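(* Let $n\ge 3$ be an odd integer and $(\mathcal{C},\Sigma)$ a tensor $n$-angulated category, with Grothendieck ring $K_0(\mathcal{C})$ (multiplication $[A][B]=[A\otimes B]$). Then the maps $\mathcal{A}\mapsto\operatorname{Im}K_0(\mathcal{A})$ and $H\mapsto\mathcal{A}_H$ give mutually inverse bijections (a) between the set of $n$-angulated tensor ideals of $\mathcal{C}$ that are both complete and dense and the set of ideals of the ring $K_0(\mathcal{C})$; and (b) between the set of $n$-angulated tensor prime ideals of $\mathcal{C}$ that are both complete and dense and the set of prime ideals of $K_0(\mathcal{C})$. Here $\mathcal{A}_H$ is the full subcategory of $\mathcal{C}$ consisting of the objects $A$ with $[A]\in H$ (with $n$-angles the $n$-angles of $\mathcal{C}$ all of whose objects lie in $\mathcal{A}_H$).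
   Context: All categories are small. Fix an integer $n\ge 3$. Let $\mathcal{C}$ be an additive category with an automorphism $\Sigma$. An $n$-$\Sigma$-sequence in $\mathcal{C}$ is a diagram $A_1\xrightarrow{\alpha_1}A_2\xrightarrow{\alpha_2}\cdots\xrightarrow{\alpha_{n-1}}A_n\xrightarrow{\alpha_n}\Sigma A_1$. Its left rotation is $A_2\xrightarrow{\alpha_2}\cdots\xrightarrow{\alpha_n}\Sigma A_1\xrightarrow{(-1)^n\Sigma\alpha_1}\Sigma A_2$. A morphism from $(A_\bullet,\alpha)$ to $(B_\bullet,\beta)$ is a tuple $(\varphi_1,\dots,\varphi_n)$, $\varphi_i:A_i\to B_i$, with $\beta_i\varphi_i=\varphi_{i+1}\alpha_i$ for $1\le i\le n-1$ and $\beta_n\varphi_n=(\Sigma\varphi_1)\alpha_n$; it is an isomorphism if all $\varphi_i$ are isomorphisms. Direct sums of sequences are taken termwise. $(\mathcal{C},\Sigma)$ is $n$-angulated if it is equipped with a collection $\mathscr N$ of $n$-$\Sigma$-sequences, called $n$-angles, such that: (N1)(a) $\mathscr N$ is closed under direct sums, direct summands and isomorphisms of $n$-$\Sigma$-sequences; (b) for every object $A$, the trivial sequence $A\xrightarrow{1}A\to0\to\cdots\to0\to\Sigma A$ is in $\mathscr N$; (c) every morphism $A_1\to A_2$ is the first morphism of some $n$-angle; (N2) an $n$-$\Sigma$-sequence is in $\mathscr N$ iff its left rotation is; (N3) given $n$-angles $(A_\bullet,\alpha),(B_\bullet,\beta)$ and $\varphi_1:A_1\to B_1$, $\varphi_2:A_2\to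 B_2$ with $\beta_1\varphi_1=\varphi_2\alpha_1$, there exist $\varphi_3,\dots,\varphi_n$ making $(\varphi_1,\dots,\varphi_n)$ a morphism; (N4) in (N3) the $\varphi_i$ can be chosen so that the mapping cone $A_2\oplus B_1\to A_3\oplus B_2\to\cdots\to\Sigma A_1\oplus B_n\to\Sigma A_2\oplus\Sigma B_1$, with maps $\left[\begin{smallmatrix}-\alpha_{i+1}&0\\ \varphi_{i+1}&\beta_i\end{smallmatrix}\right]$ ($1\le i\le n-1$) and last map $\left[\begin{smallmatrix}-\Sigma\alpha_1&0\\ \Sigma\varphi_1&\beta_n\end{smallmatrix}\right]$, is an $n$-angle. Grothendieck group: $F(\mathcal{C})$ is the free abelian group on isomorphism classes $\langle A\rangle$ of objects; for an $n$-angle $A_\bullet$, $\chi(A_\bullet)=\sum_{i=1}^n(-1)^{i+1}\langle A_i\rangle$; $R(\mathcal{C})$ is generated by all $\chi(A_\bullet)$, together with $\langle 0\rangle$ when $n$ is even; $K_0(\mathcal{C})=F(\mathcal{C})/R(\mathcal{C})$, $[A]$ the class of $\langle A\rangle$. An $n$-angulated category $(\mathcal{C},\Sigma)$ is tensor $n$-angulated if it carries a symmetric monoidal structure $(\otimes,I,\alpha,\lambda,\rho,\gamma)$ with $\otimes$ an additive bifunctor, such that: (1) there are natural isomorphisms $l:A\otimes\Sigma B\to\Sigma(A\otimes B)$ and $r:\Sigma A\otimes B\to\Sigma(A\otimes B)$; (2) for every object $A$ and every $n$-angle $A_1\xrightarrow{\alpha_1}\cdots\xrightarrow{\alpha_{n-1}}A_n\xrightarrow{\alpha_n}\Sigma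 A_1$, the sequences $A\otimes A_1\xrightarrow{1\otimes\alpha_1}\cdots\xrightarrow{1\otimes\alpha_{n-1}}A\otimes A_n\xrightarrow{l\circ(1\otimes\alpha_n)}\Sigma(A\otimes A_1)$ and $A_1\otimes A\xrightarrow{\alpha_1\otimes1}\cdots\xrightarrow{\alpha_{n-1}\otimes1}A_n\otimes A\xrightarrow{r\circ(\alpha_n\otimes1)}\Sigma(A_1\otimes A)$ are $n$-angles; (3) $\lambda_{\Sigma A}=\Sigma\lambda_A\circ l$ and $\rho_{\Sigma A}=\Sigma\rho_A\circ r$; (4) $\Sigma l\circ r=-\,\Sigma r\circ l$ as maps $\Sigma A\otimes\Sigma B\to\Sigma^2(A\otimes B)$. For $n$ odd, $K_0(\mathcal{C})$ is a commutative ring with $[A][B]=[A\otimes B]$. An additive functor $L:\mathcal{C}\to\mathcal{C}'$ between $n$-angulated categories is $n$-angulated if there is a natural isomorphism $\eta:L\circ\Sigma\to\Sigma'\circ L$ such that $L$ sends each $n$-angle $(A_\bullet,\alpha)$ to the $n$-angle $LA_1\xrightarrow{L\alpha_1}\cdots\xrightarrow{L\alpha_{n-1}}LA_n\xrightarrow{\eta\circ L\alpha_n}\Sigma'LA_1$. An $n$-angulated subcategory of $(\mathcal{C},\Sigma)$ is a full subcategory $\mathcal{A}$, closed under isomorphisms, on which $\Sigma$ restricts to an automorphism, equipped with $n$-angles making $(\mathcal{A},\Sigma)$ $n$-angulated, such that the inclusion $\mathcal{A}\to\mathcal{C}$ is $n$-angulated. $\mathcal{A}$ is dense if every object of $\mathcal{C}$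 is a direct summand of an object of $\mathcal{A}$; complete if whenever an $n$-angle $A_1\to\cdots\to A_n\to\Sigma A_1$ in $\mathcal{C}$ has $n-1$ of $A_1,\dots,A_n$ in $\mathcal{A}$, the remaining one is in $\mathcal{A}$. An $n$-angulated tensor ideal is an $n$-angulated subcategory $\mathcal{A}$ such that $C\otimes A\in\mathcal{A}$ for all $A\in\mathcal{A}$, $C\in\mathcal{C}$; it is an $n$-angulated tensor prime ideal if moreover $C\otimes C'\in\mathcal{A}$ (for $C,C'\in\mathcal{C}$) implies $C\in\mathcal{A}$ or $C'\in\mathcal{A}$. $\operatorname{Im}K_0(\mathcal{A})$ is the image of the homomorphism $K_0(\mathcal{A})\to K_0(\mathcal{C})$, $[A]\mapsto[A]$, induced by the inclusion.
   Formalization: In (b) tensor prime ideals are required to be proper (different from the whole category), since otherwise the whole category would map to the non-prime ideal K_0(C); tensor ideals are identified with their underlying full subcategories, not counted with a choice of n-angles. *)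

theory Defs
  imports "HOL-Algebra.QuotRing" "HOL-Algebra.Generated_Groups"
begin

text \<open>A small category with explicit object set and arrow set; arrows carry source and
target. Composition is written cmp g f for "g after f". Hom-sets carry the additive
structure pls / zro / ngt.\<close>

record ('o, 'm) cat =
  obj :: "'o set"
  arr :: "'m set"
  src :: "'m \<Rightarrow> 'o"
  tgt :: "'m \<Rightarrow> 'o"
  cmp :: "'m \<Rightarrow> 'm \<Rightarrow> 'm"
  idm :: "'o \<Rightarrow> 'm"
  pls :: "'m \<Rightarrow> 'm \<Rightarrow> 'm"
  zro :: "'o \<Rightarrow> 'o \<Rightarrow> 'm"
  ngt :: "'m \<Rightarrow> 'm"

definition hom :: "('o, 'm, 'x) cat_scheme \<Rightarrow> 'o \<Rightarrow> 'o \<Rightarrow> 'm set" where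
  "hom C A B = {f \<in> arr C. src C f = A \<and> tgt C f = B}"

definition is_category :: "('o, 'm, 'x) cat_scheme \<Rightarrow> bool" where
  "is_category C \<longleftrightarrow>
     (\<forall>f \<in> arr C. src C f \<in> obj C \<and> tgt C f \<in> obj C) \<and>
     (\<forall>A \<in> obj C. idm C A \<in> hom C A A) \<and>
     (\<forall>A \<in> obj C. \<forall>B \<in> obj C. \<forall>D \<in> obj C. \<forall>f \<in> hom C A B. \<forall>g \<in> hom C B D.
        cmp C g f \<in> hom C A D) \<and>
     (\<forall>A \<in> obj C. \<forall>B \<in> obj C. \<forall>f \<in> hom C A B.
        cmp C f (idm C A) = f \<and> cmp C (idm C B) f = f) \<and>
     (\<forall>A \<in> obj C. \<forall>B \<in> obj C. \<forall>D \<in> obj C. \<forall>E \<in> obj C.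
      \<forall>f \<in> hom C A B. \<forall>g \<in> hom C B D. \<forall>h \<in> hom C D E.
        cmp C h (cmp C g f) = cmp C (cmp C h g) f)"

definition is_preadditive :: "('o, 'm, 'x) cat_scheme \<Rightarrow> bool" where
  "is_preadditive C \<longleftrightarrow> is_category C \<and>
     (\<forall>A \<in> obj C. \<forall>B \<in> obj C.
        zro C A B \<in> hom C A B \<and>
        (\<forall>f \<in> hom C A B. \<forall>g \<in> hom C A B. pls C f g \<in> hom C A B) \<and>
        (\<forall>f \<in> hom C A B. ngt C f \<in> hom C A B) \<and>
        (\<forall>f \<in> hom C A B. \<forall>g \<in> hom C A B. \<forall>h \<in> hom C A B.
           pls C (pls C f g) h = pls C f (pls C g h)) \<and>
        (\<forall>f \<in> hom C A B. \<forall>g \<in> hom C A B. pls C f g = pls C g f) \<and>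
        (\<forall>f \<in> hom C A B. pls C f (zro C A B) = f) \<and>
        (\<forall>f \<in> hom C A B. pls C f (ngt C f) = zro C A B)) \<and>
     (\<forall>A \<in> obj C. \<forall>B \<in> obj C. \<forall>D \<in> obj C.
        (\<forall>f \<in> hom C A B. \<forall>g \<in> hom C B D. \<forall>g' \<in> hom C B D.
           cmp C (pls C g g') f = pls C (cmp C g f) (cmp C g' f)) \<and>
        (\<forall>f \<in> hom C A B. \<forall>f' \<in> hom C A B. \<forall>g \<in> hom C B D.
           cmp C g (pls C f f') = pls C (cmp C g f) (cmp C g f')))"

definition is_zero_obj :: "('o, 'm, 'x) cat_scheme \<Rightarrow> 'o \<Rightarrow> bool" where
  "is_zero_obj C Z \<longleftrightarrow> Z \<in> obj C \<and>
     (\<forall>A \<in> obj C. (\<exists>!f. f \<in> hom C Z A) \<and> (\<exists>!f. f \<in> hom C A Z))"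

definition biprod :: "('o, 'm, 'x) cat_scheme \<Rightarrow> 'o \<Rightarrow> 'o \<Rightarrow> 'o \<Rightarrow>
    'm \<Rightarrow> 'm \<Rightarrow> 'm \<Rightarrow> 'm \<Rightarrow> bool" where
  "biprod C A B S i1 i2 p1 p2 \<longleftrightarrow>
     A \<in> obj C \<and> B \<in> obj C \<and> S \<in> obj C \<and>
     i1 \<in> hom C A S \<and> i2 \<in> hom C B S \<and> p1 \<in> hom C S A \<and> p2 \<in> hom C S B \<and>
     cmp C p1 i1 = idm C A \<and> cmp C p2 i2 = idm C B \<and>
     cmp C p1 i2 = zro C B A \<and> cmp C p2 i1 = zro C A B \<and>
     pls C (cmp C i1 p1) (cmp C i2 p2) = idm C S"

definition is_additive :: "('o, 'm, 'x) cat_scheme \<Rightarrow> bool" where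
  "is_additive C \<longleftrightarrow> is_preadditive C \<and> (\<exists>Z. is_zero_obj C Z) \<and>
     (\<forall>A \<in> obj C. \<forall>B \<in> obj C. \<exists>S i1 i2 p1 p2. biprod C A B S i1 i2 p1 p2)"

definition is_iso :: "('o, 'm, 'x) cat_scheme \<Rightarrow> 'm \<Rightarrow> bool" where
  "is_iso C f \<longleftrightarrow> f \<in> arr C \<and>
     (\<exists>g \<in> hom C (tgt C f) (src C f).
        cmp C g f = idm C (src C f) \<and> cmp C f g = idm C (tgt C f))"

definition isomorphic :: "('o, 'm, 'x) cat_scheme \<Rightarrow> 'o \<Rightarrow> 'o \<Rightarrow> bool" where
  "isomorphic C A B \<longleftrightarrow> (\<exists>f \<in> hom C A B. is_iso C f)"

definition full_sub :: "('o, 'm, 'x) cat_scheme \<Rightarrow> 'o set \<Rightarrow> ('o, 'm, 'x) cat_scheme" where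
  "full_sub C U = obj_update (\<lambda>_. U) (arr_update (\<lambda>_. {f \<in> arr C. src C f \<in> U \<and> tgt C f \<in> U}) C)"

definition is_additive_automorphism ::
    "('o, 'm, 'x) cat_scheme \<Rightarrow> ('o \<Rightarrow> 'o) \<Rightarrow> ('m \<Rightarrow> 'm) \<Rightarrow> bool" where
  "is_additive_automorphism C SO SM \<longleftrightarrow>
     bij_betw SO (obj C) (obj C) \<and> bij_betw SM (arr C) (arr C) \<and>
     (\<forall>A \<in> obj C. \<forall>B \<in> obj C. \<forall>f \<in> hom C A B. SM f \<in> hom C (SO A) (SO B)) \<and>
     (\<forall>A \<in> obj C. SM (idm C A) = idm C (SO A)) \<and>
     (\<forall>A \<in> obj C. \<forall>B \<in> obj C. \<forall>D \<in> obj C. \<forall>f \<in> hom C A B. \<forall>g \<in> hom C B D.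
        SM (cmp C g f) = cmp C (SM g) (SM f)) \<and>
     (\<forall>A \<in> obj C. \<forall>B \<in> obj C. \<forall>f \<in> hom C A B. \<forall>g \<in> hom C A B.
        SM (pls C f g) = pls C (SM f) (SM g))"

text \<open>An n-Sigma-sequence is a pair (A, a) of an object family and a morphism family
indexed by 1..n: a i : A i \<rightarrow> A (i+1) for 1 \<le> i < n, and a n : A n \<rightarrow> \<Sigma> (A 1).
Values outside 1..n are irrelevant.\<close>

type_synonym ('o, 'm) nseq = "(nat \<Rightarrow> 'o) \<times> (nat \<Rightarrow> 'm)"

definition is_nseq :: "('o, 'm, 'x) cat_scheme \<Rightarrow> ('o \<Rightarrow> 'o) \<Rightarrow> nat \<Rightarrow> ('o, 'm) nseq \<Rightarrow> bool" where
  "is_nseq C SO n U \<longleftrightarrow>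
     (\<forall>i \<in> {1..n}. fst U i \<in> obj C) \<and>
     (\<forall>i \<in> {1..<n}. snd U i \<in> hom C (fst U i) (fst U (Suc i))) \<and>
     snd U n \<in> hom C (fst U n) (SO (fst U 1))"

definition nseq_mor :: "('o, 'm, 'x) cat_scheme \<Rightarrow> ('m \<Rightarrow> 'm) \<Rightarrow> nat \<Rightarrow>
    ('o, 'm) nseq \<Rightarrow> ('o, 'm) nseq \<Rightarrow> (nat \<Rightarrow> 'm) \<Rightarrow> bool" where
  "nseq_mor C SM n U Y \<phi> \<longleftrightarrow>
     (\<forall>i \<in> {1..n}. \<phi> i \<in> hom C (fst U i) (fst Y i)) \<and>
     (\<forall>i \<in> {1..<n}. cmp C (snd Y i) (\<phi> i) = cmp C (\<phi> (Suc i)) (snd U i)) \<and>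
     cmp C (snd Y n) (\<phi> n) = cmp C (SM (\<phi> 1)) (snd U n)"

definition nseq_iso :: "('o, 'm, 'x) cat_scheme \<Rightarrow> ('m \<Rightarrow> 'm) \<Rightarrow> nat \<Rightarrow>
    ('o, 'm) nseq \<Rightarrow> ('o, 'm) nseq \<Rightarrow> (nat \<Rightarrow> 'm) \<Rightarrow> bool" where
  "nseq_iso C SM n U Y \<phi> \<longleftrightarrow> nseq_mor C SM n U Y \<phi> \<and> (\<forall>i \<in> {1..n}. is_iso C (\<phi> i))"

definition rot :: "('o, 'm, 'x) cat_scheme \<Rightarrow> ('o \<Rightarrow> 'o) \<Rightarrow> ('m \<Rightarrow> 'm) \<Rightarrow> nat \<Rightarrow>
    ('o, 'm) nseq \<Rightarrow> ('o, 'm) nseq" where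
  "rot C SO SM n U =
     ((\<lambda>i. if i < n then fst U (Suc i) else SO (fst U 1)),
      (\<lambda>i. if i < n then snd U (Suc i)
           else (if even n then SM (snd U 1) else ngt C (SM (snd U 1)))))"

definition nseq_dsum :: "('o, 'm, 'x) cat_scheme \<Rightarrow> ('m \<Rightarrow> 'm) \<Rightarrow> nat \<Rightarrow>
    ('o, 'm) nseq \<Rightarrow> ('o, 'm) nseq \<Rightarrow> ('o, 'm) nseq \<Rightarrow> bool" where
  "nseq_dsum C SM n U Y Z \<longleftrightarrow>
     (\<exists>i1 i2 p1 p2.
        (\<forall>k \<in> {1..n}. biprod C (fst U k) (fst Y k) (fst Z k) (i1 k) (i2 k) (p1 k) (p2 k)) \<and>
        (\<forall>k \<in> {1..<n}. snd Z k =
            pls C (cmp C (i1 (Suc k)) (cmp C (snd U k) (p1 k)))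
                  (cmp C (i2 (Suc k)) (cmp C (snd Y k) (p2 k)))) \<and>
        snd Z n =
            pls C (cmp C (SM (i1 1)) (cmp C (snd U n) (p1 n)))
                  (cmp C (SM (i2 1)) (cmp C (snd Y n) (p2 n))))"

definition triv_nseq :: "('o, 'm, 'x) cat_scheme \<Rightarrow> ('o \<Rightarrow> 'o) \<Rightarrow> nat \<Rightarrow> 'o \<Rightarrow> 'o \<Rightarrow>
    ('o, 'm) nseq" where
  "triv_nseq C SO n Z A =
     ((\<lambda>i. if i \<le> 2 then A else Z),
      (\<lambda>i. if i = 1 then idm C A
           else if i = 2 then zro C A Z
           else if i < n then zro C Z Z
           else zro C Z (SO A)))"

text \<open>Mapping cone of (\<phi>_1,...,\<phi>_n) : U \<rightarrow> Y, with chosen biproducts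
D i = (rot U)_i \<oplus> Y_i (injections j1 j2, projections q1 q2); the last term
\<Sigma>A_2 \<oplus> \<Sigma>B_1 is \<Sigma>(D 1) with the induced biproduct structure.\<close>
definition cone :: "('o, 'm, 'x) cat_scheme \<Rightarrow> ('o \<Rightarrow> 'o) \<Rightarrow> ('m \<Rightarrow> 'm) \<Rightarrow> nat \<Rightarrow>
    ('o, 'm) nseq \<Rightarrow> ('o, 'm) nseq \<Rightarrow> (nat \<Rightarrow> 'm) \<Rightarrow>
    (nat \<Rightarrow> 'o) \<Rightarrow> (nat \<Rightarrow> 'm) \<Rightarrow> (nat \<Rightarrow> 'm) \<Rightarrow> (nat \<Rightarrow> 'm) \<Rightarrow> (nat \<Rightarrow> 'm) \<Rightarrow>
    ('o, 'm) nseq" where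
  "cone C SO SM n U Y \<phi> D j1 j2 q1 q2 =
     (D,
      (\<lambda>i. if i < n then
             pls C (pls C (cmp C (j1 (Suc i)) (cmp C (ngt C (snd U (Suc i))) (q1 i)))
                          (cmp C (j2 (Suc i)) (cmp C (\<phi> (Suc i)) (q1 i))))
                   (cmp C (j2 (Suc i)) (cmp C (snd Y i) (q2 i)))
           else
             pls C (pls C (cmp C (SM (j1 1)) (cmp C (ngt C (SM (snd U 1))) (q1 n)))
                          (cmp C (SM (j2 1)) (cmp C (SM (\<phi> 1)) (q1 n))))
                   (cmp C (SM (j2 1)) (cmp C (snd Y n) (q2 n)))))"

definition is_cone_data :: "('o, 'm, 'x) cat_scheme \<Rightarrow> ('o \<Rightarrow> 'o) \<Rightarrow> ('m \<Rightarrow> 'm) \<Rightarrow> nat \<Rightarrow>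
    ('o, 'm) nseq \<Rightarrow> ('o, 'm) nseq \<Rightarrow>
    (nat \<Rightarrow> 'o) \<Rightarrow> (nat \<Rightarrow> 'm) \<Rightarrow> (nat \<Rightarrow> 'm) \<Rightarrow> (nat \<Rightarrow> 'm) \<Rightarrow> (nat \<Rightarrow> 'm) \<Rightarrow> bool" where
  "is_cone_data C SO SM n U Y D j1 j2 q1 q2 \<longleftrightarrow>
     (\<forall>i \<in> {1..n}. biprod C (fst (rot C SO SM n U) i) (fst Y i) (D i) (j1 i) (j2 i) (q1 i) (q2 i))"

definition n_angulated :: "('o, 'm, 'x) cat_scheme \<Rightarrow> ('o \<Rightarrow> 'o) \<Rightarrow> ('m \<Rightarrow> 'm) \<Rightarrow> nat \<Rightarrow>
    ('o, 'm) nseq set \<Rightarrow> bool" where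
  "n_angulated C SO SM n N \<longleftrightarrow>
     is_additive C \<and> is_additive_automorphism C SO SM \<and>
     (\<forall>U \<in> N. is_nseq C SO n U) \<and>
     \<comment> \<open>(N1)(a)\<close>
     (\<forall>U \<in> N. \<forall>Y \<in> N. \<forall>Z. is_nseq C SO n Z \<and> nseq_dsum C SM n U Y Z \<longrightarrow> Z \<in> N) \<and>
     (\<forall>U Y Z. is_nseq C SO n U \<and> is_nseq C SO n Y \<and> Z \<in> N \<and> nseq_dsum C SM n U Y Z \<longrightarrow> U \<in> N) \<and>
     (\<forall>U \<in> N. \<forall>Y \<phi>. is_nseq C SO n Y \<and> nseq_iso C SM n U Y \<phi> \<longrightarrow> Y \<in> N) \<and>
     \<comment> \<open>(N1)(b)\<close>
     (\<forall>A \<in> obj C. \<forall>Z. is_zero_obj C Z \<longrightarrow> triv_nseq C SO n Z A \<in> N) \<and>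
     \<comment> \<open>(N1)(c)\<close>
     (\<forall>A1 \<in> obj C. \<forall>A2 \<in> obj C. \<forall>f \<in> hom C A1 A2.
        \<exists>U \<in> N. fst U 1 = A1 \<and> fst U 2 = A2 \<and> snd U 1 = f) \<and>
     \<comment> \<open>(N2)\<close>
     (\<forall>U. is_nseq C SO n U \<longrightarrow> (U \<in> N \<longleftrightarrow> rot C SO SM n U \<in> N)) \<and>
     \<comment> \<open>(N3)\<close>
     (\<forall>U \<in> N. \<forall>Y \<in> N. \<forall>f1 f2.
        f1 \<in> hom C (fst U 1) (fst Y 1) \<and> f2 \<in> hom C (fst U 2) (fst Y 2) \<and>
        cmp C (snd Y 1) f1 = cmp C f2 (snd U 1) \<longrightarrow>
        (\<exists>\<phi>. \<phi> 1 = f1 \<and> \<phi> 2 = f2 \<and> nseq_mor C SM n U Y \<phi>)) \<and>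
     \<comment> \<open>(N4)\<close>
     (\<forall>U \<in> N. \<forall>Y \<in> N. \<forall>f1 f2.
        f1 \<in> hom C (fst U 1) (fst Y 1) \<and> f2 \<in> hom C (fst U 2) (fst Y 2) \<and>
        cmp C (snd Y 1) f1 = cmp C f2 (snd U 1) \<longrightarrow>
        (\<exists>\<phi>. \<phi> 1 = f1 \<and> \<phi> 2 = f2 \<and> nseq_mor C SM n U Y \<phi> \<and>
           (\<forall>D j1 j2 q1 q2. is_cone_data C SO SM n U Y D j1 j2 q1 q2 \<longrightarrow>
              cone C SO SM n U Y \<phi> D j1 j2 q1 q2 \<in> N)))"

record ('o, 'm) tensor =
  tob :: "'o \<Rightarrow> 'o \<Rightarrow> 'o"
  tar :: "'m \<Rightarrow> 'm \<Rightarrow> 'm"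
  tunit :: "'o"
  tassoc :: "'o \<Rightarrow> 'o \<Rightarrow> 'o \<Rightarrow> 'm"   \<comment> \<open>(A \<otimes> B) \<otimes> D \<rightarrow> A \<otimes> (B \<otimes> D)\<close>
  tlam :: "'o \<Rightarrow> 'm"                    \<comment> \<open>I \<otimes> A \<rightarrow> A\<close>
  trho :: "'o \<Rightarrow> 'm"                    \<comment> \<open>A \<otimes> I \<rightarrow> A\<close>
  tsym :: "'o \<Rightarrow> 'o \<Rightarrow> 'm"             \<comment> \<open>A \<otimes> B \<rightarrow> B \<otimes> A\<close>
  tshl :: "'o \<Rightarrow> 'o \<Rightarrow> 'm"               \<comment> \<open>l : A \<otimes> \<Sigma>B \<rightarrow> \<Sigma>(A \<otimes> B)\<close>
  tshr :: "'o \<Rightarrow> 'o \<Rightarrow> 'm"               \<comment> \<open>r : \<Sigma>A \<otimes> B \<rightarrow> \<Sigma>(A \<otimes> B)\<close>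

definition symmetric_monoidal :: "('o, 'm, 'x) cat_scheme \<Rightarrow> ('o, 'm) tensor \<Rightarrow> bool" where
  "symmetric_monoidal C T \<longleftrightarrow>
     (let ob = tob T; ar = tar T; c = cmp C; I = tunit T in
     \<comment> \<open>additive bifunctor\<close>
     (\<forall>A \<in> obj C. \<forall>B \<in> obj C. ob A B \<in> obj C) \<and>
     (\<forall>A \<in> obj C. \<forall>A' \<in> obj C. \<forall>B \<in> obj C. \<forall>B' \<in> obj C.
        \<forall>f \<in> hom C A A'. \<forall>g \<in> hom C B B'. ar f g \<in> hom C (ob A B) (ob A' B')) \<and>
     (\<forall>A \<in> obj C. \<forall>B \<in> obj C. ar (idm C A) (idm C B) = idm C (ob A B)) \<and>
     (\<forall>A \<in> obj C. \<forall>A' \<in> obj C. \<forall>A'' \<in> obj C. \<forall>B \<in> obj C. \<forall>B' \<in> obj C. \<forall>B'' \<in> obj C.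
        \<forall>f \<in> hom C A A'. \<forall>f' \<in> hom C A' A''. \<forall>g \<in> hom C B B'. \<forall>g' \<in> hom C B' B''.
          ar (c f' f) (c g' g) = c (ar f' g') (ar f g)) \<and>
     (\<forall>A \<in> obj C. \<forall>A' \<in> obj C. \<forall>B \<in> obj C. \<forall>B' \<in> obj C.
        \<forall>f \<in> hom C A A'. \<forall>f' \<in> hom C A A'. \<forall>g \<in> hom C B B'.
          ar (pls C f f') g = pls C (ar f g) (ar f' g) \<and>
          ar g (pls C f f') = pls C (ar g f) (ar g f')) \<and>
     \<comment> \<open>unit and structure isomorphisms\<close>
     I \<in> obj C \<and>
     (\<forall>A \<in> obj C. \<forall>B \<in> obj C. \<forall>D \<in> obj C.
        tassoc T A B D \<in> hom C (ob (ob A B) D) (ob A (ob B D)) \<and> is_iso C (tassoc T A B D)) \<and>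
     (\<forall>A \<in> obj C. tlam T A \<in> hom C (ob I A) A \<and> is_iso C (tlam T A)) \<and>
     (\<forall>A \<in> obj C. trho T A \<in> hom C (ob A I) A \<and> is_iso C (trho T A)) \<and>
     (\<forall>A \<in> obj C. \<forall>B \<in> obj C. tsym T A B \<in> hom C (ob A B) (ob B A) \<and> is_iso C (tsym T A B)) \<and>
     \<comment> \<open>naturality\<close>
     (\<forall>A \<in> obj C. \<forall>A' \<in> obj C. \<forall>B \<in> obj C. \<forall>B' \<in> obj C. \<forall>D \<in> obj C. \<forall>D' \<in> obj C.
        \<forall>f \<in> hom C A A'. \<forall>g \<in> hom C B B'. \<forall>h \<in> hom C D D'.
          c (tassoc T A' B' D') (ar (ar f g) h) = c (ar f (ar g h)) (tassoc T A B D)) \<and>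
     (\<forall>A \<in> obj C. \<forall>A' \<in> obj C. \<forall>f \<in> hom C A A'.
        c (tlam T A') (ar (idm C I) f) = c f (tlam T A) \<and>
        c (trho T A') (ar f (idm C I)) = c f (trho T A)) \<and>
     (\<forall>A \<in> obj C. \<forall>A' \<in> obj C. \<forall>B \<in> obj C. \<forall>B' \<in> obj C.
        \<forall>f \<in> hom C A A'. \<forall>g \<in> hom C B B'.
          c (tsym T A' B') (ar f g) = c (ar g f) (tsym T A B)) \<and>
     \<comment> \<open>pentagon\<close>
     (\<forall>A \<in> obj C. \<forall>B \<in> obj C. \<forall>D \<in> obj C. \<forall>E \<in> obj C.
        c (tassoc T A B (ob D E)) (tassoc T (ob A B) D E) =
        c (ar (idm C A) (tassoc T B D E)) (c (tassoc T A (ob B D) E) (ar (tassoc T A B D) (idm C E)))) \<and>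
     \<comment> \<open>triangle\<close>
     (\<forall>A \<in> obj C. \<forall>B \<in> obj C.
        c (ar (idm C A) (tlam T B)) (tassoc T A I B) = ar (trho T A) (idm C B)) \<and>
     \<comment> \<open>symmetry\<close>
     (\<forall>A \<in> obj C. \<forall>B \<in> obj C. c (tsym T B A) (tsym T A B) = idm C (ob A B)) \<and>
     \<comment> \<open>hexagon\<close>
     (\<forall>A \<in> obj C. \<forall>B \<in> obj C. \<forall>D \<in> obj C.
        c (tassoc T B D A) (c (tsym T A (ob B D)) (tassoc T A B D)) =
        c (ar (idm C B) (tsym T A D)) (c (tassoc T B A D) (ar (tsym T A B) (idm C D)))))"

definition tensor_n_angulated :: "('o, 'm, 'x) cat_scheme \<Rightarrow> ('o \<Rightarrow> 'o) \<Rightarrow> ('m \<Rightarrow> 'm) \<Rightarrow>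
    nat \<Rightarrow> ('o, 'm) nseq set \<Rightarrow> ('o, 'm) tensor \<Rightarrow> bool" where
  "tensor_n_angulated C SO SM n N T \<longleftrightarrow>
     n_angulated C SO SM n N \<and> symmetric_monoidal C T \<and>
     \<comment> \<open>(1) natural isomorphisms l and r\<close>
     (\<forall>A \<in> obj C. \<forall>B \<in> obj C.
        tshl T A B \<in> hom C (tob T A (SO B)) (SO (tob T A B)) \<and> is_iso C (tshl T A B) \<and>
        tshr T A B \<in> hom C (tob T (SO A) B) (SO (tob T A B)) \<and> is_iso C (tshr T A B)) \<and>
     (\<forall>A \<in> obj C. \<forall>A' \<in> obj C. \<forall>B \<in> obj C. \<forall>B' \<in> obj C.
        \<forall>f \<in> hom C A A'. \<forall>g \<in> hom C B B'.
          cmp C (tshl T A' B') (tar T f (SM g)) = cmp C (SM (tar T f g)) (tshl T A B) \<and>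
          cmp C (tshr T A' B') (tar T (SM f) g) = cmp C (SM (tar T f g)) (tshr T A B)) \<and>
     \<comment> \<open>(2) tensoring with an object preserves n-angles\<close>
     (\<forall>A \<in> obj C. \<forall>U \<in> N.
        ((\<lambda>i. tob T A (fst U i)),
         (\<lambda>i. if i < n then tar T (idm C A) (snd U i)
              else cmp C (tshl T A (fst U 1)) (tar T (idm C A) (snd U n)))) \<in> N \<and>
        ((\<lambda>i. tob T (fst U i) A),
         (\<lambda>i. if i < n then tar T (snd U i) (idm C A)
              else cmp C (tshr T (fst U 1) A) (tar T (snd U n) (idm C A)))) \<in> N) \<and>
     \<comment> \<open>(3)\<close>
     (\<forall>A \<in> obj C.
        tlam T (SO A) = cmp C (SM (tlam T A)) (tshl T (tunit T) A) \<and>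
        trho T (SO A) = cmp C (SM (trho T A)) (tshr T A (tunit T))) \<and>
     \<comment> \<open>(4)\<close>
     (\<forall>A \<in> obj C. \<forall>B \<in> obj C.
        cmp C (SM (tshl T A B)) (tshr T A (SO B)) = ngt C (cmp C (SM (tshr T A B)) (tshl T (SO A) B)))"

text \<open>(U, NX) is an n-angulated subcategory of C: a full, isomorphism-closed subcategory
on the object set U, on which \<Sigma> restricts to an automorphism, with n-angles NX making it
n-angulated, such that the inclusion is an n-angulated functor (with some natural
isomorphism \<eta> from \<Sigma> to \<Sigma> on U).\<close>
definition n_ang_subcat :: "('o, 'm, 'x) cat_scheme \<Rightarrow> ('o \<Rightarrow> 'o) \<Rightarrow> ('m \<Rightarrow> 'm) \<Rightarrow> nat \<Rightarrow>
    ('o, 'm) nseq set \<Rightarrow> 'o set \<Rightarrow> ('o, 'm) nseq set \<Rightarrow> bool" where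
  "n_ang_subcat C SO SM n N U NX \<longleftrightarrow>
     U \<subseteq> obj C \<and>
     (\<forall>A \<in> U. \<forall>B \<in> obj C. isomorphic C A B \<longrightarrow> B \<in> U) \<and>
     bij_betw SO U U \<and>
     n_angulated (full_sub C U) SO SM n NX \<and>
     (\<exists>\<eta>. (\<forall>A \<in> U. \<eta> A \<in> hom C (SO A) (SO A) \<and> is_iso C (\<eta> A)) \<and>
          (\<forall>A \<in> U. \<forall>B \<in> U. \<forall>f \<in> hom C A B. cmp C (\<eta> B) (SM f) = cmp C (SM f) (\<eta> A)) \<and>
          (\<forall>Y \<in> NX. (fst Y, (snd Y)(n := cmp C (\<eta> (fst Y 1)) (snd Y n))) \<in> N))"

definition n_ang_tensor_ideal :: "('o, 'm, 'x) cat_scheme \<Rightarrow> ('o \<Rightarrow> 'o) \<Rightarrow> ('m \<Rightarrow> 'm) \<Rightarrow>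
    nat \<Rightarrow> ('o, 'm) nseq set \<Rightarrow> ('o, 'm) tensor \<Rightarrow> 'o set \<Rightarrow> ('o, 'm) nseq set \<Rightarrow> bool" where
  "n_ang_tensor_ideal C SO SM n N T U NX \<longleftrightarrow>
     n_ang_subcat C SO SM n N U NX \<and> (\<forall>A \<in> U. \<forall>B \<in> obj C. tob T B A \<in> U)"

definition n_ang_tensor_prime_ideal :: "('o, 'm, 'x) cat_scheme \<Rightarrow> ('o \<Rightarrow> 'o) \<Rightarrow> ('m \<Rightarrow> 'm) \<Rightarrow>
    nat \<Rightarrow> ('o, 'm) nseq set \<Rightarrow> ('o, 'm) tensor \<Rightarrow> 'o set \<Rightarrow> ('o, 'm) nseq set \<Rightarrow> bool" where
  "n_ang_tensor_prime_ideal C SO SM n N T U NX \<longleftrightarrow>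
     n_ang_tensor_ideal C SO SM n N T U NX \<and> U \<noteq> obj C \<and>
     (\<forall>A \<in> obj C. \<forall>B \<in> obj C. tob T A B \<in> U \<longrightarrow> A \<in> U \<or> B \<in> U)"

definition subcat_dense :: "('o, 'm, 'x) cat_scheme \<Rightarrow> 'o set \<Rightarrow> bool" where
  "subcat_dense C U \<longleftrightarrow>
     (\<forall>A \<in> obj C. \<exists>S \<in> U. \<exists>B i1 i2 p1 p2. biprod C A B S i1 i2 p1 p2)"

definition subcat_complete :: "nat \<Rightarrow> ('o, 'm) nseq set \<Rightarrow> 'o set \<Rightarrow> bool" where
  "subcat_complete n N U \<longleftrightarrow>
     (\<forall>Y \<in> N. \<forall>j \<in> {1..n}. (\<forall>i \<in> {1..n} - {j}. fst Y i \<in> U) \<longrightarrow> fst Y j \<in> U)"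

definition angles_in :: "nat \<Rightarrow> ('o, 'm) nseq set \<Rightarrow> 'o set \<Rightarrow> ('o, 'm) nseq set" where
  "angles_in n N U = {Y \<in> N. \<forall>i \<in> {1..n}. fst Y i \<in> U}"

definition isocls :: "('o, 'm, 'x) cat_scheme \<Rightarrow> 'o \<Rightarrow> 'o set" where
  "isocls C A = {B \<in> obj C. isomorphic C A B}"

definition Fcarrier :: "('o, 'm, 'x) cat_scheme \<Rightarrow> ('o set \<Rightarrow> int) set" where
  "Fcarrier C = {f. finite {c. f c \<noteq> 0} \<and> (\<forall>c. f c \<noteq> 0 \<longrightarrow> c \<in> isocls C ` obj C)}"

definition gen :: "('o, 'm, 'x) cat_scheme \<Rightarrow> 'o \<Rightarrow> 'o set \<Rightarrow> int" where
  "gen C A = (\<lambda>c. if c = isocls C A then 1 else 0)"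

definition tcls :: "('o, 'm, 'x) cat_scheme \<Rightarrow> ('o, 'm) tensor \<Rightarrow> 'o set \<Rightarrow> 'o set \<Rightarrow> 'o set" where
  "tcls C T a b = isocls C (tob T (SOME A. A \<in> a) (SOME B. B \<in> b))"

definition Fring :: "('o, 'm, 'x) cat_scheme \<Rightarrow> ('o, 'm) tensor \<Rightarrow> ('o set \<Rightarrow> int) ring" where
  "Fring C T =
     \<lparr>carrier = Fcarrier C,
      mult = (\<lambda>f g c. \<Sum>p \<in> {a. f a \<noteq> 0} \<times> {b. g b \<noteq> 0}.
                 if tcls C T (fst p) (snd p) = c then f (fst p) * g (snd p) else 0),
      one = gen C (tunit T),
      zero = (\<lambda>c. 0),
      add = (\<lambda>f g c. f c + g c)\<rparr>"

definition chi :: "('o, 'm, 'x) cat_scheme \<Rightarrow> nat \<Rightarrow> ('o, 'm) nseq \<Rightarrow> 'o set \<Rightarrow> int" where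
  "chi C n U = (\<lambda>c. \<Sum>i \<in> {1..n}. if c = isocls C (fst U i) then (-1) ^ (i + 1) else 0)"

definition Rsub :: "('o, 'm, 'x) cat_scheme \<Rightarrow> nat \<Rightarrow> ('o, 'm) nseq set \<Rightarrow> ('o, 'm) tensor \<Rightarrow>
    ('o set \<Rightarrow> int) set" where
  "Rsub C n N T = generate (add_monoid (Fring C T))
      (chi C n ` N \<union> (if even n then {gen C Z | Z. is_zero_obj C Z} else {}))"

definition K0 :: "('o, 'm, 'x) cat_scheme \<Rightarrow> nat \<Rightarrow> ('o, 'm) nseq set \<Rightarrow> ('o, 'm) tensor \<Rightarrow>
    ('o set \<Rightarrow> int) set ring" where
  "K0 C n N T = FactRing (Fring C T) (Rsub C n N T)"

definition K0cls :: "('o, 'm, 'x) cat_scheme \<Rightarrow> nat \<Rightarrow> ('o, 'm) nseq set \<Rightarrow> ('o, 'm) tensor \<Rightarrow>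
    'o \<Rightarrow> ('o set \<Rightarrow> int) set" where
  "K0cls C n N T A = Rsub C n N T +>\<^bsub>Fring C T\<^esub> gen C A"

text \<open>Im K_0(U): the image of K_0(U) \<rightarrow> K_0(C). Since K_0(U) is a quotient of the free
abelian group F(U) on isomorphism classes of objects of U, this image is the set of
classes in K_0(C) of elements of F(C) supported on isomorphism classes of objects of U.\<close>
definition ImK0 :: "('o, 'm, 'x) cat_scheme \<Rightarrow> nat \<Rightarrow> ('o, 'm) nseq set \<Rightarrow> ('o, 'm) tensor \<Rightarrow>
    'o set \<Rightarrow> ('o set \<Rightarrow> int) set set" where
  "ImK0 C n N T U =
     {Rsub C n N T +>\<^bsub>Fring C T\<^esub> f | f. f \<in> Fcarrier C \<and>
        (\<forall>c. f c \<noteq> 0 \<longrightarrow> (\<exists>A \<in> U. c = isocls C A))}"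

definition subcat_of_ideal :: "('o, 'm, 'x) cat_scheme \<Rightarrow> nat \<Rightarrow> ('o, 'm) nseq set \<Rightarrow>
    ('o, 'm) tensor \<Rightarrow> ('o set \<Rightarrow> int) set set \<Rightarrow> 'o set" where
  "subcat_of_ideal C n N T H = {A \<in> obj C. K0cls C n N T A \<in> H}"

end

theory Submission
  imports Defs "HOL-Library.Function_Algebras"
begin

text \<open>
  Trivial n-angles give [A \<oplus> B] = [A] + [B] and, as n is odd, [\<Sigma>A] = -[A], so every
  element of the Grothendieck ring is the class of an object. Hence an ideal H is determined by the objects
  with class in H, and these form a complete dense subcategory, because A \<oplus> \<Sigma>A has
  class zero. A morphism between two such objects lies in an n-angle of the subcategory: add
  trivial n-angles to move the third, fourth, ... object into it; the last one follows by
  completeness.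

  Conversely let U be dense and complete, and call two objects equivalent if they become
  isomorphic after adding objects of U. By density the equivalence classes form a group, and by
  completeness the class of A is trivial iff A lies in U (Thomason's argument). Adding trivial
  n-angles to an arbitrary n-angle moves all its objects into U, so its Euler characteristic
  vanishes in this group. Therefore [A] = [B] with B in U forces A to lie in U.
\<close>

section \<open>Finitely supported integer functions\<close>

text \<open>Padding by a trivial n-angle changes two neighbouring positions k and k+1 with k < n. So
  positions 1 to n-1 can be moved into the subcategory one after the other, each step disturbing
  only the next position. The last object collects what remains and has no further neighbour; this
  is where completeness enters. The padding object occurs with opposite signs, so the Euler
  characteristic changes only by direct sum relations. Hence one construction,
  \<open>angle_fill\<close>, serves both directions: started after position 2 it keeps a given first
  morphism, started at position 1 it computes Euler characteristics in Thomason's group.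

  That group is used through the kernel of the map from the free abelian group to it. The kernel and
  \<open>Rsub\<close> are subgroups of the same free group, so they are compared by an inclusion
  that is checked on Euler characteristics. Oddness of n gives A and \<Sigma>A equal signs in the
  rotated trivial n-angle, so a formal difference of A and B is realised by the object A \<oplus>
  \<Sigma>B.\<close>

definition fsupp :: "'a set \<Rightarrow> ('a \<Rightarrow> int) set" where
  "fsupp X = {f. finite {c. f c \<noteq> 0} \<and> (\<forall>c. f c \<noteq> 0 \<longrightarrow> c \<in> X)}"

definition ind :: "'a \<Rightarrow> 'a \<Rightarrow> int" where
  "ind a = (\<lambda>c. if c = a then 1 else 0)"

text \<open>A subgroup of the additive group that the type itself carries, so that calculations are
  pointwise arithmetic; \<open>additive_subgroup_monoid_ring_iff\<close> connects it with subgroups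
  of the algebraic structure.\<close>

definition addsub :: "('a :: ab_group_add) set \<Rightarrow> bool" where
  "addsub K \<longleftrightarrow> 0 \<in> K \<and> (\<forall>f\<in>K. \<forall>g\<in>K. f - g \<in> K)"

lemma addsub_zero: "addsub K \<Longrightarrow> 0 \<in> K"
  by (simp add: addsub_def)

lemma addsub_diff: "addsub K \<Longrightarrow> f \<in> K \<Longrightarrow> g \<in> K \<Longrightarrow> f - g \<in> K"
  by (simp add: addsub_def)

lemma addsub_uminus: "addsub K \<Longrightarrow> f \<in> K \<Longrightarrow> - f \<in> K"
  by (metis addsub_def diff_0)

lemma addsub_add: "addsub K \<Longrightarrow> f \<in> K \<Longrightarrow> g \<in> K \<Longrightarrow> f + g \<in> K"
  by (metis addsub_uminus addsub_def diff_minus_eq_add)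

lemmas addsub_closed = addsub_zero addsub_diff addsub_uminus addsub_add

lemma addsub_sum: "addsub K \<Longrightarrow> (\<And>i. i \<in> I \<Longrightarrow> f i \<in> K) \<Longrightarrow> (\<Sum>i\<in>I. f i) \<in> K"
  by (induction I rule: infinite_finite_induct) (auto intro: addsub_zero addsub_add)

lemma addsub_fsupp: "addsub (fsupp X)"
  unfolding addsub_def
proof (intro conjI ballI)
  fix f g assume "f \<in> fsupp X" "g \<in> fsupp X"
  moreover have "{c. (f - g) c \<noteq> 0} \<subseteq> {c. f c \<noteq> 0} \<union> {c. g c \<noteq> 0}"
    by (auto simp: fun_diff_def)
  ultimately show "f - g \<in> fsupp X"
    unfolding fsupp_def by (auto intro: finite_subset)
qed (simp add: fsupp_def)

lemma ind_in_fsupp: "a \<in> X \<Longrightarrow> ind a \<in> fsupp X"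
  by (auto simp: fsupp_def ind_def)

lemma sum_fun_apply: "(\<Sum>i\<in>I. f i) c = (\<Sum>i\<in>I. f i c)"
  by (induction I rule: infinite_finite_induct) auto

lemma addsub_int_multiple:
  fixes f :: "'a \<Rightarrow> int"
  assumes "addsub K" and "f \<in> K"
  shows "(\<lambda>c. k * f c) \<in> K"
proof (induction k rule: int_induct[where k = 0])
  case base
  then show ?case using addsub_zero[OF assms(1)] by (simp add: zero_fun_def)
next
  case (step1 i)
  have "(\<lambda>c. (i + 1) * f c) = (\<lambda>c. i * f c) + f" by (auto simp: algebra_simps)
  then show ?case using step1 assms by (simp add: addsub_add)
next
  case (step2 i)
  have "(\<lambda>c. (i - 1) * f c) = (\<lambda>c. i * f c) - f" by (auto simp: algebra_simps)
  then show ?case using step2 assms by (simp add: addsub_diff)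
qed

text \<open>A finitely supported function is the finite sum of its values times indicators. This
  acts as the induction principle of the free abelian group: a property holds everywhere once it
  holds on indicators and the functions satisfying it form a subgroup.\<close>

lemma fsupp_subset_addsub:
  assumes K: "addsub K" and ind: "\<And>a. a \<in> X \<Longrightarrow> ind a \<in> K"
  shows "fsupp X \<subseteq> K"
proof
  fix f assume f: "f \<in> fsupp X"
  have "f = (\<Sum>a\<in>{c. f c \<noteq> 0}. (\<lambda>c. f a * ind a c))"
  proof
    fix c
    have "(\<Sum>a\<in>{c. f c \<noteq> 0}. f a * ind a c) = (\<Sum>a\<in>{c. f c \<noteq> 0}. if a = c then f a else 0)"
      by (rule sum.cong) (auto simp: ind_def)
    also have "\<dots> = f c"
      using f by (subst sum.delta) (auto simp: fsupp_def)
    finally show "f c = (\<Sum>a\<in>{c. f c \<noteq> 0}. (\<lambda>c. f a * ind a c)) c"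
      by (simp add: sum_fun_apply)
  qed
  also have "\<dots> \<in> K"
    using f by (intro addsub_sum[OF K] addsub_int_multiple[OF K] ind) (auto simp: fsupp_def)
  finally show "f \<in> K" .
qed

section \<open>Monoid rings\<close>

text \<open>Multiplication of the monoid ring. The sum has the shape of the one in
  \<open>Fring\<close>, with an arbitrary operation in the place of \<open>tcls\<close>, so that
  both agree by unfolding.\<close>

definition conv :: "('a \<Rightarrow> 'a \<Rightarrow> 'a) \<Rightarrow> ('a \<Rightarrow> int) \<Rightarrow> ('a \<Rightarrow> int) \<Rightarrow> 'a \<Rightarrow> int" where
  "conv m f g = (\<lambda>c. \<Sum>p \<in> {a. f a \<noteq> 0} \<times> {b. g b \<noteq> 0}.
      if m (fst p) (snd p) = c then f (fst p) * g (snd p) else 0)"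

text \<open>The supports of f, f' and f - f' differ, so bilinearity needs all sums over one common
  finite index set; the additional terms vanish.\<close>

lemma conv_eq_sum:
  assumes "finite A" "finite B" "{a. f a \<noteq> 0} \<subseteq> A" "{b. g b \<noteq> 0} \<subseteq> B"
  shows "conv m f g c =
    (\<Sum>p \<in> A \<times> B. if m (fst p) (snd p) = c then f (fst p) * g (snd p) else 0)"
  unfolding conv_def using assms by (intro sum.mono_neutral_left) auto

lemma conv_diff_left:
  assumes "f \<in> fsupp X" "f' \<in> fsupp X" "g \<in> fsupp X"
  shows "conv m (f - f') g = conv m f g - conv m f' g"
proof
  fix c
  let ?A = "{a. f a \<noteq> 0} \<union> {a. f' a \<noteq> 0}" and ?B = "{b. g b \<noteq> 0}"
  have fin: "finite ?A" "finite ?B" using assms by (auto simp: fsupp_def)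
  have "conv m (f - f') g c = (\<Sum>p \<in> ?A \<times> ?B. (if m (fst p) (snd p) = c then f (fst p) * g (snd p) else 0)
      - (if m (fst p) (snd p) = c then f' (fst p) * g (snd p) else 0))"
    by (subst conv_eq_sum[OF fin]) (auto simp: algebra_simps intro!: sum.cong)
  also have "\<dots> = conv m f g c - conv m f' g c"
    unfolding sum_subtractf by (subst (1 2) conv_eq_sum[OF fin]) auto
  finally show "conv m (f - f') g c = (conv m f g - conv m f' g) c" by simp
qed

lemma conv_diff_right:
  assumes "f \<in> fsupp X" "g \<in> fsupp X" "g' \<in> fsupp X"
  shows "conv m f (g - g') = conv m f g - conv m f g'"
proof
  fix c
  let ?B = "{a. g a \<noteq> 0} \<union> {a. g' a \<noteq> 0}" and ?A = "{b. f b \<noteq> 0}"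
  have fin: "finite ?A" "finite ?B" using assms by (auto simp: fsupp_def)
  have "conv m f (g - g') c = (\<Sum>p \<in> ?A \<times> ?B. (if m (fst p) (snd p) = c then f (fst p) * g (snd p) else 0)
      - (if m (fst p) (snd p) = c then f (fst p) * g' (snd p) else 0))"
    by (subst conv_eq_sum[OF fin]) (auto simp: algebra_simps intro!: sum.cong)
  also have "\<dots> = conv m f g c - conv m f g' c"
    unfolding sum_subtractf by (subst (1 2) conv_eq_sum[OF fin]) auto
  finally show "conv m f (g - g') c = (conv m f g - conv m f g') c" by simp
qed

lemma conv_zero_left: "conv m 0 g = 0" and conv_zero_right: "conv m f 0 = 0"
  by (auto simp: conv_def)

lemma conv_ind_ind: "conv m (ind a) (ind b) = ind (m a b)"
proof
  fix c
  show "conv m (ind a) (ind b) c = ind (m a b) c"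
    by (subst conv_eq_sum[of "{a}" "{b}"]) (auto simp: ind_def)
qed

lemma fsupp_uminus: "f \<in> fsupp X \<Longrightarrow> - f \<in> fsupp X"
  by (rule addsub_uminus[OF addsub_fsupp])

lemma conv_add_left:
  assumes "f \<in> fsupp X" "f' \<in> fsupp X" "g \<in> fsupp X"
  shows "conv m (f + f') g = conv m f g + conv m f' g"
proof -
  have "conv m (0 - f') g = 0 - conv m f' g"
    using conv_diff_left[of 0 X f' g m] addsub_zero[OF addsub_fsupp[of X]] assms by (simp add: conv_zero_left)
  then show ?thesis
    using conv_diff_left[of f X "- f'" g m] fsupp_uminus[of f' X] assms by simp
qed

lemma conv_add_right:
  assumes "f \<in> fsupp X" "g \<in> fsupp X" "g' \<in> fsupp X"
  shows "conv m f (g + g') = conv m f g + conv m f g'"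
proof -
  have "conv m f (0 - g') = 0 - conv m f g'"
    using conv_diff_right[of f X 0 g' m] addsub_zero[OF addsub_fsupp[of X]] assms by (simp add: conv_zero_right)
  then show ?thesis
    using conv_diff_right[of f X g "- g'" m] fsupp_uminus[of g' X] assms by simp
qed

lemma conv_uminus_right:
  assumes "f \<in> fsupp X" "g \<in> fsupp X"
  shows "conv m f (- g) = - conv m f g"
  using conv_diff_right[of f X 0 g m] addsub_zero[OF addsub_fsupp[of X]] assms
  by (simp add: conv_zero_right)

lemma conv_sum_right:
  assumes "f \<in> fsupp X" "\<And>i. i \<in> I \<Longrightarrow> g i \<in> fsupp X"
  shows "conv m f (\<Sum>i\<in>I. g i) = (\<Sum>i\<in>I. conv m f (g i))"
  using assms(2)
proof (induction I rule: infinite_finite_induct)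
  case (insert i I)
  have "(\<Sum>i\<in>I. g i) \<in> fsupp X" using insert by (intro addsub_sum[OF addsub_fsupp]) auto
  then show ?case using insert assms(1) conv_add_right[of f X "g i" "sum g I" m]
    by (simp del: plus_fun_apply)
qed (simp_all add: conv_zero_right)

definition monoid_ring :: "('a, 'b) monoid_scheme \<Rightarrow> ('a \<Rightarrow> int) ring" where
  "monoid_ring M = \<lparr>carrier = fsupp (carrier M), mult = conv (mult M), one = ind (one M),
     zero = (\<lambda>c. 0), add = (\<lambda>f g c. f c + g c)\<rparr>"

lemma monoid_ring_simps [simp]:
  "carrier (monoid_ring M) = fsupp (carrier M)"
  "f \<otimes>\<^bsub>monoid_ring M\<^esub> g = conv (mult M) f g"
  "\<one>\<^bsub>monoid_ring M\<^esub> = ind (one M)"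
  "\<zero>\<^bsub>monoid_ring M\<^esub> = 0"
  "f \<oplus>\<^bsub>monoid_ring M\<^esub> g = f + g"
  by (auto simp: monoid_ring_def zero_fun_def plus_fun_def)

text \<open>Every law is additive in each argument, so \<open>fsupp_subset_addsub\<close> reduces it
  to indicators one argument at a time, and there it is a law of the monoid. Closure comes first,
  because associativity applies additivity of \<open>conv\<close> to products.\<close>

lemma (in comm_monoid) cring_monoid_ring: "cring (monoid_ring G)"
proof -
  let ?F = "fsupp (carrier G)" and ?c = "conv (mult G)"
  note F = addsub_fsupp[of "carrier G"]
  note gens = ind_in_fsupp[of _ "carrier G"]
  have closed: "?c f g \<in> ?F" if f: "f \<in> ?F" and g: "g \<in> ?F" for f g
  proof -
    have *: "?c (ind a) g \<in> ?F" if a: "a \<in> carrier G" for a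
    proof -
      have "?F \<subseteq> {g \<in> ?F. ?c (ind a) g \<in> ?F}"
      proof (rule fsupp_subset_addsub)
        show "addsub {g \<in> ?F. ?c (ind a) g \<in> ?F}"
          using gens[OF a] by (auto simp: addsub_def addsub_closed[OF F] conv_zero_right conv_diff_right)
      qed (use a gens in \<open>auto simp: conv_ind_ind\<close>)
      then show ?thesis using g by auto
    qed
    have "?F \<subseteq> {f \<in> ?F. ?c f g \<in> ?F}"
    proof (rule fsupp_subset_addsub)
      show "addsub {f \<in> ?F. ?c f g \<in> ?F}"
        using g by (auto simp: addsub_def addsub_closed[OF F] conv_zero_left conv_diff_left)
    qed (use * gens in auto)
    then show ?thesis using f by auto
  qed
  have comm: "?c f g = ?c g f" if f: "f \<in> ?F" and g: "g \<in> ?F" for f g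
  proof -
    have *: "?c (ind a) g = ?c g (ind a)" if a: "a \<in> carrier G" for a
    proof -
      have "?F \<subseteq> {g \<in> ?F. ?c (ind a) g = ?c g (ind a)}"
      proof (rule fsupp_subset_addsub)
        show "addsub {g \<in> ?F. ?c (ind a) g = ?c g (ind a)}"
          using gens[OF a] by (auto simp: addsub_def addsub_closed[OF F] conv_zero_right conv_zero_left
              conv_diff_right conv_diff_left)
      qed (use a gens in \<open>auto simp: conv_ind_ind m_comm\<close>)
      then show ?thesis using g by auto
    qed
    have "?F \<subseteq> {f \<in> ?F. ?c f g = ?c g f}"
    proof (rule fsupp_subset_addsub)
      show "addsub {f \<in> ?F. ?c f g = ?c g f}"
        using g by (auto simp: addsub_def addsub_closed[OF F] conv_zero_right conv_zero_left
              conv_diff_right conv_diff_left)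
    qed (use * gens in auto)
    then show ?thesis using f by auto
  qed
  have assoc: "?c (?c f g) h = ?c f (?c g h)" if f: "f \<in> ?F" and g: "g \<in> ?F" and h: "h \<in> ?F" for f g h
  proof -
    have 1: "?c (?c (ind a) (ind b)) h = ?c (ind a) (?c (ind b) h)"
      if a: "a \<in> carrier G" and b: "b \<in> carrier G" for a b
    proof -
      have "?F \<subseteq> {h \<in> ?F. ?c (?c (ind a) (ind b)) h = ?c (ind a) (?c (ind b) h)}"
      proof (rule fsupp_subset_addsub)
        show "addsub {h \<in> ?F. ?c (?c (ind a) (ind b)) h = ?c (ind a) (?c (ind b) h)}"
          using gens[OF a] gens[OF b]
          by (auto simp: addsub_def addsub_closed[OF F] conv_zero_right conv_zero_left closed
              conv_diff_right[of _ "carrier G"])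
      qed (use a b gens in \<open>auto simp: conv_ind_ind m_assoc\<close>)
      then show ?thesis using h by auto
    qed
    have 2: "?c (?c (ind a) g) h = ?c (ind a) (?c g h)" if a: "a \<in> carrier G" for a
    proof -
      have "?F \<subseteq> {g \<in> ?F. ?c (?c (ind a) g) h = ?c (ind a) (?c g h)}"
      proof (rule fsupp_subset_addsub)
        show "addsub {g \<in> ?F. ?c (?c (ind a) g) h = ?c (ind a) (?c g h)}"
          using gens[OF a] h
          by (auto simp: addsub_def addsub_closed[OF F] conv_zero_right conv_zero_left closed
              conv_diff_right[of _ "carrier G"] conv_diff_left[of _ "carrier G"])
      qed (use 1 a gens in auto)
      then show ?thesis using g by auto
    qed
    have "?F \<subseteq> {f \<in> ?F. ?c (?c f g) h = ?c f (?c g h)}"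
    proof (rule fsupp_subset_addsub)
      show "addsub {f \<in> ?F. ?c (?c f g) h = ?c f (?c g h)}"
        using g h
        by (auto simp: addsub_def addsub_closed[OF F] conv_zero_right conv_zero_left closed
              conv_diff_right[of _ "carrier G"] conv_diff_left[of _ "carrier G"])
    qed (use 2 gens in auto)
    then show ?thesis using f by auto
  qed
  have one: "?c (ind \<one>) f = f" if f: "f \<in> ?F" for f
  proof -
    have "?F \<subseteq> {f \<in> ?F. ?c (ind \<one>) f = f}"
    proof (rule fsupp_subset_addsub)
      show "addsub {f \<in> ?F. ?c (ind \<one>) f = f}"
        using gens[OF one_closed]
        by (auto simp: addsub_def addsub_closed[OF F] conv_zero_right conv_diff_right[of _ "carrier G"])
    qed (use gens in \<open>auto simp: conv_ind_ind\<close>)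
    then show ?thesis using f by auto
  qed
  show ?thesis
  proof (rule cringI)
    show "abelian_group (monoid_ring G)"
    proof (rule abelian_groupI)
      fix f assume "f \<in> carrier (monoid_ring G)"
      then show "\<exists>g\<in>carrier (monoid_ring G). g \<oplus>\<^bsub>monoid_ring G\<^esub> f = \<zero>\<^bsub>monoid_ring G\<^esub>"
        by (intro bexI[of _ "- f"]) (auto simp: fsupp_uminus)
    qed (auto simp: addsub_closed[OF F] algebra_simps)
    show "comm_monoid (monoid_ring G)"
      by (rule comm_monoidI) (auto simp: closed gens assoc one intro: comm)
    show "(x \<oplus>\<^bsub>monoid_ring G\<^esub> y) \<otimes>\<^bsub>monoid_ring G\<^esub> z =
       x \<otimes>\<^bsub>monoid_ring G\<^esub> z \<oplus>\<^bsub>monoid_ring G\<^esub> y \<otimes>\<^bsub>monoid_ring G\<^esub> z"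
      if "x \<in> carrier (monoid_ring G)" "y \<in> carrier (monoid_ring G)" "z \<in> carrier (monoid_ring G)" for x y z
      using that by (simp add: conv_add_left[of _ "carrier G"])
  qed
qed

lemma (in comm_monoid) monoid_ring_a_inv:
  assumes "f \<in> fsupp (carrier G)"
  shows "\<ominus>\<^bsub>monoid_ring G\<^esub> f = - f"
proof -
  interpret R: cring "monoid_ring G" by (rule cring_monoid_ring)
  show ?thesis
    using assms by (intro R.minus_equality) (auto simp: fsupp_uminus)
qed

lemma (in comm_monoid) additive_subgroup_monoid_ring_iff:
  "subgroup K (add_monoid (monoid_ring G)) \<longleftrightarrow> K \<subseteq> fsupp (carrier G) \<and> addsub K"
proof
  interpret R: cring "monoid_ring G" by (rule cring_monoid_ring)
  {
    assume "subgroup K (add_monoid (monoid_ring G))"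
    then interpret K: additive_subgroup K "monoid_ring G" by (rule additive_subgroup.intro)
    have sub: "K \<subseteq> fsupp (carrier G)" using K.a_subset by simp
    have "f - g \<in> K" if "f \<in> K" "g \<in> K" for f g
      using K.a_closed[OF that(1) K.a_inv_closed[OF that(2)]] that sub
      by (simp add: monoid_ring_a_inv subset_iff)
    then show "K \<subseteq> fsupp (carrier G) \<and> addsub K"
      using sub K.zero_closed by (auto simp: addsub_def)
  next
    assume K: "K \<subseteq> fsupp (carrier G) \<and> addsub K"
    show "subgroup K (add_monoid (monoid_ring G))"
    proof (rule R.add.subgroupI)
      fix f assume "f \<in> K"
      then show "\<ominus>\<^bsub>monoid_ring G\<^esub> f \<in> K"
        using K monoid_ring_a_inv addsub_uminus by (metis subsetD)
    qed (use K addsub_closed in auto)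
  }
qed

section \<open>Quotient of a commutative monoid by a dense submonoid\<close>

text \<open>The class of a under having a common complement. In the setting below this is the
  relation a s = b t with s, t in S: from a common complement c take s = b c and t = a c;
  conversely, density and cancellation turn such an equation into a common complement.\<close>

definition cofinal_rel :: "('a, 'b) monoid_scheme \<Rightarrow> 'a set \<Rightarrow> 'a \<Rightarrow> 'a set" where
  "cofinal_rel M S a = {b \<in> carrier M. \<exists>c \<in> carrier M. a \<otimes>\<^bsub>M\<^esub> c \<in> S \<and> b \<otimes>\<^bsub>M\<^esub> c \<in> S}"

text \<open>Density provides inverses: a complement b of a has a b in S, and every element of S is
  related to the unit. Cancellation keeps the kernel from exceeding S: a common complement of a and
  the unit lies itself in S, so it can be cancelled from its product with a.\<close>

lemma (in comm_monoid) quotient_by_dense_submonoid: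
  assumes S: "S \<subseteq> carrier G" "\<one> \<in> S" "\<And>a b. a \<in> S \<Longrightarrow> b \<in> S \<Longrightarrow> a \<otimes> b \<in> S"
    and cancel: "\<And>a b. a \<in> carrier G \<Longrightarrow> b \<in> S \<Longrightarrow> a \<otimes> b \<in> S \<Longrightarrow> a \<in> S"
    and dense: "\<And>a. a \<in> carrier G \<Longrightarrow> \<exists>b\<in>carrier G. a \<otimes> b \<in> S"
  obtains Q :: "'a set monoid" and h where "comm_group Q"
    "\<And>a. a \<in> carrier G \<Longrightarrow> h a \<in> carrier Q"
    "\<And>a b. a \<in> carrier G \<Longrightarrow> b \<in> carrier G \<Longrightarrow> h (a \<otimes> b) = h a \<otimes>\<^bsub>Q\<^esub> h b"
    "\<And>a. a \<in> carrier G \<Longrightarrow> h a = \<one>\<^bsub>Q\<^esub> \<longleftrightarrow> a \<in> S"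
proof -
  define rel where "rel a b \<longleftrightarrow> (\<exists>c \<in> carrier G. a \<otimes> c \<in> S \<and> b \<otimes> c \<in> S)" for a b
  have sym: "rel a b \<Longrightarrow> rel b a" for a b by (auto simp: rel_def)
  have refl: "rel a a" if "a \<in> carrier G" for a using dense[OF that] by (auto simp: rel_def)
  have trans: "rel a e" if ab: "rel a b" "rel b e" and [simp]: "a \<in> carrier G" "b \<in> carrier G" "e \<in> carrier G" for a b e
  proof -
    obtain c d where [simp]: "c \<in> carrier G" "d \<in> carrier G"
      and c: "a \<otimes> c \<in> S" "b \<otimes> c \<in> S" and d: "b \<otimes> d \<in> S" "e \<otimes> d \<in> S"
      using ab unfolding rel_def by blast
    \<comment> \<open>The middle element b enters the witness: c b d is a complement of both a and
      e, since the products split as (a c)(b d) and (e d)(b c) with all factors in S.\<close>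
    have "a \<otimes> (c \<otimes> (b \<otimes> d)) = (a \<otimes> c) \<otimes> (b \<otimes> d)" "e \<otimes> (c \<otimes> (b \<otimes> d)) = (e \<otimes> d) \<otimes> (b \<otimes> c)"
      by (simp_all add: m_ac)
    then show ?thesis
      unfolding rel_def using c d S by (intro bexI[of _ "c \<otimes> (b \<otimes> d)"]) auto
  qed
  have cong: "rel (a \<otimes> b) (a' \<otimes> b')" if ab: "rel a a'" "rel b b'"
    and [simp]: "a \<in> carrier G" "b \<in> carrier G" "a' \<in> carrier G" "b' \<in> carrier G" for a b a' b'
  proof -
    obtain c d where [simp]: "c \<in> carrier G" "d \<in> carrier G"
      and c: "a \<otimes> c \<in> S" "a' \<otimes> c \<in> S" and d: "b \<otimes> d \<in> S" "b' \<otimes> d \<in> S"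
      using ab unfolding rel_def by blast
    have "a \<otimes> b \<otimes> (c \<otimes> d) = (a \<otimes> c) \<otimes> (b \<otimes> d)" "a' \<otimes> b' \<otimes> (c \<otimes> d) = (a' \<otimes> c) \<otimes> (b' \<otimes> d)"
      by (simp_all add: m_ac)
    then show ?thesis
      unfolding rel_def using c d S by (intro bexI[of _ "c \<otimes> d"]) auto
  qed
  define h where "h = cofinal_rel G S"
  have h_eq: "h a = h b \<longleftrightarrow> rel a b" if "a \<in> carrier G" "b \<in> carrier G" for a b
  proof
    assume "h a = h b"
    moreover have "b \<in> h b" using refl[OF that(2)] that by (auto simp: h_def cofinal_rel_def rel_def)
    ultimately show "rel a b" by (auto simp: h_def cofinal_rel_def rel_def)
  next
    assume r: "rel a b"
    have "h x = {y \<in> carrier G. rel x y}" for x by (auto simp: h_def cofinal_rel_def rel_def)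
    then show "h a = h b" using trans[OF r] trans[OF sym[OF r]] that by auto
  qed
  define rep where "rep x = (SOME a. a \<in> carrier G \<and> h a = x)" for x
  have rep: "rep (h a) \<in> carrier G" "h (rep (h a)) = h a" if "a \<in> carrier G" for a
    using someI[of "\<lambda>b. b \<in> carrier G \<and> h b = h a" a] that by (auto simp: rep_def)
  define Q where "Q = \<lparr>carrier = h ` carrier G, mult = (\<lambda>x y. h (rep x \<otimes> rep y)), one = h \<one>\<rparr>"
  have mult: "h a \<otimes>\<^bsub>Q\<^esub> h b = h (a \<otimes> b)" if "a \<in> carrier G" "b \<in> carrier G" for a b
  proof -
    have "rel (rep (h a) \<otimes> rep (h b)) (a \<otimes> b)"
      using rep that h_eq by (intro cong) auto
    then show ?thesis using rep that h_eq by (simp add: Q_def)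
  qed
  have [simp]: "carrier Q = h ` carrier G" "\<one>\<^bsub>Q\<^esub> = h \<one>" by (auto simp: Q_def)
  have "comm_group Q"
  proof (rule comm_groupI)
    fix x assume "x \<in> carrier Q"
    then obtain a where a: "a \<in> carrier G" "x = h a" by auto
    obtain b where b: "b \<in> carrier G" "a \<otimes> b \<in> S" using dense[OF a(1)] by auto
    have "rel (b \<otimes> a) \<one>"
      unfolding rel_def using a b S by (intro bexI[of _ \<one>]) (auto simp: m_comm)
    then have "h b \<otimes>\<^bsub>Q\<^esub> x = \<one>\<^bsub>Q\<^esub>"
      using a b h_eq by (simp add: mult)
    then show "\<exists>y\<in>carrier Q. y \<otimes>\<^bsub>Q\<^esub> x = \<one>\<^bsub>Q\<^esub>"
      using b by auto
    fix y assume "y \<in> carrier Q"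
    then obtain a' where "a' \<in> carrier G" "y = h a'" by auto
    with a show "x \<otimes>\<^bsub>Q\<^esub> y = y \<otimes>\<^bsub>Q\<^esub> x"
      by (simp add: mult m_comm[of a a'])
  qed (auto simp: mult m_assoc)
  have ker: "h a = \<one>\<^bsub>Q\<^esub> \<longleftrightarrow> a \<in> S" if a: "a \<in> carrier G" for a
  proof -
    have "rel a \<one> \<longleftrightarrow> a \<in> S"
    proof
      assume "rel a \<one>"
      then obtain c where "c \<in> carrier G" "a \<otimes> c \<in> S" "\<one> \<otimes> c \<in> S"
        unfolding rel_def by blast
      then show "a \<in> S" using cancel[of a c] a by simp
    next
      assume "a \<in> S"
      then show "rel a \<one>" unfolding rel_def using a S(2) by (intro bexI[of _ \<one>]) simp_all
    qed
    then show ?thesis using a h_eq by simp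
  qed
  show ?thesis
    by (rule that[of Q h]) (use \<open>comm_group Q\<close> ker in \<open>simp_all add: mult\<close>)
qed

text \<open>Universal property of the free abelian group. Compatibility is stated for differences
  because this is the form in which \<open>addsub\<close> is checked for the kernel.\<close>

lemma (in comm_group) free_extension:
  assumes h: "\<And>a. a \<in> X \<Longrightarrow> h a \<in> carrier G"
  obtains \<phi> where "\<And>f. f \<in> fsupp X \<Longrightarrow> \<phi> f \<in> carrier G"
    "\<And>a. a \<in> X \<Longrightarrow> \<phi> (ind a) = h a"
    "\<And>f g. f \<in> fsupp X \<Longrightarrow> g \<in> fsupp X \<Longrightarrow> \<phi> (f - g) = \<phi> f \<otimes> inv (\<phi> g)"
proof -
  define \<phi> where "\<phi> f = finprod G (\<lambda>a. h a [^] (f a :: int)) {c. f c \<noteq> 0}" for f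
  \<comment> \<open>The product over any finite set containing the support has the same value, which
    permits comparing f, g and f + g on one index set.\<close>
  have super: "\<phi> f = finprod G (\<lambda>a. h a [^] f a) A"
    if "f \<in> fsupp X" "finite A" "{c. f c \<noteq> 0} \<subseteq> A" "A \<subseteq> X" for f A
    unfolding \<phi>_def using that h
    by (intro finprod_mono_neutral_cong_left) (auto simp: int_pow_0)
  have closed: "\<phi> f \<in> carrier G" if "f \<in> fsupp X" for f
    unfolding \<phi>_def using that h by (intro finprod_closed) (auto simp: fsupp_def)
  have sing: "\<phi> (ind a) = h a" if "a \<in> X" for a
  proof -
    have "{c. ind a c \<noteq> 0} = {a}" by (auto simp: ind_def)
    then show ?thesis using h[OF that] by (simp add: \<phi>_def ind_def)
  qed
  have add: "\<phi> (f + g) = \<phi> f \<otimes> \<phi> g" if f: "f \<in> fsupp X" and g: "g \<in> fsupp X" for f g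
  proof -
    let ?A = "{c. f c \<noteq> 0} \<union> {c. g c \<noteq> 0}"
    have A: "finite ?A" "?A \<subseteq> X" using f g by (auto simp: fsupp_def)
    have "\<phi> (f + g) = finprod G (\<lambda>a. h a [^] f a \<otimes> h a [^] g a) ?A"
    proof (subst super[OF addsub_add[OF addsub_fsupp f g] A(1) _ A(2)])
      show "finprod G (\<lambda>a. h a [^] (f + g) a) ?A = finprod G (\<lambda>a. h a [^] f a \<otimes> h a [^] g a) ?A"
        using A h by (intro finprod_cong') (auto simp: int_pow_mult subset_iff)
    qed auto
    also have "\<dots> = \<phi> f \<otimes> \<phi> g"
      using A h super[OF f A(1) _ A(2)] super[OF g A(1) _ A(2)]
      by (subst finprod_multf) (auto simp: subset_iff)
    finally show ?thesis .
  qed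
  have "\<phi> (f - g) = \<phi> f \<otimes> inv (\<phi> g)" if f: "f \<in> fsupp X" and g: "g \<in> fsupp X" for f g
  proof -
    have "\<phi> f = \<phi> (f - g) \<otimes> \<phi> g"
      using add[OF addsub_diff[OF addsub_fsupp f g] g] by simp
    then show ?thesis
      using closed[OF f] closed[OF g] closed[OF addsub_diff[OF addsub_fsupp f g]]
      by (simp add: m_assoc)
  qed
  with closed sing show ?thesis using that by blast
qed

text \<open>The subgroup K is the kernel of the homomorphism from the free abelian group to the
  quotient by S. It records the quotient as relations inside \<open>fsupp\<close>, where it can be
  compared with other subgroups.\<close>

lemma (in comm_monoid) dense_submonoid_relations:
  assumes S: "S \<subseteq> carrier G" "\<one> \<in> S" "\<And>a b. a \<in> S \<Longrightarrow> b \<in> S \<Longrightarrow> a \<otimes> b \<in> S"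
    and cancel: "\<And>a b. a \<in> carrier G \<Longrightarrow> b \<in> S \<Longrightarrow> a \<otimes> b \<in> S \<Longrightarrow> a \<in> S"
    and dense: "\<And>a. a \<in> carrier G \<Longrightarrow> \<exists>b\<in>carrier G. a \<otimes> b \<in> S"
  obtains K where "addsub K" "K \<subseteq> fsupp (carrier G)"
    "\<And>a b. a \<in> carrier G \<Longrightarrow> b \<in> carrier G \<Longrightarrow> ind (a \<otimes> b) - ind a - ind b \<in> K"
    "\<And>a. a \<in> carrier G \<Longrightarrow> ind a \<in> K \<longleftrightarrow> a \<in> S"
proof (rule quotient_by_dense_submonoid[of S])
  fix Q :: "'a set monoid" and h
  assume Q: "comm_group Q"
    and h: "\<And>a. a \<in> carrier G \<Longrightarrow> h a \<in> carrier Q"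
      "\<And>a b. a \<in> carrier G \<Longrightarrow> b \<in> carrier G \<Longrightarrow> h (a \<otimes> b) = h a \<otimes>\<^bsub>Q\<^esub> h b"
      "\<And>a. a \<in> carrier G \<Longrightarrow> h a = \<one>\<^bsub>Q\<^esub> \<longleftrightarrow> a \<in> S"
  interpret Q: comm_group Q by (rule Q)
  note F = addsub_fsupp[of "carrier G"] ind_in_fsupp[of _ "carrier G"]
  show thesis
  proof (rule Q.free_extension[of "carrier G" h])
    fix \<phi>
    assume \<phi>: "\<And>f. f \<in> fsupp (carrier G) \<Longrightarrow> \<phi> f \<in> carrier Q"
      "\<And>a. a \<in> carrier G \<Longrightarrow> \<phi> (ind a) = h a"
      "\<And>f g. f \<in> fsupp (carrier G) \<Longrightarrow> g \<in> fsupp (carrier G) \<Longrightarrow> \<phi> (f - g) = \<phi> f \<otimes>\<^bsub>Q\<^esub> inv\<^bsub>Q\<^esub> (\<phi> g)"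
    have zero: "\<phi> 0 = \<one>\<^bsub>Q\<^esub>"
      using \<phi>(3)[of 0 0] \<phi>(1)[of 0] addsub_zero[OF F(1)] by simp
    show thesis
    proof (rule that[of "{f \<in> fsupp (carrier G). \<phi> f = \<one>\<^bsub>Q\<^esub>}"])
      show "addsub {f \<in> fsupp (carrier G). \<phi> f = \<one>\<^bsub>Q\<^esub>}"
        by (auto simp: addsub_def addsub_closed[OF F(1)] zero \<phi>(3))
      show "ind (a \<otimes> b) - ind a - ind b \<in> {f \<in> fsupp (carrier G). \<phi> f = \<one>\<^bsub>Q\<^esub>}"
        if "a \<in> carrier G" "b \<in> carrier G" for a b
      proof -
        have "h a \<otimes>\<^bsub>Q\<^esub> h b \<otimes>\<^bsub>Q\<^esub> inv\<^bsub>Q\<^esub> (h a) = h b"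
          using h(1) that by (simp add: Q.m_comm[of "h a" "h b"] Q.m_assoc)
        then show ?thesis
          using that h by (simp add: addsub_closed[OF F(1)] F(2) \<phi>)
      qed
    qed (use \<phi> h F in auto)
  qed (use h in blast)
qed (use S cancel dense in blast)+

section \<open>Preadditive categories\<close>

locale preadditive =
  fixes C :: "('o, 'm, 'x) cat_scheme"
  assumes is_preadditive: "is_preadditive C"
begin

abbreviation comp (infixr \<open>\<cdot>\<close> 70) where "g \<cdot> f \<equiv> cmp C g f"
abbreviation plus_mor (infixl \<open>\<boxplus>\<close> 65) where "f \<boxplus> g \<equiv> pls C f g"

lemma hom_iff: "f \<in> hom C A B \<longleftrightarrow> f \<in> arr C \<and> src C f = A \<and> tgt C f = B"
  by (auto simp: hom_def)

lemma is_category: "is_category C"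
  using is_preadditive by (simp add: is_preadditive_def)

lemma src_obj [simp]: "f \<in> arr C \<Longrightarrow> src C f \<in> obj C"
  and tgt_obj [simp]: "f \<in> arr C \<Longrightarrow> tgt C f \<in> obj C"
  using is_category by (auto simp: is_category_def)

lemma hom_obj: "f \<in> hom C A B \<Longrightarrow> A \<in> obj C \<and> B \<in> obj C"
  by (auto simp: hom_iff)

lemma idm_hom: "A \<in> obj C \<Longrightarrow> idm C A \<in> hom C A A"
  using is_category by (auto simp: is_category_def)

lemma idm_simps [simp]:
  assumes "A \<in> obj C"
  shows "idm C A \<in> arr C" "src C (idm C A) = A" "tgt C (idm C A) = A"
  using idm_hom[OF assms] by (auto simp: hom_iff)

lemma comp_hom:
  assumes "f \<in> hom C A B" "g \<in> hom C B D"
  shows "g \<cdot> f \<in> hom C A D"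
proof -
  have "A \<in> obj C" "B \<in> obj C" "D \<in> obj C" using assms hom_obj by auto
  then show ?thesis using is_category assms unfolding is_category_def by blast
qed

lemma comp_simps [simp]:
  assumes "f \<in> arr C" "g \<in> arr C" "src C g = tgt C f"
  shows "g \<cdot> f \<in> arr C" "src C (g \<cdot> f) = src C f" "tgt C (g \<cdot> f) = tgt C g"
  using comp_hom[of f "src C f" "tgt C f" g "tgt C g"] assms by (auto simp: hom_iff)

lemma comp_assoc [simp]:
  assumes "f \<in> arr C" "g \<in> arr C" "h \<in> arr C" "src C g = tgt C f" "src C h = tgt C g"
  shows "(h \<cdot> g) \<cdot> f = h \<cdot> (g \<cdot> f)"
proof -
  have "f \<in> hom C (src C f) (tgt C f)" "g \<in> hom C (tgt C f) (tgt C g)" "h \<in> hom C (tgt C g) (tgt C h)"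
    using assms by (auto simp: hom_iff)
  moreover have "src C f \<in> obj C" "tgt C f \<in> obj C" "tgt C g \<in> obj C" "tgt C h \<in> obj C"
    using assms by auto
  ultimately have "h \<cdot> (g \<cdot> f) = (h \<cdot> g) \<cdot> f"
    using is_category unfolding is_category_def by blast
  then show ?thesis by simp
qed

lemma comp_idm [simp]: "f \<in> arr C \<Longrightarrow> src C f = A \<Longrightarrow> f \<cdot> idm C A = f"
  and idm_comp [simp]: "f \<in> arr C \<Longrightarrow> tgt C f = A \<Longrightarrow> idm C A \<cdot> f = f"
  using is_category src_obj tgt_obj unfolding is_category_def hom_def by blast+

text \<open>Composites are normalised to right-nested form, which hides the factor a \<cdot> b in a
  \<cdot> (b \<cdot> x); this variant lets an equation for a \<cdot> b rewrite there.\<close>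

lemma comp_reduce:
  assumes "a \<cdot> b = c" "x \<in> arr C" "b \<in> arr C" "a \<in> arr C" "src C b = tgt C x" "src C a = tgt C b"
  shows "a \<cdot> (b \<cdot> x) = c \<cdot> x"
  using assms comp_assoc by metis

lemma hom_group:
  assumes "A \<in> obj C" "B \<in> obj C"
  shows "zro C A B \<in> hom C A B"
    and "f \<in> hom C A B \<Longrightarrow> g \<in> hom C A B \<Longrightarrow> f \<boxplus> g \<in> hom C A B"
    and "f \<in> hom C A B \<Longrightarrow> ngt C f \<in> hom C A B"
    and "f \<in> hom C A B \<Longrightarrow> g \<in> hom C A B \<Longrightarrow> h \<in> hom C A B \<Longrightarrow> (f \<boxplus> g) \<boxplus> h = f \<boxplus> (g \<boxplus> h)"
    and "f \<in> hom C A B \<Longrightarrow> g \<in> hom C A B \<Longrightarrow> f \<boxplus> g = g \<boxplus> f"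
    and "f \<in> hom C A B \<Longrightarrow> f \<boxplus> zro C A B = f"
    and "f \<in> hom C A B \<Longrightarrow> f \<boxplus> ngt C f = zro C A B"
  using is_preadditive assms unfolding is_preadditive_def by blast+

lemma zro_simps [simp]:
  assumes "A \<in> obj C" "B \<in> obj C"
  shows "zro C A B \<in> arr C" "src C (zro C A B) = A" "tgt C (zro C A B) = B"
  using hom_group(1)[OF assms] by (auto simp: hom_iff)

lemma pls_simps [simp]:
  assumes "f \<in> arr C" "g \<in> arr C" "src C f = src C g" "tgt C f = tgt C g"
  shows "f \<boxplus> g \<in> arr C" "src C (f \<boxplus> g) = src C g" "tgt C (f \<boxplus> g) = tgt C g"
  using hom_group(2)[of "src C f" "tgt C f" f g] assms by (auto simp: hom_iff)

lemma ngt_simps [simp]: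
  assumes "f \<in> arr C"
  shows "ngt C f \<in> arr C" "src C (ngt C f) = src C f" "tgt C (ngt C f) = tgt C f"
  using hom_group(3)[of "src C f" "tgt C f" f] assms by (auto simp: hom_iff)

lemma pls_assoc:
  assumes "f \<in> arr C" "g \<in> arr C" "h \<in> arr C" "src C f = src C g" "tgt C f = tgt C g"
    "src C h = src C g" "tgt C h = tgt C g"
  shows "(f \<boxplus> g) \<boxplus> h = f \<boxplus> (g \<boxplus> h)"
  using hom_group(4)[of "src C f" "tgt C f" f g h] assms by (auto simp: hom_iff)

lemma pls_commute:
  assumes "f \<in> arr C" "g \<in> arr C" "src C f = src C g" "tgt C f = tgt C g"
  shows "f \<boxplus> g = g \<boxplus> f"
  using hom_group(5)[of "src C f" "tgt C f" f g] assms by (auto simp: hom_iff)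

lemma pls_zro [simp]:
  assumes "f \<in> arr C" "src C f = A" "tgt C f = B"
  shows "f \<boxplus> zro C A B = f" "zro C A B \<boxplus> f = f"
  using hom_group(6)[of "src C f" "tgt C f" f] pls_commute[of f "zro C A B"] assms by (auto simp: hom_iff)

lemma pls_ngt: "f \<in> arr C \<Longrightarrow> f \<boxplus> ngt C f = zro C (src C f) (tgt C f)"
  using hom_group(7)[of "src C f" "tgt C f" f] by (auto simp: hom_iff)

text \<open>Add the negative to both sides. Applied to images of 0 = 0 + 0, it shows that
  composition and \<Sigma> preserve zero morphisms.\<close>

lemma pls_idem_imp_zro:
  assumes "f \<in> arr C" "f \<boxplus> f = f"
  shows "f = zro C (src C f) (tgt C f)"
proof -
  have "f = f \<boxplus> (f \<boxplus> ngt C f)" using assms by (simp add: pls_ngt)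
  also have "\<dots> = (f \<boxplus> f) \<boxplus> ngt C f" using assms(1) by (simp add: pls_assoc)
  finally show ?thesis using assms by (simp add: pls_ngt)
qed

lemma comp_pls_left [simp]:
  assumes "f \<in> arr C" "g \<in> arr C" "h \<in> arr C" "src C g = tgt C f" "src C h = src C g" "tgt C h = tgt C g"
  shows "(g \<boxplus> h) \<cdot> f = g \<cdot> f \<boxplus> h \<cdot> f"
proof -
  have "f \<in> hom C (src C f) (tgt C f)" "g \<in> hom C (tgt C f) (tgt C g)" "h \<in> hom C (tgt C f) (tgt C g)"
    using assms by (auto simp: hom_iff)
  moreover have "src C f \<in> obj C" "tgt C f \<in> obj C" "tgt C g \<in> obj C"
    using assms by auto
  ultimately show ?thesis
    using conjunct2[OF conjunct2[OF is_preadditive[unfolded is_preadditive_def]]] by blast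
qed

lemma comp_pls_right [simp]:
  assumes "f \<in> arr C" "g \<in> arr C" "h \<in> arr C" "src C h = tgt C f" "src C f = src C g" "tgt C f = tgt C g"
  shows "h \<cdot> (f \<boxplus> g) = h \<cdot> f \<boxplus> h \<cdot> g"
proof -
  have "f \<in> hom C (src C f) (tgt C f)" "g \<in> hom C (src C f) (tgt C f)" "h \<in> hom C (tgt C f) (tgt C h)"
    using assms by (auto simp: hom_iff)
  moreover have "src C f \<in> obj C" "tgt C f \<in> obj C" "tgt C h \<in> obj C"
    using assms by auto
  ultimately show ?thesis
    using conjunct2[OF conjunct2[OF is_preadditive[unfolded is_preadditive_def]]] by blast
qed

lemma comp_zro [simp]:
  assumes "f \<in> arr C" "src C f = B" "A \<in> obj C"
  shows "f \<cdot> zro C A B = zro C A (tgt C f)"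
proof -
  have "f \<cdot> zro C A B \<boxplus> f \<cdot> zro C A B = f \<cdot> (zro C A B \<boxplus> zro C A B)"
    using assms by (subst comp_pls_right) auto
  also have "\<dots> = f \<cdot> zro C A B"
    using assms by (subst pls_zro) auto
  finally have "f \<cdot> zro C A B \<boxplus> f \<cdot> zro C A B = f \<cdot> zro C A B" .
  then show ?thesis using pls_idem_imp_zro[of "f \<cdot> zro C A B"] assms by auto
qed

lemma zro_comp [simp]:
  assumes "f \<in> arr C" "tgt C f = A" "B \<in> obj C"
  shows "zro C A B \<cdot> f = zro C (src C f) B"
proof -
  have "zro C A B \<cdot> f \<boxplus> zro C A B \<cdot> f = (zro C A B \<boxplus> zro C A B) \<cdot> f"
    using assms by (subst comp_pls_left) auto
  also have "\<dots> = zro C A B \<cdot> f"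
    using assms by (subst pls_zro) auto
  finally have "zro C A B \<cdot> f \<boxplus> zro C A B \<cdot> f = zro C A B \<cdot> f" .
  then show ?thesis using pls_idem_imp_zro[of "zro C A B \<cdot> f"] assms by auto
qed

subsection \<open>Isomorphisms and zero objects\<close>

lemma isomorphic_iff:
  "isomorphic C A B \<longleftrightarrow>
     (\<exists>f \<in> hom C A B. \<exists>g \<in> hom C B A. g \<cdot> f = idm C A \<and> f \<cdot> g = idm C B)"
  unfolding isomorphic_def is_iso_def by (auto simp: hom_def)

lemma is_isoI:
  "f \<in> hom C A B \<Longrightarrow> g \<in> hom C B A \<Longrightarrow> g \<cdot> f = idm C A \<Longrightarrow> f \<cdot> g = idm C B \<Longrightarrow> is_iso C f"
  unfolding is_iso_def by (auto simp: hom_def)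

lemma isomorphic_refl: "A \<in> obj C \<Longrightarrow> isomorphic C A A"
  unfolding isomorphic_iff by (intro bexI[of _ "idm C A"] conjI) (auto simp: hom_iff)

lemma isomorphic_sym: "isomorphic C A B \<Longrightarrow> isomorphic C B A"
  unfolding isomorphic_iff by blast

lemma isomorphic_trans:
  assumes "isomorphic C A B" "isomorphic C B D"
  shows "isomorphic C A D"
proof -
  obtain f g where f: "f \<in> hom C A B" "g \<in> hom C B A" "g \<cdot> f = idm C A" "f \<cdot> g = idm C B"
    using assms by (auto simp: isomorphic_iff)
  obtain h k where h: "h \<in> hom C B D" "k \<in> hom C D B" "k \<cdot> h = idm C B" "h \<cdot> k = idm C D"
    using assms by (auto simp: isomorphic_iff)
  note [simp] = f(3,4) h(3,4) comp_reduce[OF f(3)] comp_reduce[OF f(4)] comp_reduce[OF h(3)] comp_reduce[OF h(4)]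
  show ?thesis
    unfolding isomorphic_iff using f(1,2) h(1,2)
    by (intro bexI[of _ "h \<cdot> f"] bexI[of _ "g \<cdot> k"] conjI) (auto simp: hom_iff)
qed

lemma isomorphic_obj: "isomorphic C A B \<Longrightarrow> A \<in> obj C \<and> B \<in> obj C"
  unfolding isomorphic_iff using hom_obj by blast

lemma isocls_eq_iff:
  assumes "A \<in> obj C" "B \<in> obj C"
  shows "isocls C A = isocls C B \<longleftrightarrow> isomorphic C A B"
  unfolding isocls_def using assms isomorphic_refl isomorphic_sym isomorphic_trans by blast

lemma some_isocls:
  assumes "A \<in> obj C"
  shows "(SOME B. B \<in> isocls C A) \<in> obj C" "isomorphic C A (SOME B. B \<in> isocls C A)"
proof -
  have "A \<in> isocls C A" using assms by (simp add: isocls_def isomorphic_refl)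
  then have "(SOME B. B \<in> isocls C A) \<in> isocls C A" by (rule someI)
  then show "(SOME B. B \<in> isocls C A) \<in> obj C" "isomorphic C A (SOME B. B \<in> isocls C A)"
    by (auto simp: isocls_def)
qed

lemma zero_obj_hom_unique:
  assumes "is_zero_obj C Z" "A \<in> obj C"
  shows "f \<in> hom C Z A \<Longrightarrow> g \<in> hom C Z A \<Longrightarrow> f = g" "f \<in> hom C A Z \<Longrightarrow> g \<in> hom C A Z \<Longrightarrow> f = g"
  using assms unfolding is_zero_obj_def by blast+

text \<open>Every morphism from or to Z factors through the identity of Z, so it is zero once that
  identity is. As an equation, the condition passes to \<Sigma>Z and to full subcategories.\<close>

lemma is_zero_obj_iff: "is_zero_obj C Z \<longleftrightarrow> Z \<in> obj C \<and> idm C Z = zro C Z Z"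
proof
  assume Z: "is_zero_obj C Z"
  then have "Z \<in> obj C" by (simp add: is_zero_obj_def)
  then show "Z \<in> obj C \<and> idm C Z = zro C Z Z"
    using zero_obj_hom_unique(1)[OF Z, of Z "idm C Z" "zro C Z Z"] by (auto simp: hom_iff)
next
  assume Z: "Z \<in> obj C \<and> idm C Z = zro C Z Z"
  have "f = zro C Z A" if f: "f \<in> hom C Z A" for f A
  proof -
    have "f = f \<cdot> idm C Z" using f by (auto simp: hom_iff)
    also have "\<dots> = zro C Z A" using Z f by (auto simp: hom_iff)
    finally show ?thesis .
  qed
  moreover have "f = zro C A Z" if f: "f \<in> hom C A Z" for f A
  proof -
    have "f = idm C Z \<cdot> f" using f by (auto simp: hom_iff)
    also have "\<dots> = zro C A Z" using Z f by (auto simp: hom_iff)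
    finally show ?thesis .
  qed
  ultimately show "is_zero_obj C Z"
    unfolding is_zero_obj_def using Z by (auto intro!: ex1I simp: hom_group(1))
qed

lemma zero_obj_isomorphic:
  assumes "is_zero_obj C Z" "is_zero_obj C Z'"
  shows "isomorphic C Z Z'"
  unfolding isomorphic_iff using assms
  by (intro bexI[of _ "zro C Z Z'"] bexI[of _ "zro C Z' Z"]) (auto simp: is_zero_obj_iff hom_iff)

subsection \<open>Biproducts\<close>

text \<open>A relation, because biproducts are determined only up to isomorphism and no sum object
  is chosen.\<close>

definition bsum :: "'o \<Rightarrow> 'o \<Rightarrow> 'o \<Rightarrow> bool" where
  "bsum A B S \<longleftrightarrow> (\<exists>i1 i2 p1 p2. biprod C A B S i1 i2 p1 p2)"

lemma bsum_obj: "bsum A B S \<Longrightarrow> A \<in> obj C \<and> B \<in> obj C \<and> S \<in> obj C"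
  by (auto simp: bsum_def biprod_def)

text \<open>The isomorphism is the diagonal matrix of the two given isomorphisms, written through
  injections and projections.\<close>

lemma bsum_unique:
  assumes "bsum A B S" "bsum A' B' S'" "isomorphic C A A'" "isomorphic C B B'"
  shows "isomorphic C S S'"
proof -
  obtain i1 i2 p1 p2 where S: "biprod C A B S i1 i2 p1 p2" using assms(1) by (auto simp: bsum_def)
  obtain j1 j2 q1 q2 where S': "biprod C A' B' S' j1 j2 q1 q2" using assms(2) by (auto simp: bsum_def)
  obtain a a' where a: "a \<in> hom C A A'" "a' \<in> hom C A' A" "a' \<cdot> a = idm C A" "a \<cdot> a' = idm C A'"
    using assms(3) by (auto simp: isomorphic_iff)
  obtain b b' where b: "b \<in> hom C B B'" "b' \<in> hom C B' B" "b' \<cdot> b = idm C B" "b \<cdot> b' = idm C B'"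
    using assms(4) by (auto simp: isomorphic_iff)
  have eqs: "a' \<cdot> a = idm C A" "a \<cdot> a' = idm C A'" "b' \<cdot> b = idm C B" "b \<cdot> b' = idm C B'"
    "p1 \<cdot> i1 = idm C A" "p2 \<cdot> i2 = idm C B" "p1 \<cdot> i2 = zro C B A" "p2 \<cdot> i1 = zro C A B"
    "q1 \<cdot> j1 = idm C A'" "q2 \<cdot> j2 = idm C B'" "q1 \<cdot> j2 = zro C B' A'" "q2 \<cdot> j1 = zro C A' B'"
    and sums: "i1 \<cdot> p1 \<boxplus> i2 \<cdot> p2 = idm C S" "j1 \<cdot> q1 \<boxplus> j2 \<cdot> q2 = idm C S'"
    and homs: "i1 \<in> hom C A S" "i2 \<in> hom C B S" "p1 \<in> hom C S A" "p2 \<in> hom C S B"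
      "j1 \<in> hom C A' S'" "j2 \<in> hom C B' S'" "q1 \<in> hom C S' A'" "q2 \<in> hom C S' B'"
    and obs: "A \<in> obj C" "B \<in> obj C" "S \<in> obj C" "A' \<in> obj C" "B' \<in> obj C" "S' \<in> obj C"
    using a b S S' by (simp_all add: biprod_def)
  note [simp] = eqs eqs[THEN comp_reduce]
  show ?thesis
    unfolding isomorphic_iff using a(1,2) b(1,2) homs obs
    by (intro bexI[of _ "j1 \<cdot> (a \<cdot> p1) \<boxplus> j2 \<cdot> (b \<cdot> p2)"] bexI[of _ "i1 \<cdot> (a' \<cdot> q1) \<boxplus> i2 \<cdot> (b' \<cdot> q2)"] conjI)
      (simp_all add: hom_iff sums)
qed

lemma bsum_commute:
  assumes "bsum A B S"
  shows "bsum B A S"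
proof -
  obtain i1 i2 p1 p2 where S: "biprod C A B S i1 i2 p1 p2" using assms(1) by (auto simp: bsum_def)
  then have "i2 \<cdot> p2 \<boxplus> i1 \<cdot> p1 = i1 \<cdot> p1 \<boxplus> i2 \<cdot> p2"
    by (intro pls_commute) (auto simp: biprod_def hom_iff)
  then have "biprod C B A S i2 i1 p2 p1"
    using S by (auto simp: biprod_def)
  then show ?thesis by (auto simp: bsum_def)
qed

text \<open>P inherits a biproduct structure over A and Q: the injection of Q is assembled from
  those of B and D into P, and dually for the projection.\<close>

lemma bsum_assoc:
  assumes "bsum A B S" "bsum S D P" "bsum B D Q"
  shows "bsum A Q P"
proof -
  obtain i1 i2 p1 p2 where S: "biprod C A B S i1 i2 p1 p2" using assms(1) by (auto simp: bsum_def)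
  obtain j1 j2 q1 q2 where P: "biprod C S D P j1 j2 q1 q2" using assms(2) by (auto simp: bsum_def)
  obtain k1 k2 r1 r2 where Q: "biprod C B D Q k1 k2 r1 r2" using assms(3) by (auto simp: bsum_def)
  have eqs: "p1 \<cdot> i1 = idm C A" "p2 \<cdot> i2 = idm C B" "p1 \<cdot> i2 = zro C B A" "p2 \<cdot> i1 = zro C A B"
    "q1 \<cdot> j1 = idm C S" "q2 \<cdot> j2 = idm C D" "q1 \<cdot> j2 = zro C D S" "q2 \<cdot> j1 = zro C S D"
    "r1 \<cdot> k1 = idm C B" "r2 \<cdot> k2 = idm C D" "r1 \<cdot> k2 = zro C D B" "r2 \<cdot> k1 = zro C B D"
    and sums: "i1 \<cdot> p1 \<boxplus> i2 \<cdot> p2 = idm C S" "j1 \<cdot> q1 \<boxplus> j2 \<cdot> q2 = idm C P" "k1 \<cdot> r1 \<boxplus> k2 \<cdot> r2 = idm C Q"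
    and homs: "i1 \<in> hom C A S" "i2 \<in> hom C B S" "p1 \<in> hom C S A" "p2 \<in> hom C S B"
      "j1 \<in> hom C S P" "j2 \<in> hom C D P" "q1 \<in> hom C P S" "q2 \<in> hom C P D"
      "k1 \<in> hom C B Q" "k2 \<in> hom C D Q" "r1 \<in> hom C Q B" "r2 \<in> hom C Q D"
    and obs: "A \<in> obj C" "B \<in> obj C" "D \<in> obj C" "S \<in> obj C" "P \<in> obj C" "Q \<in> obj C"
    using S P Q by (simp_all add: biprod_def)
  note [simp] = eqs eqs[THEN comp_reduce]
  \<comment> \<open>The identity of S, split over A and B, is inserted between \<open>j1\<close> and
    \<open>q1\<close>; this refines the decomposition of the identity of P from two terms to
    three.\<close>
  have "j1 \<cdot> ((i1 \<cdot> p1 \<boxplus> i2 \<cdot> p2) \<cdot> q1) = j1 \<cdot> q1"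
    using homs obs by (subst sums) (auto simp: hom_iff)
  then have "j1 \<cdot> (i1 \<cdot> (p1 \<cdot> q1)) \<boxplus> j1 \<cdot> (i2 \<cdot> (p2 \<cdot> q1)) = j1 \<cdot> q1"
    using homs obs by (auto simp: hom_iff)
  then have *: "j1 \<cdot> (i1 \<cdot> (p1 \<cdot> q1)) \<boxplus> (j1 \<cdot> (i2 \<cdot> (p2 \<cdot> q1)) \<boxplus> j2 \<cdot> q2) = idm C P"
    using homs obs sums(2) by (subst pls_assoc[symmetric]) (auto simp: hom_iff)
  have "biprod C A Q P (j1 \<cdot> i1) (j1 \<cdot> (i2 \<cdot> r1) \<boxplus> j2 \<cdot> r2) (p1 \<cdot> q1) (k1 \<cdot> (p2 \<cdot> q1) \<boxplus> k2 \<cdot> q2)"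
    using homs obs * sums(3) unfolding biprod_def hom_iff by simp
  then show ?thesis by (auto simp: bsum_def)
qed

lemma biprod_zero_right:
  assumes "is_zero_obj C Z" "A \<in> obj C"
  shows "biprod C A Z A (idm C A) (zro C Z A) (idm C A) (zro C A Z)"
  using assms by (auto simp: biprod_def is_zero_obj_iff hom_iff)

lemma bsum_zero: "is_zero_obj C Z \<Longrightarrow> A \<in> obj C \<Longrightarrow> bsum A Z A"
  unfolding bsum_def using biprod_zero_right by blast

end

section \<open>Additive categories and the monoid of isomorphism classes under direct sum\<close>

locale additive = preadditive C for C :: "('o, 'm, 'x) cat_scheme" +
  assumes zero_exists: "\<exists>Z. is_zero_obj C Z"
    and biprod_exists: "\<And>A B. A \<in> obj C \<Longrightarrow> B \<in> obj C \<Longrightarrow> \<exists>S i1 i2 p1 p2. biprod C A B S i1 i2 p1 p2"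
begin

definition addcls :: "'o set \<Rightarrow> 'o set \<Rightarrow> 'o set" where
  "addcls a b = isocls C (SOME S. bsum (SOME A. A \<in> a) (SOME B. B \<in> b) S)"

definition zob :: 'o where "zob = (SOME Z. is_zero_obj C Z)"

lemma zob: "is_zero_obj C zob"
  unfolding zob_def using zero_exists by (rule someI_ex)

lemma zob_obj [simp]: "zob \<in> obj C"
  using zob by (simp add: is_zero_obj_def)

lemma bsum_exists: "A \<in> obj C \<Longrightarrow> B \<in> obj C \<Longrightarrow> \<exists>S. bsum A B S"
  unfolding bsum_def using biprod_exists by blast

text \<open>\<open>addcls\<close> adds arbitrary representatives; uniqueness of biproducts up to
  isomorphism makes the choice irrelevant.\<close>

lemma addcls_isocls:
  assumes "bsum A B S"
  shows "addcls (isocls C A) (isocls C B) = isocls C S"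
proof -
  let ?A = "SOME X. X \<in> isocls C A" and ?B = "SOME X. X \<in> isocls C B"
  have A: "?A \<in> obj C" "isomorphic C A ?A" and B: "?B \<in> obj C" "isomorphic C B ?B"
    using some_isocls bsum_obj[OF assms] by blast+
  have S: "bsum ?A ?B (SOME S. bsum ?A ?B S)"
    using bsum_exists[OF A(1) B(1)] by (rule someI_ex)
  then have "isomorphic C S (SOME S. bsum ?A ?B S)"
    using bsum_unique assms A B by blast
  then show ?thesis
    unfolding addcls_def using isocls_eq_iff bsum_obj S assms isomorphic_sym by blast
qed

definition sum_monoid :: "'o set monoid" where
  "sum_monoid = \<lparr>carrier = isocls C ` obj C, mult = addcls, one = isocls C zob\<rparr>"

lemma comm_monoid_sum_monoid: "comm_monoid sum_monoid"
proof (rule comm_monoidI)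
  fix x y z assume "x \<in> carrier sum_monoid" "y \<in> carrier sum_monoid" "z \<in> carrier sum_monoid"
  then obtain A B D where ABD: "A \<in> obj C" "B \<in> obj C" "D \<in> obj C"
    and x: "x = isocls C A" and y: "y = isocls C B" and z: "z = isocls C D"
    by (auto simp: sum_monoid_def)
  obtain S Q where S: "bsum A B S" and Q: "bsum B D Q" using bsum_exists ABD by blast
  obtain P where P: "bsum S D P" using bsum_exists bsum_obj[OF S] ABD by blast
  have "bsum A Q P" using bsum_assoc S P Q by blast
  then show "x \<otimes>\<^bsub>sum_monoid\<^esub> y \<otimes>\<^bsub>sum_monoid\<^esub> z = x \<otimes>\<^bsub>sum_monoid\<^esub> (y \<otimes>\<^bsub>sum_monoid\<^esub> z)"
    using S P Q by (simp add: sum_monoid_def x y z addcls_isocls)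
  show "x \<otimes>\<^bsub>sum_monoid\<^esub> y = y \<otimes>\<^bsub>sum_monoid\<^esub> x"
    using S bsum_commute[OF S] by (simp add: sum_monoid_def x y addcls_isocls)
  show "x \<otimes>\<^bsub>sum_monoid\<^esub> y \<in> carrier sum_monoid"
    using S bsum_obj[OF S] by (simp add: sum_monoid_def x y addcls_isocls)
  show "\<one>\<^bsub>sum_monoid\<^esub> \<otimes>\<^bsub>sum_monoid\<^esub> x = x"
    using bsum_commute[OF bsum_zero[OF zob ABD(1)]] by (simp add: sum_monoid_def x addcls_isocls)
qed (simp add: sum_monoid_def)

end

section \<open>Odd n-angulated categories\<close>

lemma gen_eq_ind: "gen C A = ind (isocls C A)"
  by (simp add: gen_def ind_def)

text \<open>Euler characteristic in terms of objects only and as a sum of functions, so that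
  replacing one object of the family has a computable effect, as in
  \<open>altsum_upd\<close>.\<close>

definition altsum :: "('o, 'm, 'x) cat_scheme \<Rightarrow> nat \<Rightarrow> (nat \<Rightarrow> 'o) \<Rightarrow> 'o set \<Rightarrow> int" where
  "altsum C n A = (\<Sum>i=1..n. if odd i then gen C (A i) else - gen C (A i))"

lemma chi_eq_altsum: "chi C n Y = altsum C n (fst Y)"
proof
  fix c
  show "chi C n Y c = altsum C n (fst Y) c"
    by (auto simp: chi_def altsum_def sum_fun_apply gen_def intro!: sum.cong)
qed

lemma altsum_upd:
  assumes "k \<in> {1..n}"
  shows "altsum C n (A(k := S)) =
    altsum C n A + (if odd k then gen C S - gen C (A k) else gen C (A k) - gen C S)"
proof -
  have "altsum C n B = (if odd k then gen C (B k) else - gen C (B k)) +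
      (\<Sum>i\<in>{1..n} - {k}. if odd i then gen C (B i) else - gen C (B i))" for B :: "nat \<Rightarrow> 'a"
    unfolding altsum_def using assms by (intro sum.remove) auto
  moreover have "(\<Sum>i\<in>{1..n} - {k}. if odd i then gen C ((A(k := S)) i) else - gen C ((A(k := S)) i)) =
    (\<Sum>i\<in>{1..n} - {k}. if odd i then gen C (A i) else - gen C (A i))"
    by (rule sum.cong) auto
  ultimately show ?thesis by simp
qed

lemma altsum_const: "altsum C n (\<lambda>_. Z) = (if odd n then gen C Z else 0)"
  unfolding altsum_def by (induction n) auto

lemma altsum_cong: "(\<And>i. i \<in> {1..n} \<Longrightarrow> A i = B i) \<Longrightarrow> altsum C n A = altsum C n B"
  unfolding altsum_def by (auto intro!: sum.cong)

lemma altsum_in_addsub: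
  "addsub K \<Longrightarrow> (\<And>i. i \<in> {1..n} \<Longrightarrow> gen C (A i) \<in> K) \<Longrightarrow> altsum C n A \<in> K"
  unfolding altsum_def by (auto intro!: addsub_sum addsub_uminus)

text \<open>The term at j is, up to sign, the total minus the other terms. This is the algebraic
  content of completeness for a subcategory cut out by a subgroup.\<close>

lemma altsum_remaining:
  assumes "addsub K" "altsum C n A \<in> K" "j \<in> {1..n}" "\<And>i. i \<in> {1..n} - {j} \<Longrightarrow> gen C (A i) \<in> K"
  shows "gen C (A j) \<in> K"
proof -
  have "altsum C n A = (if odd j then gen C (A j) else - gen C (A j)) +
      (\<Sum>i\<in>{1..n} - {j}. if odd i then gen C (A i) else - gen C (A i))"
    unfolding altsum_def using assms by (intro sum.remove) auto
  moreover have "(\<Sum>i\<in>{1..n} - {j}. if odd i then gen C (A i) else - gen C (A i)) \<in> K"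
  proof (rule addsub_sum[OF assms(1)])
    fix i assume "i \<in> {1..n} - {j}"
    from assms(4)[OF this] show "(if odd i then gen C (A i) else - gen C (A i)) \<in> K"
      using addsub_uminus[OF assms(1)] by simp
  qed
  ultimately have "(if odd j then gen C (A j) else - gen C (A j)) \<in> K"
    using addsub_diff[OF assms(1,2)] by fastforce
  then show ?thesis
    using addsub_uminus[OF assms(1), of "- gen C (A j)"] by (auto split: if_splits)
qed

locale odd_angulated =
  fixes C :: "('o, 'm, 'x) cat_scheme" and SO :: "'o \<Rightarrow> 'o" and SM :: "'m \<Rightarrow> 'm"
    and n :: nat and N :: "('o, 'm) nseq set"
  assumes angulated: "n_angulated C SO SM n N"
    and n_ge_3: "n \<ge> 3" and odd_n: "odd n"

sublocale odd_angulated \<subseteq> additive C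
  using angulated by unfold_locales (auto simp: n_angulated_def is_additive_def)

context odd_angulated
begin

section \<open>Shift functor and closure axioms of an odd n-angulated category\<close>

lemma n_pos [simp]: "Suc 0 \<le> n" "0 < n" "Suc 0 < n" "2 < n" "n \<noteq> 1" "n \<noteq> 2" "Suc 0 \<noteq> n" "2 \<noteq> n"
  "n \<noteq> Suc 0" "n \<noteq> Suc (Suc 0)" "Suc (Suc 0) \<noteq> n" "Suc (Suc 0) < n" "Suc (Suc 0) \<le> n"
  using n_ge_3 by auto

lemma automorphism: "is_additive_automorphism C SO SM"
  using angulated by (simp add: n_angulated_def)

lemma SO_obj [simp]: "A \<in> obj C \<Longrightarrow> SO A \<in> obj C"
  using automorphism unfolding is_additive_automorphism_def by (auto dest: bij_betwE)

lemma SM_hom: "f \<in> hom C A B \<Longrightarrow> SM f \<in> hom C (SO A) (SO B)"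
  using automorphism hom_obj[of f A B] unfolding is_additive_automorphism_def by blast

lemma SM_comp: "f \<in> hom C A B \<Longrightarrow> g \<in> hom C B D \<Longrightarrow> SM (g \<cdot> f) = SM g \<cdot> SM f"
  using automorphism hom_obj[of f A B] hom_obj[of g B D]
  unfolding is_additive_automorphism_def by blast

lemma SM_pls: "f \<in> hom C A B \<Longrightarrow> g \<in> hom C A B \<Longrightarrow> SM (f \<boxplus> g) = SM f \<boxplus> SM g"
  using automorphism hom_obj[of f A B] unfolding is_additive_automorphism_def by blast

lemma SM_simps [simp]:
  assumes "f \<in> arr C"
  shows "SM f \<in> arr C" "src C (SM f) = SO (src C f)" "tgt C (SM f) = SO (tgt C f)"
  using SM_hom[of f "src C f" "tgt C f"] assms by (auto simp: hom_iff)

lemma SM_idm [simp]: "A \<in> obj C \<Longrightarrow> SM (idm C A) = idm C (SO A)"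
  using automorphism unfolding is_additive_automorphism_def by blast

lemma SM_zro [simp]:
  assumes "A \<in> obj C" "B \<in> obj C"
  shows "SM (zro C A B) = zro C (SO A) (SO B)"
proof -
  have "zro C A B \<in> hom C A B" using hom_group(1) assms by blast
  then have "SM (zro C A B \<boxplus> zro C A B) = SM (zro C A B) \<boxplus> SM (zro C A B)"
    by (intro SM_pls)
  then have "SM (zro C A B) \<boxplus> SM (zro C A B) = SM (zro C A B)"
    using assms by simp
  then show ?thesis
    using pls_idem_imp_zro[of "SM (zro C A B)"] assms by simp
qed

lemma zero_obj_SO: "is_zero_obj C Z \<Longrightarrow> is_zero_obj C (SO Z)"
  unfolding is_zero_obj_iff using SM_idm[of Z] SM_zro[of Z Z] by simp

lemma angle_nseq: "Y \<in> N \<Longrightarrow> is_nseq C SO n Y"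
  using angulated by (simp add: n_angulated_def)

lemma angle_obj: "Y \<in> N \<Longrightarrow> i \<in> {1..n} \<Longrightarrow> fst Y i \<in> obj C"
  using angle_nseq by (simp add: is_nseq_def)

lemma angle_closure:
  shows "\<forall>U\<in>N. \<forall>Y\<in>N. \<forall>Z. is_nseq C SO n Z \<and> nseq_dsum C SM n U Y Z \<longrightarrow> Z \<in> N"
    and "\<forall>U\<in>N. \<forall>Y \<phi>. is_nseq C SO n Y \<and> nseq_iso C SM n U Y \<phi> \<longrightarrow> Y \<in> N"
    and "\<forall>A\<in>obj C. \<forall>Z. is_zero_obj C Z \<longrightarrow> triv_nseq C SO n Z A \<in> N"
    and "\<forall>A\<in>obj C. \<forall>B\<in>obj C. \<forall>f\<in>hom C A B. \<exists>U\<in>N. fst U 1 = A \<and> fst U 2 = B \<and> snd U 1 = f"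
    and "\<forall>U. is_nseq C SO n U \<longrightarrow> (U \<in> N \<longleftrightarrow> rot C SO SM n U \<in> N)"
  by (insert angulated[unfolded n_angulated_def]) (elim conjE, assumption)+

lemma angle_dsum: "U \<in> N \<Longrightarrow> Y \<in> N \<Longrightarrow> is_nseq C SO n Z \<Longrightarrow> nseq_dsum C SM n U Y Z \<Longrightarrow> Z \<in> N"
  using angle_closure(1) by blast

lemma angle_iso: "U \<in> N \<Longrightarrow> is_nseq C SO n Y \<Longrightarrow> nseq_iso C SM n U Y \<phi> \<Longrightarrow> Y \<in> N"
  using angle_closure(2) by blast

lemma angle_triv: "A \<in> obj C \<Longrightarrow> is_zero_obj C Z \<Longrightarrow> triv_nseq C SO n Z A \<in> N"
  using angle_closure(3) by blast

lemma angle_exists: "f \<in> hom C A B \<Longrightarrow> \<exists>U\<in>N. fst U 1 = A \<and> fst U 2 = B \<and> snd U 1 = f"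
  using angle_closure(4) hom_obj by blast

lemma angle_rot: "is_nseq C SO n U \<Longrightarrow> U \<in> N \<longleftrightarrow> rot C SO SM n U \<in> N"
  using angle_closure(5) by blast

lemma is_iso_idm: "A \<in> obj C \<Longrightarrow> is_iso C (idm C A)"
  by (rule is_isoI[of _ A A "idm C A"]) (auto simp: hom_iff)

text \<open>Sequences are functions on all of nat, so membership in the class of n-angles must be
  transported along agreement on 1..n.\<close>

lemma angle_cong:
  assumes Y: "Y \<in> N" and eq: "\<And>i. i \<in> {1..n} \<Longrightarrow> fst Y' i = fst Y i \<and> snd Y' i = snd Y i"
  shows "Y' \<in> N"
proof -
  have nseq: "is_nseq C SO n Y'"
    using angle_nseq[OF Y] eq by (simp add: is_nseq_def)
  have "nseq_iso C SM n Y Y' (\<lambda>i. idm C (fst Y i))"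
    using angle_nseq[OF Y] eq
    by (simp add: is_nseq_def nseq_iso_def nseq_mor_def is_iso_idm hom_iff)
  then show ?thesis using angle_iso[OF Y nseq] by blast
qed

lemma nseq_rot:
  assumes "is_nseq C SO n Y"
  shows "is_nseq C SO n (rot C SO SM n Y)"
proof -
  have obs: "\<And>i. i \<in> {1..n} \<Longrightarrow> fst Y i \<in> obj C"
    and homs: "\<And>i. i \<in> {1..<n} \<Longrightarrow> snd Y i \<in> hom C (fst Y i) (fst Y (Suc i))"
    and last: "snd Y n \<in> hom C (fst Y n) (SO (fst Y 1))"
    using assms by (auto simp: is_nseq_def)
  show ?thesis
    unfolding is_nseq_def
  proof (intro conjI ballI)
    fix i assume "i \<in> {1..n}"
    then show "fst (rot C SO SM n Y) i \<in> obj C" using obs by (auto simp: rot_def)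
  next
    fix i assume i: "i \<in> {1..<n}"
    show "snd (rot C SO SM n Y) i \<in> hom C (fst (rot C SO SM n Y) i) (fst (rot C SO SM n Y) (Suc i))"
    proof (cases "Suc i = n")
      case True
      then show ?thesis using i last by (auto simp: rot_def)
    next
      case False
      then show ?thesis using i homs[of "Suc i"] by (auto simp: rot_def)
    qed
  next
    have "snd Y 1 \<in> hom C (fst Y 1) (fst Y 2)" using homs[of 1] by (auto simp: numeral_2_eq_2)
    then show "snd (rot C SO SM n Y) n \<in> hom C (fst (rot C SO SM n Y) n) (SO (fst (rot C SO SM n Y) 1))"
      using odd_n by (auto simp: rot_def hom_iff numeral_2_eq_2)
  qed
qed

subsection \<open>Trivial n-angles in arbitrary position\<close>

definition triv_at :: "nat \<Rightarrow> 'o \<Rightarrow> ('o, 'm) nseq" where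
  "triv_at k B =
     (let A = (\<lambda>i. if i = k \<or> i = Suc k then B else zob) in
      (A, \<lambda>i. if i = k then idm C B else if i < n then zro C (A i) (A (Suc i))
           else zro C (A n) (SO (A 1))))"

lemma triv_at_fst: "fst (triv_at k B) i = (if i = k \<or> i = Suc k then B else zob)"
  by (simp add: triv_at_def Let_def)

lemma triv_at_nseq:
  assumes "B \<in> obj C" "1 \<le> k" "k < n"
  shows "is_nseq C SO n (triv_at k B)"
  using assms by (auto simp: is_nseq_def triv_at_def Let_def hom_iff)

text \<open>Rotation moves the identity one place to the left, so the induction uses the rotation
  axiom backwards: the rotation of the sequence at position k+1 is isomorphic to the n-angle at
  position k.\<close>

lemma triv_at_angle:
  assumes B: "B \<in> obj C" and k: "1 \<le> k" "k < n"
  shows "triv_at k B \<in> N"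
  using k
proof (induction k rule: dec_induct)
  case base
  show ?case
    by (rule angle_cong[OF angle_triv[OF B zob]]) (auto simp: triv_at_def triv_nseq_def Let_def numeral_2_eq_2)
next
  case (step k)
  let ?T = "triv_at k B" and ?R = "rot C SO SM n (triv_at (Suc k) B)"
  \<comment> \<open>The two sequences differ in their objects only at position n, with
    \<open>zob\<close> on one side and \<open>SO zob\<close> on the other; the zero map between them
    is an isomorphism.\<close>
  let ?\<phi> = "\<lambda>i. if i < n then idm C (fst ?T i) else zro C zob (SO zob)"
  have T: "?T \<in> N" using step by simp
  have nseq: "is_nseq C SO n (triv_at (Suc k) B)" using step triv_at_nseq[OF B] by simp
  have zero: "is_zero_obj C (SO zob)" using zero_obj_SO zob by blast
  have "is_iso C (zro C zob (SO zob))"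
    using zob zero by (intro is_isoI[of _ zob "SO zob" "zro C (SO zob) zob"]) (auto simp: is_zero_obj_iff hom_iff)
  then have isos: "\<forall>i\<in>{1..n}. is_iso C (?\<phi> i)"
    using B by (auto simp: triv_at_fst is_iso_idm)
  have "nseq_mor C SM n ?T ?R ?\<phi>"
    unfolding nseq_mor_def
  proof (intro conjI ballI)
    fix i assume i: "i \<in> {1..n}"
    then have "i < n \<or> i = n" by auto
    then show "?\<phi> i \<in> hom C (fst ?T i) (fst ?R i)"
      using step B by (auto simp: triv_at_def rot_def Let_def hom_iff)
  next
    fix i assume i: "i \<in> {1..<n}"
    have "Suc i < n \<or> Suc i = n" using i by auto
    then show "snd ?R i \<cdot> ?\<phi> i = ?\<phi> (Suc i) \<cdot> snd ?T i"
      using step B i by (auto simp: triv_at_def rot_def Let_def)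
  next
    show "snd ?R n \<cdot> ?\<phi> n = SM (?\<phi> 1) \<cdot> snd ?T n"
      using step B odd_n by (auto simp: triv_at_def rot_def Let_def numeral_2_eq_2)
  qed
  then have "?R \<in> N"
    using angle_iso[OF T nseq_rot[OF nseq], of ?\<phi>] isos by (simp add: nseq_iso_def)
  then show ?case using angle_rot[OF nseq] by simp
qed

text \<open>The biproduct object and maps are prescribed in each position, so that a later sum can
  keep an object literally equal where nothing is added.\<close>

lemma angle_direct_sum:
  assumes U: "U \<in> N" and V: "V \<in> N"
    and bi: "\<And>k. k \<in> {1..n} \<Longrightarrow> biprod C (fst U k) (fst V k) (D k) (i1 k) (i2 k) (p1 k) (p2 k)"
  shows "(D, \<lambda>k. if k < n
      then i1 (Suc k) \<cdot> (snd U k \<cdot> p1 k) \<boxplus> i2 (Suc k) \<cdot> (snd V k \<cdot> p2 k)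
      else SM (i1 1) \<cdot> (snd U n \<cdot> p1 n) \<boxplus> SM (i2 1) \<cdot> (snd V n \<cdot> p2 n)) \<in> N"
proof (rule angle_dsum[OF U V])
  let ?Z = "(D, \<lambda>k. if k < n
      then i1 (Suc k) \<cdot> (snd U k \<cdot> p1 k) \<boxplus> i2 (Suc k) \<cdot> (snd V k \<cdot> p2 k)
      else SM (i1 1) \<cdot> (snd U n \<cdot> p1 n) \<boxplus> SM (i2 1) \<cdot> (snd V n \<cdot> p2 n))"
  show "nseq_dsum C SM n U V ?Z"
    unfolding nseq_dsum_def using bi by (intro exI[of _ i1] exI[of _ i2] exI[of _ p1] exI[of _ p2]) auto
  show "is_nseq C SO n ?Z"
    unfolding is_nseq_def
  proof (intro conjI ballI)
    fix i assume "i \<in> {1..n}"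
    then show "fst ?Z i \<in> obj C" using bi[of i] by (simp add: biprod_def)
  next
    fix i assume i: "i \<in> {1..<n}"
    then have "snd U i \<in> hom C (fst U i) (fst U (Suc i))" "snd V i \<in> hom C (fst V i) (fst V (Suc i))"
      using angle_nseq[OF U] angle_nseq[OF V] by (auto simp: is_nseq_def)
    then show "snd ?Z i \<in> hom C (fst ?Z i) (fst ?Z (Suc i))"
      using bi[of i] bi[of "Suc i"] i by (simp add: biprod_def hom_iff)
  next
    have "snd U n \<in> hom C (fst U n) (SO (fst U 1))" "snd V n \<in> hom C (fst V n) (SO (fst V 1))"
      using angle_nseq[OF U] angle_nseq[OF V] by (auto simp: is_nseq_def)
    then show "snd ?Z n \<in> hom C (fst ?Z n) (SO (fst ?Z 1))"
      using bi[of n] bi[of 1] by (simp add: biprod_def hom_iff)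
  qed
qed

text \<open>Sum with the trivial n-angle on B at positions k and k+1. For k at least 3 the first two
  objects and the map between them stay untouched, which matters when a first morphism is
  prescribed.\<close>

lemma angle_add_triv:
  assumes Y: "Y \<in> N" and k: "1 \<le> k" "k < n"
    and S: "bsum (fst Y k) B S" and S': "bsum (fst Y (Suc k)) B S'"
  obtains Y' where "Y' \<in> N" "fst Y' = (fst Y)(k := S, Suc k := S')" "3 \<le> k \<Longrightarrow> snd Y' 1 = snd Y 1"
proof -
  obtain a1 a2 c1 c2 where a: "biprod C (fst Y k) B S a1 a2 c1 c2"
    using S by (auto simp: bsum_def)
  obtain b1 b2 d1 d2 where b: "biprod C (fst Y (Suc k)) B S' b1 b2 d1 d2"
    using S' by (auto simp: bsum_def)
  \<comment> \<open>Away from k and k+1 the second summand is the zero object, and the first summand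
    itself serves as the biproduct; hence the objects there stay equal, not merely
    isomorphic.\<close>
  define i1 where "i1 j = (if j = k then a1 else if j = Suc k then b1 else idm C (fst Y j))" for j
  define i2 where "i2 j = (if j = k then a2 else if j = Suc k then b2 else zro C zob (fst Y j))" for j
  define p1 where "p1 j = (if j = k then c1 else if j = Suc k then d1 else idm C (fst Y j))" for j
  define p2 where "p2 j = (if j = k then c2 else if j = Suc k then d2 else zro C (fst Y j) zob)" for j
  have "B \<in> obj C" using bsum_obj[OF S] by simp
  then have T: "triv_at k B \<in> N" using triv_at_angle k by simp
  have bi: "biprod C (fst Y j) (fst (triv_at k B) j) (((fst Y)(k := S, Suc k := S')) j) (i1 j) (i2 j) (p1 j) (p2 j)"
    if "j \<in> {1..n}" for j
    using a b biprod_zero_right[OF zob angle_obj[OF Y that]]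
    by (auto simp: triv_at_fst i1_def i2_def p1_def p2_def)
  note sum = angle_direct_sum[OF Y T, of "(fst Y)(k := S, Suc k := S')" i1 i2 p1 p2, OF bi]
  have "snd Y 1 \<in> hom C (fst Y 1) (fst Y (Suc 1))"
    using angle_nseq[OF Y] by (auto simp: is_nseq_def)
  then have first: "i1 (Suc 1) \<cdot> (snd Y 1 \<cdot> p1 1) \<boxplus> i2 (Suc 1) \<cdot> (snd (triv_at k B) 1 \<cdot> p2 1) = snd Y 1" if "3 \<le> k"
    using that k angle_obj[OF Y, of 1] angle_obj[OF Y, of "Suc 1"]
    by (auto simp: i1_def i2_def p1_def p2_def triv_at_def Let_def hom_iff)
  show ?thesis
    using first by (intro that[OF sum]) simp_all
qed

text \<open>Induction on m: density gives a complement B of the object at m+1, and the trivial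
  n-angle on B is added at positions m+1 and m+2, for which m+1 < n leaves room. Positions up to m0
  are never touched; m0 at least 2 therefore preserves the first morphism.\<close>

lemma angle_fill:
  assumes dense: "subcat_dense C U"
    and K: "addsub K" "\<And>A B S. bsum A B S \<Longrightarrow> gen C S - gen C A - gen C B \<in> K"
    and Y: "Y \<in> N" "\<And>i. i \<in> {1..m0} \<Longrightarrow> fst Y i \<in> U" and m: "m0 \<le> m" "m < n"
  shows "\<exists>Y'\<in>N. (\<forall>i\<in>{1..m}. fst Y' i \<in> U) \<and> (\<forall>i\<in>{1..m0}. fst Y' i = fst Y i) \<and>
    (2 \<le> m0 \<longrightarrow> snd Y' 1 = snd Y 1) \<and> chi C n Y' - chi C n Y \<in> K"
  using m
proof (induction m rule: dec_induct)
  case base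
  then show ?case using Y addsub_zero[OF K(1)] by (intro bexI[of _ Y]) (auto simp: zero_fun_def)
next
  case (step m)
  then obtain Y' where Y': "Y' \<in> N" "\<forall>i\<in>{1..m}. fst Y' i \<in> U" "\<forall>i\<in>{1..m0}. fst Y' i = fst Y i"
    "2 \<le> m0 \<longrightarrow> snd Y' 1 = snd Y 1" "chi C n Y' - chi C n Y \<in> K"
    using Suc_lessD by blast
  let ?k = "Suc m"
  have obs: "fst Y' ?k \<in> obj C" "fst Y' (Suc ?k) \<in> obj C"
    using angle_obj[OF Y'(1)] step by auto
  obtain S B where S: "S \<in> U" "bsum (fst Y' ?k) B S"
    using dense obs(1) unfolding subcat_dense_def bsum_def by blast
  obtain S' where S': "bsum (fst Y' (Suc ?k)) B S'"
    using bsum_exists[OF obs(2)] bsum_obj[OF S(2)] by blast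
  obtain Y'' where Y'': "Y'' \<in> N" "fst Y'' = (fst Y')(?k := S, Suc ?k := S')"
    "3 \<le> ?k \<Longrightarrow> snd Y'' 1 = snd Y' 1"
    using angle_add_triv[OF Y'(1) _ _ S(2) S'] step by auto
  \<comment> \<open>The two positions carry opposite signs, so the terms \<open>gen C B\<close>
    cancel and the change of \<open>chi\<close> is a difference of two direct sum relations.\<close>
  let ?s = "gen C S - gen C (fst Y' ?k) - gen C B"
  let ?s' = "gen C S' - gen C (fst Y' (Suc ?k)) - gen C B"
  have "chi C n Y'' - chi C n Y' = (if odd ?k then ?s - ?s' else ?s' - ?s)"
    using step by (simp add: chi_eq_altsum Y''(2) altsum_upd)
  also have "\<dots> \<in> K"
    using addsub_diff[OF K(1) K(2)[OF S(2)] K(2)[OF S']] addsub_diff[OF K(1) K(2)[OF S'] K(2)[OF S(2)]]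
    by (simp only: split: if_split) blast
  finally have "chi C n Y'' - chi C n Y' \<in> K" .
  from addsub_add[OF K(1) this Y'(5)] have "chi C n Y'' - chi C n Y \<in> K"
    by simp
  moreover have "2 \<le> m0 \<longrightarrow> snd Y'' 1 = snd Y 1"
    using Y''(3) Y'(4) \<open>m0 \<le> m\<close> by simp
  moreover have "\<forall>i\<in>{1..Suc m}. fst Y'' i \<in> U" "\<forall>i\<in>{1..m0}. fst Y'' i = fst Y i"
    using Y'(2,3) \<open>m0 \<le> m\<close> S(1) by (auto simp: Y''(2) le_Suc_eq)
  ultimately show ?case
    using Y''(1) by blast
qed

lemma complete_last:
  assumes "subcat_complete n N U" "Y \<in> N" "\<forall>i\<in>{1..n - 1}. fst Y i \<in> U" "i \<in> {1..n}"
  shows "fst Y i \<in> U"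
proof (cases "i = n")
  case True
  have "\<forall>i\<in>{1..n} - {n}. fst Y i \<in> U"
  proof
    fix i assume "i \<in> {1..n} - {n}"
    then have "i \<in> {1..n - 1}" by auto
    then show "fst Y i \<in> U" using assms(3) by blast
  qed
  then show ?thesis using assms(1,2,4) True unfolding subcat_complete_def by blast
next
  case False
  then have "i \<in> {1..n - 1}" using assms(4) by auto
  then show ?thesis using assms(3) by blast
qed

text \<open>The n-angle with objects A, S, B, 0, ..., 0 has all objects but the first in U. It
  arises from the trivial n-angle on A by adding the one on B at positions 2 and 3.\<close>

lemma complete_cancel:
  assumes complete: "subcat_complete n N U" and Z: "is_zero_obj C Z" "Z \<in> U"
    and iso: "\<And>A B. A \<in> U \<Longrightarrow> isomorphic C A B \<Longrightarrow> B \<in> U"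
    and S: "bsum A B S" "B \<in> U" "S \<in> U"
  shows "A \<in> U"
proof -
  have obs: "A \<in> obj C" "B \<in> obj C" using bsum_obj[OF S(1)] by auto
  have zobU: "zob \<in> U" using iso[OF Z(2) zero_obj_isomorphic[OF Z(1) zob]] .
  have T: "triv_at 1 A \<in> N" using triv_at_angle[OF obs(1)] by simp
  obtain Y where Y: "Y \<in> N" "fst Y = (fst (triv_at 1 A))(2 := S, Suc 2 := B)"
    using angle_add_triv[OF T, of 2 B S B] S(1) bsum_commute[OF bsum_zero[OF zob obs(2)]]
    by (auto simp: triv_at_fst)
  have "fst Y 1 \<in> U"
    using complete[unfolded subcat_complete_def, rule_format, OF Y(1), of 1] S(2,3) zobU
    by (simp add: Y(2) triv_at_fst)
  then show ?thesis by (simp add: Y(2) triv_at_fst)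
qed

end

section \<open>Full subcategories\<close>

lemma full_sub_simps [simp]:
  "obj (full_sub C U) = U" "src (full_sub C U) = src C" "tgt (full_sub C U) = tgt C"
  "cmp (full_sub C U) = cmp C" "idm (full_sub C U) = idm C" "pls (full_sub C U) = pls C"
  "zro (full_sub C U) = zro C" "ngt (full_sub C U) = ngt C"
  "arr (full_sub C U) = {f \<in> arr C. src C f \<in> U \<and> tgt C f \<in> U}"
  by (simp_all add: full_sub_def)

lemma hom_full_sub: "hom (full_sub C U) A B = (if A \<in> U \<and> B \<in> U then hom C A B else {})"
  by (auto simp: hom_def)

lemma biprod_full_sub:
  "U \<subseteq> obj C \<Longrightarrow> biprod (full_sub C U) A B S i1 i2 p1 p2 \<longleftrightarrow>
     A \<in> U \<and> B \<in> U \<and> S \<in> U \<and> biprod C A B S i1 i2 p1 p2"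
  by (auto simp: biprod_def hom_full_sub)

lemma is_iso_full_sub: "is_iso (full_sub C U) f \<Longrightarrow> is_iso C f"
  by (auto simp: is_iso_def hom_full_sub)

lemma rot_full_sub: "rot (full_sub C U) SO SM n Y = rot C SO SM n Y"
  unfolding rot_def full_sub_simps ..

lemma triv_nseq_full_sub: "triv_nseq (full_sub C U) SO n Z A = triv_nseq C SO n Z A"
  unfolding triv_nseq_def full_sub_simps ..

lemma cone_full_sub: "cone (full_sub C U) SO SM n = cone C SO SM n"
  unfolding cone_def[abs_def] full_sub_simps ..

lemma (in preadditive) preadditive_full_sub:
  assumes U: "U \<subseteq> obj C"
  shows "preadditive (full_sub C U)"
proof
  have cat: "is_category (full_sub C U)"
    unfolding is_category_def
  proof (intro conjI ballI)
    fix A B D E f g h assume *: "A \<in> obj (full_sub C U)" "B \<in> obj (full_sub C U)" "D \<in> obj (full_sub C U)"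
      "E \<in> obj (full_sub C U)" "f \<in> hom (full_sub C U) A B" "g \<in> hom (full_sub C U) B D"
      "h \<in> hom (full_sub C U) D E"
    then show "cmp (full_sub C U) h (cmp (full_sub C U) g f) = cmp (full_sub C U) (cmp (full_sub C U) h g) f"
      by (simp add: hom_full_sub hom_iff)
  qed (use U in \<open>auto simp: hom_full_sub hom_iff split: if_splits\<close>)
  show "is_preadditive (full_sub C U)"
    unfolding is_preadditive_def
  proof (intro conjI ballI)
    fix A B f g assume "A \<in> obj (full_sub C U)" "B \<in> obj (full_sub C U)"
      "f \<in> hom (full_sub C U) A B" "g \<in> hom (full_sub C U) A B"
    then show "pls (full_sub C U) f g = pls (full_sub C U) g f"
      using hom_group(5)[of A B f g] U by (auto simp: hom_full_sub)
  qed (use U cat in \<open>auto simp: hom_full_sub hom_iff pls_assoc pls_ngt subset_iff split: if_splits\<close>)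
qed

lemma (in preadditive) is_zero_obj_full_sub:
  assumes U: "U \<subseteq> obj C"
  shows "is_zero_obj (full_sub C U) Z \<longleftrightarrow> Z \<in> U \<and> is_zero_obj C Z"
  using preadditive.is_zero_obj_iff[OF preadditive_full_sub[OF U], of Z] U by (auto simp: is_zero_obj_iff)

lemma is_nseq_full_sub:
  assumes "\<And>A. A \<in> U \<Longrightarrow> SO A \<in> U" "U \<subseteq> obj C" "1 \<le> n"
  shows "is_nseq (full_sub C U) SO n Y \<longleftrightarrow> is_nseq C SO n Y \<and> (\<forall>i\<in>{1..n}. fst Y i \<in> U)"
proof -
  have *: "hom (full_sub C U) (fst Y i) (fst Y (Suc i)) = hom C (fst Y i) (fst Y (Suc i))"
    if "\<forall>i\<in>{1..n}. fst Y i \<in> U" "i \<in> {1..<n}" for i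
    using that by (auto simp: hom_full_sub)
  have "hom (full_sub C U) (fst Y n) (SO (fst Y 1)) = hom C (fst Y n) (SO (fst Y 1))"
    if "\<forall>i\<in>{1..n}. fst Y i \<in> U"
    using that assms by (auto simp: hom_full_sub)
  then show ?thesis
    using * assms(2) unfolding is_nseq_def by auto
qed

lemma nseq_mor_full_sub:
  assumes "\<forall>i\<in>{1..n}. fst X i \<in> U" "\<forall>i\<in>{1..n}. fst Y i \<in> U"
  shows "nseq_mor (full_sub C U) SM n X Y \<phi> \<longleftrightarrow> nseq_mor C SM n X Y \<phi>"
  using assms unfolding nseq_mor_def by (auto simp: hom_full_sub)

lemma nseq_dsum_full_sub:
  assumes "U \<subseteq> obj C" "nseq_dsum (full_sub C U) SM n X Y Z"
  shows "nseq_dsum C SM n X Y Z"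
  using assms(2) unfolding nseq_dsum_def biprod_full_sub[OF assms(1)] full_sub_simps by blast

text \<open>Most axioms restrict termwise, since direct sums, cones and rotations formed in U are
  those of the ambient category. The equivalence for \<open>SO\<close> makes \<Sigma> surjective on
  the objects and arrows of the subcategory. Density and completeness enter in the existence of an
  n-angle on a given morphism.\<close>

lemma (in odd_angulated) angulated_subcat:
  assumes U: "U \<subseteq> obj C"
    and iso: "\<And>A B. A \<in> U \<Longrightarrow> isomorphic C A B \<Longrightarrow> B \<in> U"
    and zero: "zob \<in> U"
    and sum: "\<And>A B S. A \<in> U \<Longrightarrow> B \<in> U \<Longrightarrow> bsum A B S \<Longrightarrow> S \<in> U"
    and shift: "\<And>A. A \<in> obj C \<Longrightarrow> SO A \<in> U \<longleftrightarrow> A \<in> U"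
    and dense: "subcat_dense C U" and complete: "subcat_complete n N U"
  shows "n_ang_subcat C SO SM n N U (angles_in n N U)"
proof -
  let ?C = "full_sub C U" and ?N = "angles_in n N U"
  have SU: "SO A \<in> U" if "A \<in> U" for A using shift that U by blast
  have bijO: "bij_betw SO (obj C) (obj C)" and bijM: "bij_betw SM (arr C) (arr C)"
    using automorphism by (auto simp: is_additive_automorphism_def)
  have bijU: "bij_betw SO U U"
  proof (rule bij_betw_imageI)
    show "inj_on SO U" using bijO U by (auto simp: bij_betw_def intro: inj_on_subset)
    show "SO ` U = U"
    proof (intro equalityI subsetI)
      fix B assume B: "B \<in> U"
      then have "B \<in> SO ` obj C" using bijO U by (auto simp: bij_betw_def)
      then show "B \<in> SO ` U" using shift B by auto
    qed (use SU in auto)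
  qed
  have bijA: "bij_betw SM (arr ?C) (arr ?C)"
  proof (rule bij_betw_imageI)
    show "inj_on SM (arr ?C)" using bijM by (auto simp: bij_betw_def intro: inj_on_subset)
    show "SM ` arr ?C = arr ?C"
    proof (intro equalityI subsetI)
      fix f assume f: "f \<in> arr ?C"
      then have "f \<in> SM ` arr C" using bijM by (simp add: bij_betw_def)
      then obtain g where g: "g \<in> arr C" "f = SM g" by blast
      then have "src C g \<in> U" "tgt C g \<in> U" using f shift by auto
      then show "f \<in> SM ` arr ?C" using g by auto
    qed (use SU in auto)
  qed
  have nseq: "is_nseq ?C SO n Y \<longleftrightarrow> is_nseq C SO n Y \<and> (\<forall>i\<in>{1..n}. fst Y i \<in> U)" for Y
    by (intro is_nseq_full_sub) (use SU U in auto)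
  note obs = preadditive_full_sub[OF U, THEN preadditive.is_preadditive]
  have angle_iff: "Y \<in> ?N \<longleftrightarrow> Y \<in> N \<and> (\<forall>i\<in>{1..n}. fst Y i \<in> U)" for Y
    by (simp add: angles_in_def)
  have addC: "is_additive ?C"
    unfolding is_additive_def
  proof (intro conjI ballI)
    show "\<exists>Z. is_zero_obj ?C Z" using is_zero_obj_full_sub[OF U] zob zero by blast
    fix A B assume AB: "A \<in> obj ?C" "B \<in> obj ?C"
    then have "A \<in> obj C" "B \<in> obj C" using U by auto
    then obtain S i1 i2 p1 p2 where S: "biprod C A B S i1 i2 p1 p2"
      using biprod_exists by blast
    then have "S \<in> U" using sum[of A B S] AB by (auto simp: bsum_def)
    then show "\<exists>S i1 i2 p1 p2. biprod ?C A B S i1 i2 p1 p2"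
      using S AB unfolding biprod_full_sub[OF U] full_sub_simps by blast
  qed (rule obs)
  have autC: "is_additive_automorphism ?C SO SM"
    unfolding is_additive_automorphism_def
  proof (intro conjI ballI)
    fix A B D f g assume "A \<in> obj ?C" "B \<in> obj ?C" "D \<in> obj ?C" "f \<in> hom ?C A B" "g \<in> hom ?C B D"
    then show "SM (cmp ?C g f) = cmp ?C (SM g) (SM f)"
      using SM_comp[of f A B g D] by (simp add: hom_full_sub)
  next
    fix A B f g assume "A \<in> obj ?C" "B \<in> obj ?C" "f \<in> hom ?C A B" "g \<in> hom ?C A B"
    then show "SM (pls ?C f g) = pls ?C (SM f) (SM g)"
      using SM_pls[of f A B g] by (simp add: hom_full_sub)
  qed (use bijU bijA SU U SM_hom in \<open>auto simp: hom_full_sub subset_iff\<close>)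
  have first: "\<exists>Y\<in>?N. fst Y 1 = A \<and> fst Y 2 = B \<and> snd Y 1 = f"
    if "A \<in> U" "B \<in> U" "f \<in> hom C A B" for A B f
  proof -
    obtain Y where Y: "Y \<in> N" "fst Y 1 = A" "fst Y 2 = B" "snd Y 1 = f"
      using angle_exists[OF \<open>f \<in> hom C A B\<close>] by auto
    have Y12: "fst Y i \<in> U" if "i \<in> {1..2}" for i
    proof -
      have "i = 1 \<or> i = 2" using that by auto
      then show ?thesis using Y \<open>A \<in> U\<close> \<open>B \<in> U\<close> by auto
    qed
    have "2 \<le> n - 1" "n - 1 < n" using n_ge_3 by auto
    \<comment> \<open>No Euler characteristic is tracked here, so the subgroup is taken to be
      everything; m0 = 2 keeps A, B and f.\<close>
    from angle_fill[OF dense, of UNIV Y 2 "n - 1", OF _ _ Y(1) Y12 this]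
    obtain Y' where Y': "Y' \<in> N" "\<forall>i\<in>{1..n - 1}. fst Y' i \<in> U" "\<forall>i\<in>{1..2}. fst Y' i = fst Y i"
      "snd Y' 1 = snd Y 1"
      by (auto simp: addsub_def)
    have "fst Y' i \<in> U" if "i \<in> {1..n}" for i
      using complete_last[OF complete Y'(1,2) that] .
    then have "Y' \<in> ?N" using Y'(1) by (simp add: angle_iff)
    then show ?thesis using Y'(3,4) Y by (intro bexI[of _ Y']) auto
  qed
  have N1a: "Z \<in> ?N" if "X \<in> ?N" "Y \<in> ?N" "is_nseq ?C SO n Z" "nseq_dsum ?C SM n X Y Z" for X Y Z
    using that angle_dsum nseq_dsum_full_sub[OF U] unfolding angle_iff nseq by blast
  have N1a': "X \<in> ?N"
    if "is_nseq ?C SO n X" "is_nseq ?C SO n Y" "Z \<in> ?N" "nseq_dsum ?C SM n X Y Z" for X Y Z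
  proof -
    have "\<forall>X Y Z. is_nseq C SO n X \<and> is_nseq C SO n Y \<and> Z \<in> N \<and> nseq_dsum C SM n X Y Z \<longrightarrow> X \<in> N"
      by (insert angulated[unfolded n_angulated_def]) (elim conjE, assumption)
    then show ?thesis
      using that nseq_dsum_full_sub[OF U] unfolding angle_iff nseq by blast
  qed
  have N1a'': "Y \<in> ?N" if "X \<in> ?N" "is_nseq ?C SO n Y" "nseq_iso ?C SM n X Y \<phi>" for X Y \<phi>
  proof -
    have "nseq_mor C SM n X Y \<phi>"
      using that nseq_mor_full_sub[of n X U Y C SM \<phi>] by (simp add: nseq angle_iff nseq_iso_def)
    moreover have "\<forall>i\<in>{1..n}. is_iso C (\<phi> i)"
      using that(3) is_iso_full_sub[of C U] by (simp add: nseq_iso_def)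
    ultimately have "nseq_iso C SM n X Y \<phi>" by (simp add: nseq_iso_def)
    then show ?thesis using that angle_iso unfolding angle_iff nseq by blast
  qed
  have N2: "X \<in> ?N \<longleftrightarrow> rot ?C SO SM n X \<in> ?N" if "is_nseq ?C SO n X" for X
  proof -
    have "fst (rot C SO SM n X) i \<in> U" if "i \<in> {1..n}" for i
      using that \<open>is_nseq ?C SO n X\<close> nseq SU by (auto simp: rot_def)
    then show ?thesis
      using that angle_rot unfolding angle_iff rot_full_sub nseq by blast
  qed
  have N4: "\<exists>\<phi>. \<phi> 1 = f1 \<and> \<phi> 2 = f2 \<and> nseq_mor ?C SM n X Y \<phi> \<and>
      (\<forall>D j1 j2 q1 q2. is_cone_data ?C SO SM n X Y D j1 j2 q1 q2 \<longrightarrow> cone ?C SO SM n X Y \<phi> D j1 j2 q1 q2 \<in> ?N)"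
    if XY: "X \<in> ?N" "Y \<in> ?N" and f: "f1 \<in> hom ?C (fst X 1) (fst Y 1)" "f2 \<in> hom ?C (fst X 2) (fst Y 2)"
      "cmp ?C (snd Y 1) f1 = cmp ?C f2 (snd X 1)" for X Y f1 f2
  proof -
    have "\<forall>X\<in>N. \<forall>Y\<in>N. \<forall>f1 f2.
        f1 \<in> hom C (fst X 1) (fst Y 1) \<and> f2 \<in> hom C (fst X 2) (fst Y 2) \<and>
        cmp C (snd Y 1) f1 = cmp C f2 (snd X 1) \<longrightarrow>
        (\<exists>\<phi>. \<phi> 1 = f1 \<and> \<phi> 2 = f2 \<and> nseq_mor C SM n X Y \<phi> \<and>
           (\<forall>D j1 j2 q1 q2. is_cone_data C SO SM n X Y D j1 j2 q1 q2 \<longrightarrow>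
              cone C SO SM n X Y \<phi> D j1 j2 q1 q2 \<in> N))"
      by (insert angulated[unfolded n_angulated_def]) (elim conjE, assumption)
    moreover have "X \<in> N" "Y \<in> N" "f1 \<in> hom C (fst X 1) (fst Y 1)" "f2 \<in> hom C (fst X 2) (fst Y 2)"
      "cmp C (snd Y 1) f1 = cmp C f2 (snd X 1)"
      using XY f by (auto simp: angle_iff hom_full_sub split: if_splits)
    ultimately obtain \<phi> where \<phi>: "\<phi> 1 = f1" "\<phi> 2 = f2" "nseq_mor C SM n X Y \<phi>"
      and cone: "\<And>D j1 j2 q1 q2. is_cone_data C SO SM n X Y D j1 j2 q1 q2 \<Longrightarrow>
              cone C SO SM n X Y \<phi> D j1 j2 q1 q2 \<in> N"
      by blast
    \<comment> \<open>Cone data in the full subcategory have their biproduct objects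
      \<open>D\<close> in U, and the cone has no other objects.\<close>
    have "cone C SO SM n X Y \<phi> D j1 j2 q1 q2 \<in> ?N"
      if "is_cone_data ?C SO SM n X Y D j1 j2 q1 q2" for D j1 j2 q1 q2
    proof -
      have "is_cone_data C SO SM n X Y D j1 j2 q1 q2" "\<forall>i\<in>{1..n}. D i \<in> U"
        using that by (auto simp: is_cone_data_def biprod_full_sub[OF U] rot_full_sub)
      then show ?thesis using cone by (auto simp: angle_iff cone_def)
    qed
    then show ?thesis
      using \<phi> nseq_mor_full_sub[of n X U Y C SM \<phi>] XY by (auto simp: angle_iff cone_full_sub)
  qed
  have "n_angulated ?C SO SM n ?N"
    unfolding n_angulated_def
  proof (intro conjI)
    show "\<forall>X\<in>?N. is_nseq ?C SO n X" using angle_nseq nseq by (auto simp: angle_iff)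
    show "\<forall>A\<in>obj ?C. \<forall>Z. is_zero_obj ?C Z \<longrightarrow> triv_nseq ?C SO n Z A \<in> ?N"
    proof (intro ballI allI impI)
      fix A Z assume "A \<in> obj ?C" "is_zero_obj ?C Z"
      then have A: "A \<in> U" and Z: "Z \<in> U" "is_zero_obj C Z" using is_zero_obj_full_sub[OF U] by auto
      then have "triv_nseq C SO n Z A \<in> N" using angle_triv U by blast
      moreover have "fst (triv_nseq C SO n Z A) i \<in> U" for i using A Z by (simp add: triv_nseq_def)
      ultimately show "triv_nseq ?C SO n Z A \<in> ?N" unfolding triv_nseq_full_sub angle_iff by blast
    qed
    show "\<forall>A1\<in>obj ?C. \<forall>A2\<in>obj ?C. \<forall>f\<in>hom ?C A1 A2. \<exists>X\<in>?N. fst X 1 = A1 \<and> fst X 2 = A2 \<and> snd X 1 = f"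
      using first by (auto simp: hom_full_sub)
    show "\<forall>X\<in>?N. \<forall>Y\<in>?N. \<forall>f1 f2.
        f1 \<in> hom ?C (fst X 1) (fst Y 1) \<and> f2 \<in> hom ?C (fst X 2) (fst Y 2) \<and>
        cmp ?C (snd Y 1) f1 = cmp ?C f2 (snd X 1) \<longrightarrow>
        (\<exists>\<phi>. \<phi> 1 = f1 \<and> \<phi> 2 = f2 \<and> nseq_mor ?C SM n X Y \<phi>)"
      using N4 by blast
    show "\<forall>X Y Z. is_nseq ?C SO n X \<and> is_nseq ?C SO n Y \<and> Z \<in> ?N \<and> nseq_dsum ?C SM n X Y Z \<longrightarrow> X \<in> ?N"
      using N1a' by blast
    show "\<forall>X\<in>?N. \<forall>Y \<phi>. is_nseq ?C SO n Y \<and> nseq_iso ?C SM n X Y \<phi> \<longrightarrow> Y \<in> ?N"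
      using N1a'' by blast
    show "\<forall>X. is_nseq ?C SO n X \<longrightarrow> (X \<in> ?N \<longleftrightarrow> rot ?C SO SM n X \<in> ?N)"
      using N2 by simp
    show "\<forall>X\<in>?N. \<forall>Y\<in>?N. \<forall>Z. is_nseq ?C SO n Z \<and> nseq_dsum ?C SM n X Y Z \<longrightarrow> Z \<in> ?N"
      using N1a by blast
  qed (rule addC autC | (intro ballI allI impI, elim conjE, rule N4; assumption))+
  moreover have "\<exists>\<eta>. (\<forall>A \<in> U. \<eta> A \<in> hom C (SO A) (SO A) \<and> is_iso C (\<eta> A)) \<and>
          (\<forall>A \<in> U. \<forall>B \<in> U. \<forall>f \<in> hom C A B. cmp C (\<eta> B) (SM f) = cmp C (SM f) (\<eta> A)) \<and>
          (\<forall>Y \<in> ?N. (fst Y, (snd Y)(n := cmp C (\<eta> (fst Y 1)) (snd Y n))) \<in> N)"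
  \<comment> \<open>The inclusion commutes strictly with \<Sigma>, so identities serve as the
    natural isomorphism.\<close>
  proof (intro exI[of _ "\<lambda>A. idm C (SO A)"] conjI ballI)
    fix Y assume "Y \<in> ?N"
    then have Y: "Y \<in> N" by (simp add: angle_iff)
    have "idm C (SO (fst Y 1)) \<cdot> snd Y n = snd Y n"
      using angle_nseq[OF Y] by (intro idm_comp) (auto simp: is_nseq_def hom_iff)
    then show "(fst Y, (snd Y)(n := idm C (SO (fst Y 1)) \<cdot> snd Y n)) \<in> N"
      using Y by (simp only: fun_upd_triv prod.collapse)
  qed (use U in \<open>auto simp: hom_iff is_iso_idm subset_iff\<close>)
  ultimately show ?thesis
    unfolding n_ang_subcat_def using U iso bijU by blast
qed

text \<open>Being additive, the subcategory contains some zero object and some biproduct of each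
  pair. These are also zero objects and biproducts of the ambient category, so closure under
  isomorphism yields all others.\<close>

lemma (in odd_angulated) n_ang_subcatD:
  assumes "n_ang_subcat C SO SM n N U NX"
  shows "U \<subseteq> obj C" "\<And>A B. A \<in> U \<Longrightarrow> isomorphic C A B \<Longrightarrow> B \<in> U" "zob \<in> U"
    "\<And>A B S. A \<in> U \<Longrightarrow> B \<in> U \<Longrightarrow> bsum A B S \<Longrightarrow> S \<in> U" "\<And>A. A \<in> U \<Longrightarrow> SO A \<in> U"
proof -
  show U: "U \<subseteq> obj C" using assms by (simp add: n_ang_subcat_def)
  show iso: "B \<in> U" if "A \<in> U" "isomorphic C A B" for A B
    using assms that isomorphic_obj[OF that(2)] unfolding n_ang_subcat_def by blast
  have add: "is_additive (full_sub C U)"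
    using assms by (simp add: n_ang_subcat_def n_angulated_def)
  then obtain Z where "is_zero_obj (full_sub C U) Z" by (auto simp: is_additive_def)
  then have "Z \<in> U" "is_zero_obj C Z" using is_zero_obj_full_sub[OF U] by auto
  then show "zob \<in> U" using iso zero_obj_isomorphic zob by blast
  show "S \<in> U" if AB: "A \<in> U" "B \<in> U" and S: "bsum A B S" for A B S
  proof -
    obtain S' i1 i2 p1 p2 where "biprod (full_sub C U) A B S' i1 i2 p1 p2"
      using add AB unfolding is_additive_def full_sub_simps by blast
    then have "S' \<in> U" "bsum A B S'" by (auto simp: biprod_full_sub[OF U] bsum_def)
    then show ?thesis
      using bsum_unique[OF _ S] isomorphic_refl U AB iso by blast
  qed
  show "SO A \<in> U" if "A \<in> U" for A
    using assms that by (auto simp: n_ang_subcat_def dest: bij_betwE)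
qed

section \<open>The Grothendieck ring\<close>

locale odd_tensor_angulated = odd_angulated C SO SM n N
  for C :: "('o, 'm, 'x) cat_scheme" and SO :: "'o \<Rightarrow> 'o" and SM :: "'m \<Rightarrow> 'm"
    and n :: nat and N :: "('o, 'm) nseq set" +
  fixes T :: "('o, 'm) tensor"
  assumes tensor_angulated: "tensor_n_angulated C SO SM n N T"
begin

lemma symmetric_monoidal: "symmetric_monoidal C T"
  using tensor_angulated by (simp add: tensor_n_angulated_def)

lemma monoidal_structure:
  shows "\<forall>A \<in> obj C. \<forall>B \<in> obj C. tob T A B \<in> obj C"
    and "\<forall>A \<in> obj C. \<forall>A' \<in> obj C. \<forall>B \<in> obj C. \<forall>B' \<in> obj C.
        \<forall>f \<in> hom C A A'. \<forall>g \<in> hom C B B'. tar T f g \<in> hom C (tob T A B) (tob T A' B')"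
    and "\<forall>A \<in> obj C. \<forall>B \<in> obj C. tar T (idm C A) (idm C B) = idm C (tob T A B)"
    and "\<forall>A \<in> obj C. \<forall>A' \<in> obj C. \<forall>A'' \<in> obj C. \<forall>B \<in> obj C. \<forall>B' \<in> obj C. \<forall>B'' \<in> obj C.
        \<forall>f \<in> hom C A A'. \<forall>f' \<in> hom C A' A''. \<forall>g \<in> hom C B B'. \<forall>g' \<in> hom C B' B''.
          tar T (f' \<cdot> f) (g' \<cdot> g) = tar T f' g' \<cdot> tar T f g"
    and "tunit T \<in> obj C"
    and "\<forall>A \<in> obj C. \<forall>B \<in> obj C. \<forall>D \<in> obj C.
        tassoc T A B D \<in> hom C (tob T (tob T A B) D) (tob T A (tob T B D)) \<and> is_iso C (tassoc T A B D)"
    and "\<forall>A \<in> obj C. tlam T A \<in> hom C (tob T (tunit T) A) A \<and> is_iso C (tlam T A)"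
    and "\<forall>A \<in> obj C. \<forall>B \<in> obj C. tsym T A B \<in> hom C (tob T A B) (tob T B A) \<and> is_iso C (tsym T A B)"
  by (insert symmetric_monoidal[unfolded symmetric_monoidal_def Let_def]) (elim conjE, assumption)+

lemma tob_obj: "A \<in> obj C \<Longrightarrow> B \<in> obj C \<Longrightarrow> tob T A B \<in> obj C"
  using monoidal_structure(1) by blast

lemma tob_isomorphic:
  assumes "isomorphic C A A'" "isomorphic C B B'"
  shows "isomorphic C (tob T A B) (tob T A' B')"
proof -
  obtain f f' where f: "f \<in> hom C A A'" "f' \<in> hom C A' A" "f' \<cdot> f = idm C A" "f \<cdot> f' = idm C A'"
    using assms by (auto simp: isomorphic_iff)
  obtain g g' where g: "g \<in> hom C B B'" "g' \<in> hom C B' B" "g' \<cdot> g = idm C B" "g \<cdot> g' = idm C B'"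
    using assms by (auto simp: isomorphic_iff)
  have obs: "A \<in> obj C" "A' \<in> obj C" "B \<in> obj C" "B' \<in> obj C"
    using assms isomorphic_obj by auto
  have "tar T f' g' \<cdot> tar T f g = tar T (f' \<cdot> f) (g' \<cdot> g)" "tar T f g \<cdot> tar T f' g' = tar T (f \<cdot> f') (g \<cdot> g')"
    using monoidal_structure(4) f(1,2) g(1,2) obs by simp_all
  then have "tar T f' g' \<cdot> tar T f g = idm C (tob T A B)" "tar T f g \<cdot> tar T f' g' = idm C (tob T A' B')"
    using f g obs monoidal_structure(3) by simp_all
  moreover have "tar T f g \<in> hom C (tob T A B) (tob T A' B')" "tar T f' g' \<in> hom C (tob T A' B') (tob T A B)"
    using monoidal_structure(2) f(1,2) g(1,2) obs by simp_all
  ultimately show ?thesis unfolding isomorphic_iff by blast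
qed

text \<open>\<open>tcls\<close> multiplies arbitrary representatives; the choice is irrelevant
  because the tensor product preserves isomorphisms.\<close>

lemma tcls_isocls:
  assumes "A \<in> obj C" "B \<in> obj C"
  shows "tcls C T (isocls C A) (isocls C B) = isocls C (tob T A B)"
proof -
  let ?A = "SOME X. X \<in> isocls C A" and ?B = "SOME X. X \<in> isocls C B"
  have "isomorphic C (tob T A B) (tob T ?A ?B)"
    using some_isocls assms by (intro tob_isomorphic) auto
  then show ?thesis
    unfolding tcls_def using isocls_eq_iff isomorphic_obj isomorphic_sym by blast
qed

definition tensor_monoid :: "'o set monoid" where
  "tensor_monoid = \<lparr>carrier = isocls C ` obj C, mult = tcls C T, one = isocls C (tunit T)\<rparr>"

lemma tensor_monoid_simps [simp]:
  "carrier tensor_monoid = isocls C ` obj C" "mult tensor_monoid = tcls C T"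
  "\<one>\<^bsub>tensor_monoid\<^esub> = isocls C (tunit T)"
  by (simp_all add: tensor_monoid_def)

text \<open>Associator, symmetry and left unit isomorphism become equalities of isomorphism
  classes.\<close>

lemma comm_monoid_tensor_monoid: "comm_monoid tensor_monoid"
proof (rule comm_monoidI)
  fix x y z assume "x \<in> carrier tensor_monoid" "y \<in> carrier tensor_monoid" "z \<in> carrier tensor_monoid"
  then obtain A B D where ABD: "A \<in> obj C" "B \<in> obj C" "D \<in> obj C"
    and x: "x = isocls C A" and y: "y = isocls C B" and z: "z = isocls C D"
    by auto
  have "isomorphic C (tob T (tob T A B) D) (tob T A (tob T B D))"
    using monoidal_structure(6) ABD unfolding isomorphic_def by blast
  then show "x \<otimes>\<^bsub>tensor_monoid\<^esub> y \<otimes>\<^bsub>tensor_monoid\<^esub> z = x \<otimes>\<^bsub>tensor_monoid\<^esub> (y \<otimes>\<^bsub>tensor_monoid\<^esub> z)"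
    using ABD by (simp add: x y z tcls_isocls tob_obj isocls_eq_iff)
  have "isomorphic C (tob T A B) (tob T B A)"
    using monoidal_structure(8) ABD unfolding isomorphic_def by blast
  then show "x \<otimes>\<^bsub>tensor_monoid\<^esub> y = y \<otimes>\<^bsub>tensor_monoid\<^esub> x"
    using ABD by (simp add: x y tcls_isocls tob_obj isocls_eq_iff)
  show "x \<otimes>\<^bsub>tensor_monoid\<^esub> y \<in> carrier tensor_monoid"
    using ABD by (simp add: x y tcls_isocls tob_obj)
  have "isomorphic C (tob T (tunit T) A) A"
    using monoidal_structure(7) ABD unfolding isomorphic_def by blast
  then show "\<one>\<^bsub>tensor_monoid\<^esub> \<otimes>\<^bsub>tensor_monoid\<^esub> x = x"
    using ABD monoidal_structure(5) by (simp add: x tcls_isocls tob_obj isocls_eq_iff)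
qed (simp add: monoidal_structure(5))

sublocale tm: comm_monoid tensor_monoid
  by (rule comm_monoid_tensor_monoid)

lemma Fcarrier_eq: "Fcarrier C = fsupp (isocls C ` obj C)"
  by (simp add: Fcarrier_def fsupp_def)

lemma Fring_eq: "Fring C T = monoid_ring tensor_monoid"
  unfolding Fring_def monoid_ring_def tensor_monoid_simps Fcarrier_eq gen_eq_ind conv_def[abs_def] ..

lemma cring_Fring: "cring (Fring C T)"
  unfolding Fring_eq by (rule tm.cring_monoid_ring)

lemma Fring_simps [simp]:
  "carrier (Fring C T) = Fcarrier C"
  "f \<otimes>\<^bsub>Fring C T\<^esub> g = conv (tcls C T) f g"
  "\<zero>\<^bsub>Fring C T\<^esub> = 0" "f \<oplus>\<^bsub>Fring C T\<^esub> g = f + g"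
  by (simp_all add: Fring_eq Fcarrier_eq)

lemma gen_Fcarrier: "A \<in> obj C \<Longrightarrow> gen C A \<in> Fcarrier C"
  by (simp add: Fcarrier_eq gen_eq_ind ind_in_fsupp)

lemma addsub_Fcarrier: "addsub (Fcarrier C)"
  unfolding Fcarrier_eq by (rule addsub_fsupp)

lemma gen_tob: "A \<in> obj C \<Longrightarrow> B \<in> obj C \<Longrightarrow> conv (tcls C T) (gen C A) (gen C B) = gen C (tob T A B)"
  by (simp add: gen_eq_ind conv_ind_ind tcls_isocls)

lemma chi_Fcarrier: "Y \<in> N \<Longrightarrow> chi C n Y \<in> Fcarrier C"
  unfolding chi_eq_altsum using angle_obj by (intro altsum_in_addsub addsub_Fcarrier gen_Fcarrier)

abbreviation R where "R \<equiv> Rsub C n N T"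

lemma R_eq: "R = generate (add_monoid (Fring C T)) (chi C n ` N)"
  using odd_n by (simp add: Rsub_def)

lemma R_subgroup: "subgroup R (add_monoid (Fring C T))"
proof -
  interpret F: cring "Fring C T" by (rule cring_Fring)
  show ?thesis
    unfolding R_eq using chi_Fcarrier by (intro F.add.generate_is_subgroup) auto
qed

lemma R_subset: "R \<subseteq> Fcarrier C" and addsub_R: "addsub R"
  using R_subgroup tm.additive_subgroup_monoid_ring_iff[of R] by (simp_all add: Fring_eq Fcarrier_eq)

lemma chi_in_R: "Y \<in> N \<Longrightarrow> chi C n Y \<in> R"
  unfolding R_eq by (rule generate.incl) simp

lemma R_least:
  assumes "addsub K" "K \<subseteq> Fcarrier C" "\<And>Y. Y \<in> N \<Longrightarrow> chi C n Y \<in> K"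
  shows "R \<subseteq> K"
proof -
  interpret F: cring "Fring C T" by (rule cring_Fring)
  have "subgroup K (add_monoid (Fring C T))"
    using assms(1,2) tm.additive_subgroup_monoid_ring_iff[of K] by (simp add: Fring_eq Fcarrier_eq)
  then show ?thesis
    unfolding R_eq using assms(3) by (intro F.add.generate_subgroup_incl) auto
qed

text \<open>Tensoring with A turns the n-angle into one with objects
  \<open>tob T A (fst Y i)\<close>, and the product is its Euler characteristic. This is why
  multiplication descends to the quotient.\<close>

lemma gen_conv_chi:
  assumes "A \<in> obj C" "Y \<in> N"
  shows "conv (tcls C T) (gen C A) (chi C n Y) \<in> R"
proof -
  let ?X = "isocls C ` obj C"
  have gens: "gen C A \<in> fsupp ?X" "\<And>i. i \<in> {1..n} \<Longrightarrow> gen C (fst Y i) \<in> fsupp ?X"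
    using gen_Fcarrier angle_obj assms by (auto simp: Fcarrier_eq)
  have "conv (tcls C T) (gen C A) (chi C n Y) =
      (\<Sum>i=1..n. conv (tcls C T) (gen C A) (if odd i then gen C (fst Y i) else - gen C (fst Y i)))"
    unfolding chi_eq_altsum altsum_def using gens fsupp_uminus
    by (intro conv_sum_right[of _ ?X]) auto
  also have "\<dots> = altsum C n (\<lambda>i. tob T A (fst Y i))"
    unfolding altsum_def using gens gen_tob assms(1) angle_obj[OF assms(2)]
    by (intro sum.cong refl) (auto simp: conv_uminus_right[of _ ?X])
  finally have eq: "conv (tcls C T) (gen C A) (chi C n Y) = altsum C n (\<lambda>i. tob T A (fst Y i))" .
  have "((\<lambda>i. tob T A (fst U i)),
         (\<lambda>i. if i < n then tar T (idm C A) (snd U i)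
              else cmp C (tshl T A (fst U 1)) (tar T (idm C A) (snd U n)))) \<in> N" if "U \<in> N" for U
    using tensor_angulated assms(1) that unfolding tensor_n_angulated_def by blast
  from chi_in_R[OF this[OF assms(2)]] show ?thesis
    unfolding eq by (simp add: chi_eq_altsum)
qed

text \<open>Additivity reduces absorption to generators: \<open>R_least\<close> varies r while the
  left factor is the class of an object, then \<open>fsupp_subset_addsub\<close> varies the left
  factor. Commutativity gives the other side.\<close>

lemma ideal_R: "ideal R (Fring C T)"
proof -
  interpret F: cring "Fring C T" by (rule cring_Fring)
  let ?c = "conv (tcls C T)" and ?X = "isocls C ` obj C"
  note F = addsub_Fcarrier
  note conv = conv_zero_left conv_zero_right conv_diff_left[of _ ?X] conv_diff_right[of _ ?X]
  have gen: "?c (gen C A) r \<in> R" if A: "A \<in> obj C" and r: "r \<in> R" for A r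
  proof -
    have "R \<subseteq> {r \<in> Fcarrier C. ?c (gen C A) r \<in> R}"
    proof (rule R_least)
      show "addsub {r \<in> Fcarrier C. ?c (gen C A) r \<in> R}"
        using gen_Fcarrier[OF A]
        by (auto simp: addsub_def addsub_closed[OF F] addsub_closed[OF addsub_R] conv Fcarrier_eq[symmetric])
    qed (use A gen_conv_chi chi_Fcarrier in auto)
    then show ?thesis using r by auto
  qed
  have left: "?c f r \<in> R" if f: "f \<in> Fcarrier C" and r: "r \<in> R" for f r
  proof -
    have "fsupp ?X \<subseteq> {f \<in> Fcarrier C. ?c f r \<in> R}"
    proof (rule fsupp_subset_addsub)
      show "addsub {f \<in> Fcarrier C. ?c f r \<in> R}"
        using r R_subset
        by (auto simp: addsub_def addsub_closed[OF F] addsub_closed[OF addsub_R] conv Fcarrier_eq[symmetric])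
      show "ind a \<in> {f \<in> Fcarrier C. ?c f r \<in> R}" if "a \<in> ?X" for a
        using that gen[OF _ r] gen_Fcarrier by (auto simp: gen_eq_ind)
    qed
    then show ?thesis using f by (auto simp: Fcarrier_eq)
  qed
  show ?thesis
  proof (rule idealI)
    fix r f assume rf: "r \<in> R" "f \<in> carrier (Fring C T)"
    then show "f \<otimes>\<^bsub>Fring C T\<^esub> r \<in> R" using left by simp
    then show "r \<otimes>\<^bsub>Fring C T\<^esub> f \<in> R" using F.m_comm[of r f] rf R_subset by auto
  qed (rule F.ring_axioms R_subgroup)+
qed

subsection \<open>Classes of objects\<close>

text \<open>In the trivial n-angle on \<open>zob\<close> all n objects are \<open>zob\<close>; as n
  is odd, the alternating signs leave exactly one of them.\<close>

lemma gen_zob: "gen C zob \<in> R"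
proof -
  have "triv_at 1 zob \<in> N" by (rule triv_at_angle) auto
  moreover have "fst (triv_at 1 zob) = (\<lambda>_. zob)" by (auto simp: triv_at_fst)
  ultimately show ?thesis
    using chi_in_R[of "triv_at 1 zob"] odd_n by (simp add: chi_eq_altsum altsum_const)
qed

text \<open>The n-angle A, S, B, 0, ..., 0 is compared with the trivial n-angle on A from which it
  is built; their Euler characteristics differ by the relation up to the class of zero.\<close>

lemma gen_bsum:
  assumes S: "bsum A B S"
  shows "gen C S - gen C A - gen C B \<in> R"
proof -
  have obs: "A \<in> obj C" "B \<in> obj C" using bsum_obj[OF S] by auto
  have T: "triv_at 1 A \<in> N" using triv_at_angle[OF obs(1)] by simp
  obtain Y where Y: "Y \<in> N" "fst Y = (fst (triv_at 1 A))(2 := S, Suc 2 := B)"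
    using angle_add_triv[OF T, of 2 B S B] S bsum_commute[OF bsum_zero[OF zob obs(2)]]
    by (auto simp: triv_at_fst)
  have "chi C n Y = chi C n (triv_at 1 A) + (gen C A - gen C S) + (gen C B - gen C zob)"
    using n_ge_3 by (simp add: chi_eq_altsum Y(2) altsum_upd triv_at_fst)
  then have "gen C S - gen C A - gen C B = chi C n (triv_at 1 A) - chi C n Y - gen C zob"
    by simp
  then show ?thesis
    using chi_in_R[OF T] chi_in_R[OF Y(1)] gen_zob addsub_diff[OF addsub_R] by simp
qed

text \<open>Rotating the trivial n-angle on A puts A at position 1, \<Sigma>A at position n and zero
  objects between them; both signs are positive because n is odd.\<close>

lemma gen_shift:
  assumes A: "A \<in> obj C"
  shows "gen C A + gen C (SO A) \<in> R"
proof -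
  let ?T = "triv_at 1 A"
  have T: "?T \<in> N" using triv_at_angle[OF A] by simp
  then have rot: "rot C SO SM n ?T \<in> N" using angle_rot angle_nseq by blast
  have "altsum C n (fst (rot C SO SM n ?T)) = altsum C n ((\<lambda>_. zob)(1 := A, n := SO A))"
    by (rule altsum_cong) (auto simp: rot_def triv_at_fst)
  also have "\<dots> = gen C A + gen C (SO A) - gen C zob"
    using odd_n by (simp add: altsum_upd altsum_const)
  finally have "gen C A + gen C (SO A) = chi C n (rot C SO SM n ?T) + gen C zob"
    by (simp add: chi_eq_altsum)
  then show ?thesis
    using chi_in_R[OF rot] gen_zob addsub_add[OF addsub_R] by simp
qed

section \<open>The quotient ring and its elements as classes of objects\<close>

abbreviation cl where "cl \<equiv> K0cls C n N T"
abbreviation K where "K \<equiv> K0 C n N T"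
abbreviation cos where "cos f \<equiv> R +>\<^bsub>Fring C T\<^esub> f"

lemma cring_K: "cring K"
  unfolding K0_def using ideal.quotient_is_cring[OF ideal_R cring_Fring] .

sublocale K0: cring K
  by (rule cring_K)

lemma cos_hom: "cos \<in> ring_hom (Fring C T) K"
  unfolding K0_def using ideal.rcos_ring_hom[OF ideal_R] .

lemma cos_add: "f \<in> Fcarrier C \<Longrightarrow> g \<in> Fcarrier C \<Longrightarrow> cos (f + g) = cos f \<oplus>\<^bsub>K\<^esub> cos g"
  using ring_hom_add[OF cos_hom, of f g] by simp

lemma cos_zero: "r \<in> R \<Longrightarrow> cos r = \<zero>\<^bsub>K\<^esub>"
proof -
  interpret ideal R "Fring C T" by (rule ideal_R)
  show "r \<in> R \<Longrightarrow> cos r = \<zero>\<^bsub>K\<^esub>"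
    using a_coset_join2[OF _ a_subgroup, of r] R_subset by (auto simp: K0_def FactRing_def)
qed

lemma cos_eq_iff:
  assumes "f \<in> Fcarrier C" "g \<in> Fcarrier C"
  shows "cos f = cos g \<longleftrightarrow> f - g \<in> R"
proof
  assume "f - g \<in> R"
  then have "cos (g + (f - g)) = cos g \<oplus>\<^bsub>K\<^esub> \<zero>\<^bsub>K\<^esub>"
    using assms R_subset by (subst cos_add) (auto simp: cos_zero)
  moreover have "cos g \<in> carrier K" using ring_hom_closed[OF cos_hom, of g] assms by simp
  ultimately show "cos f = cos g" by simp
next
  interpret I: ideal R "Fring C T" by (rule ideal_R)
  assume "cos f = cos g"
  then have "f \<in> cos g" using I.a_rcos_self[of f] assms by simp
  then obtain r where "r \<in> R" "f = r + g" by (auto simp: a_r_coset_def r_coset_def Fring_eq)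
  then show "f - g \<in> R" by simp
qed

lemma cos_carrier: "f \<in> Fcarrier C \<Longrightarrow> cos f \<in> carrier K"
  using ring_hom_closed[OF cos_hom, of f] by simp

lemma carrier_K_eq_cos: "carrier K = cos ` Fcarrier C"
  by (auto simp: K0_def FactRing_def A_RCOSETS_def')

lemma cl_eq: "cl A = cos (gen C A)"
  by (simp add: K0cls_def)

lemma cl_carrier: "A \<in> obj C \<Longrightarrow> cl A \<in> carrier K"
  by (simp add: cl_eq cos_carrier gen_Fcarrier)

lemma cl_zob: "cl zob = \<zero>\<^bsub>K\<^esub>"
  by (simp add: cl_eq cos_zero gen_zob)

lemma cl_bsum:
  assumes "bsum A B S"
  shows "cl S = cl A \<oplus>\<^bsub>K\<^esub> cl B"
proof -
  have "gen C A \<in> Fcarrier C" "gen C B \<in> Fcarrier C" "gen C S \<in> Fcarrier C"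
    using bsum_obj[OF assms] gen_Fcarrier by auto
  moreover have "gen C S - (gen C A + gen C B) \<in> R"
    using gen_bsum[OF assms] by (simp add: algebra_simps)
  ultimately show ?thesis
    using cos_eq_iff[of "gen C S" "gen C A + gen C B"] cos_add addsub_add[OF addsub_Fcarrier]
    by (simp add: cl_eq)
qed

lemma cl_shift: "A \<in> obj C \<Longrightarrow> cl (SO A) = \<ominus>\<^bsub>K\<^esub> cl A"
proof -
  assume A: "A \<in> obj C"
  have "cl (SO A) \<oplus>\<^bsub>K\<^esub> cl A = cos (gen C A + gen C (SO A))"
    using A gen_Fcarrier cos_add K0.a_comm by (simp add: cl_eq cos_carrier)
  also have "\<dots> = \<zero>\<^bsub>K\<^esub>" using cos_zero gen_shift[OF A] by blast
  finally show ?thesis using K0.minus_equality[of "cl (SO A)" "cl A"] A cl_carrier by simp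
qed

lemma cl_tob: "A \<in> obj C \<Longrightarrow> B \<in> obj C \<Longrightarrow> cl (tob T A B) = cl A \<otimes>\<^bsub>K\<^esub> cl B"
  using ring_hom_mult[OF cos_hom, of "gen C A" "gen C B"] gen_Fcarrier gen_tob by (simp add: cl_eq)

lemma cl_isomorphic: "isomorphic C A B \<Longrightarrow> cl A = cl B"
  using isocls_eq_iff[of A B] isomorphic_obj[of A B] by (simp add: cl_eq gen_eq_ind)

text \<open>The shift absorbs differences: if f and g agree modulo \<open>R\<close> with the classes
  of A and B, then f - g agrees with that of A \<oplus> \<Sigma>B. So a combination of objects of U
  is congruent to a single object of U.\<close>

lemma representable:
  assumes U: "U \<subseteq> obj C" "zob \<in> U" "\<And>A B S. A \<in> U \<Longrightarrow> B \<in> U \<Longrightarrow> bsum A B S \<Longrightarrow> S \<in> U"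
    "\<And>A. A \<in> U \<Longrightarrow> SO A \<in> U"
  shows "fsupp (isocls C ` U) \<subseteq> {f \<in> Fcarrier C. \<exists>A\<in>U. f - gen C A \<in> R}"
proof (rule fsupp_subset_addsub)
  show "addsub {f \<in> Fcarrier C. \<exists>A\<in>U. f - gen C A \<in> R}"
    unfolding addsub_def
  proof (intro conjI ballI)
    show "0 \<in> {f \<in> Fcarrier C. \<exists>A\<in>U. f - gen C A \<in> R}"
      using U(2) addsub_diff[OF addsub_R addsub_zero[OF addsub_R] gen_zob] addsub_zero[OF addsub_Fcarrier]
      by blast
    fix f g assume "f \<in> {f \<in> Fcarrier C. \<exists>A\<in>U. f - gen C A \<in> R}" "g \<in> {f \<in> Fcarrier C. \<exists>A\<in>U. f - gen C A \<in> R}"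
    then obtain A B where A: "f \<in> Fcarrier C" "A \<in> U" "f - gen C A \<in> R"
      and B: "g \<in> Fcarrier C" "B \<in> U" "g - gen C B \<in> R" by blast
    obtain S where S: "bsum A (SO B) S" using bsum_exists[of A "SO B"] A B U(1,4) by blast
    have "B \<in> obj C" using B U(1) by blast
    \<comment> \<open>Regrouping into four elements of \<open>R\<close>: the two given ones, the
      direct sum relation for S and the shift relation for B.\<close>
    have "f - g - gen C S = ((f - gen C A) - (g - gen C B)) -
        ((gen C S - gen C A - gen C (SO B)) + (gen C B + gen C (SO B)))"
      by (simp add: algebra_simps)
    also have "\<dots> \<in> R"
      using addsub_diff[OF addsub_R addsub_diff[OF addsub_R A(3) B(3)]
          addsub_add[OF addsub_R gen_bsum[OF S] gen_shift[OF \<open>B \<in> obj C\<close>]]] .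
    finally have "f - g - gen C S \<in> R" .
    moreover have "S \<in> U" using U A B S by blast
    ultimately show "f - g \<in> {f \<in> Fcarrier C. \<exists>A\<in>U. f - gen C A \<in> R}"
      using addsub_diff[OF addsub_Fcarrier A(1) B(1)] by blast
  qed
  fix a assume "a \<in> isocls C ` U"
  then obtain A where A: "A \<in> U" "ind a = gen C A" by (auto simp: gen_eq_ind)
  then have "ind a \<in> Fcarrier C" "ind a - gen C A \<in> R"
    using gen_Fcarrier U(1) addsub_zero[OF addsub_R] by (auto simp del: minus_apply)
  then show "ind a \<in> {f \<in> Fcarrier C. \<exists>A\<in>U. f - gen C A \<in> R}" using A(1) by blast
qed

text \<open>The case of all objects in \<open>representable\<close>. It allows ring elements to be
  replaced by objects when ideals and primes are tested.\<close>

lemma carrier_K: "carrier K = cl ` obj C"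
proof -
  have rep: "fsupp (isocls C ` obj C) \<subseteq> {f \<in> Fcarrier C. \<exists>A\<in>obj C. f - gen C A \<in> R}"
    by (rule representable) (use bsum_obj in auto)
  have "cos f \<in> cl ` obj C" if f: "f \<in> Fcarrier C" for f
  proof -
    obtain A where "A \<in> obj C" "f - gen C A \<in> R"
      using rep f unfolding Fcarrier_eq by blast
    then show ?thesis using cos_eq_iff[OF f gen_Fcarrier] cl_eq by blast
  qed
  then show ?thesis using cl_carrier by (auto simp: carrier_K_eq_cos)
qed

lemma ImK0_eq:
  assumes U: "U \<subseteq> obj C" "zob \<in> U" "\<And>A B S. A \<in> U \<Longrightarrow> B \<in> U \<Longrightarrow> bsum A B S \<Longrightarrow> S \<in> U"
    "\<And>A. A \<in> U \<Longrightarrow> SO A \<in> U"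
  shows "ImK0 C n N T U = cl ` U"
proof -
  have rep: "fsupp (isocls C ` U) \<subseteq> {f \<in> Fcarrier C. \<exists>A\<in>U. f - gen C A \<in> R}"
    by (rule representable) (fact U)+
  have "ImK0 C n N T U = cos ` fsupp (isocls C ` U)"
  proof -
    have "f \<in> Fcarrier C \<and> (\<forall>c. f c \<noteq> 0 \<longrightarrow> (\<exists>A\<in>U. c = isocls C A)) \<longleftrightarrow> f \<in> fsupp (isocls C ` U)" for f
    proof -
      have "c \<in> isocls C ` obj C" if "c \<in> isocls C ` U" for c using that U(1) by blast
      moreover have "(\<exists>A\<in>U. c = isocls C A) \<longleftrightarrow> c \<in> isocls C ` U" for c by blast
      ultimately show ?thesis unfolding Fcarrier_def fsupp_def by simp metis
    qed
    then have "ImK0 C n N T U = {cos f | f. f \<in> fsupp (isocls C ` U)}" unfolding ImK0_def by (simp only:)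
    then show ?thesis by (simp only: Setcompr_eq_image Collect_mem_eq)
  qed
  also have "\<dots> = cl ` U"
  proof (intro equalityI subsetI)
    fix x assume "x \<in> cos ` fsupp (isocls C ` U)"
    then obtain f where f: "x = cos f" "f \<in> fsupp (isocls C ` U)" by blast
    then obtain A where "f \<in> Fcarrier C" "A \<in> U" "f - gen C A \<in> R"
      using rep by blast
    then show "x \<in> cl ` U" using cos_eq_iff[of f "gen C A"] gen_Fcarrier U(1) f(1) cl_eq by blast
  next
    fix x assume "x \<in> cl ` U"
    then show "x \<in> cos ` fsupp (isocls C ` U)"
      by (auto simp: cl_eq gen_eq_ind intro!: imageI ind_in_fsupp)
  qed
  finally show ?thesis .
qed

section \<open>Thomason's argument\<close>

text \<open>The kernel to Thomason's group contains the class of an object exactly when the object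
  lies in U. Once it contains \<open>R\<close>, an equality of \<open>cl A\<close> with the class of
  an object of U forces the class of A into it.\<close>

lemma dense_complete_detects:
  assumes U: "n_ang_subcat C SO SM n N U NX" and complete: "subcat_complete n N U"
    and dense: "subcat_dense C U" and A: "A \<in> obj C" "cl A \<in> cl ` U"
  shows "A \<in> U"
proof -
  note closed = n_ang_subcatD[OF U]
  interpret M: comm_monoid sum_monoid by (rule comm_monoid_sum_monoid)
  have M: "carrier sum_monoid = isocls C ` obj C" "mult sum_monoid = addcls" "\<one>\<^bsub>sum_monoid\<^esub> = isocls C zob"
    by (simp_all add: sum_monoid_def)
  have mem: "isocls C B \<in> isocls C ` U \<longleftrightarrow> B \<in> U" if "B \<in> obj C" for B
    using that closed(1,2) isocls_eq_iff by blast
  show ?thesis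
  proof (rule M.dense_submonoid_relations[of "isocls C ` U"])
    show "isocls C ` U \<subseteq> carrier sum_monoid" "\<one>\<^bsub>sum_monoid\<^esub> \<in> isocls C ` U"
      using closed(1,3) by (auto simp: M)
    show "a \<otimes>\<^bsub>sum_monoid\<^esub> b \<in> isocls C ` U" if ab: "a \<in> isocls C ` U" "b \<in> isocls C ` U" for a b
    proof -
      obtain A B where AB: "a = isocls C A" "b = isocls C B" "A \<in> U" "B \<in> U" using ab by blast
      obtain S where S: "bsum A B S" using bsum_exists[of A B] AB closed(1) by blast
      then show ?thesis using closed(4)[OF _ _ S] AB by (simp add: M addcls_isocls)
    qed
    show "a \<in> isocls C ` U"
      if ab: "a \<in> carrier sum_monoid" "b \<in> isocls C ` U" "a \<otimes>\<^bsub>sum_monoid\<^esub> b \<in> isocls C ` U" for a b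
    proof -
      obtain A B where AB: "a = isocls C A" "b = isocls C B" "A \<in> obj C" "B \<in> U" using ab by (auto simp: M)
      obtain S where S: "bsum A B S" using bsum_exists[of A B] AB closed(1) by blast
      then have "S \<in> U" using ab(3) mem bsum_obj[OF S] by (simp add: AB M addcls_isocls)
      \<comment> \<open>Cancellation in the monoid is completeness of U, through the n-angle A, S,
        B, 0, ..., 0.\<close>
      then show ?thesis
        using complete_cancel[OF complete zob closed(3) _ S] closed(2) AB by blast
    qed
    show "\<exists>b\<in>carrier sum_monoid. a \<otimes>\<^bsub>sum_monoid\<^esub> b \<in> isocls C ` U" if a: "a \<in> carrier sum_monoid" for a
    proof -
      obtain A where A: "a = isocls C A" "A \<in> obj C" using a by (auto simp: M)
      obtain S B where S: "S \<in> U" "bsum A B S"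
        using dense A(2) unfolding subcat_dense_def bsum_def by blast
      then show ?thesis using bsum_obj[OF S(2)] addcls_isocls[OF S(2)] by (auto simp: A M)
    qed
  next
    \<comment> \<open>This local \<open>K\<close> is the kernel to Thomason's group and shadows the
      abbreviation for the Grothendieck ring.\<close>
    fix K assume K: "addsub K" "K \<subseteq> fsupp (carrier sum_monoid)"
      "\<And>a b. a \<in> carrier sum_monoid \<Longrightarrow> b \<in> carrier sum_monoid \<Longrightarrow> ind (a \<otimes>\<^bsub>sum_monoid\<^esub> b) - ind a - ind b \<in> K"
      "\<And>a. a \<in> carrier sum_monoid \<Longrightarrow> ind a \<in> K \<longleftrightarrow> a \<in> isocls C ` U"
    have sum: "gen C S - gen C A - gen C B \<in> K" if S: "bsum A B S" for A B S
      using K(3)[of "isocls C A" "isocls C B"] bsum_obj[OF S] addcls_isocls[OF S]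
      by (simp add: M gen_eq_ind)
    have gen: "gen C B \<in> K \<longleftrightarrow> B \<in> U" if "B \<in> obj C" for B
      using K(4) mem that by (simp add: M gen_eq_ind)
    have chi: "chi C n Y \<in> K" if Y: "Y \<in> N" for Y
    proof -
      \<comment> \<open>No object has to be preserved, so filling starts from m0 = 0. Completeness
        then puts the last object into U too, and every term of the new Euler characteristic lies in
        K.\<close>
      have "\<exists>Y'\<in>N. (\<forall>i\<in>{1..n - 1}. fst Y' i \<in> U) \<and> (\<forall>i\<in>{1..0}. fst Y' i = fst Y i) \<and>
        (2 \<le> (0::nat) \<longrightarrow> snd Y' 1 = snd Y 1) \<and> chi C n Y' - chi C n Y \<in> K"
        by (rule angle_fill[OF dense K(1) sum Y]) auto
      then obtain Y' where Y': "Y' \<in> N" "\<forall>i\<in>{1..n - 1}. fst Y' i \<in> U" "chi C n Y' - chi C n Y \<in> K"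
        by blast
      have "chi C n Y' \<in> K"
        unfolding chi_eq_altsum using gen angle_obj complete_last[OF complete Y'(1,2)] Y'(1)
        by (intro altsum_in_addsub[OF K(1)]) blast
      from addsub_diff[OF K(1) this Y'(3)] show ?thesis by simp
    qed
    have "R \<subseteq> K"
      using K(1,2) chi by (intro R_least) (simp_all add: M Fcarrier_eq)
    obtain B where B: "B \<in> U" "cl A = cl B" using A(2) by blast
    then have "gen C A - gen C B \<in> R"
      using cos_eq_iff gen_Fcarrier A(1) closed(1) unfolding cl_eq by blast
    then have "gen C A - gen C B \<in> K" using \<open>R \<subseteq> K\<close> by blast
    moreover have "gen C B \<in> K" using gen B(1) closed(1) by blast
    ultimately have "gen C A \<in> K" using addsub_add[OF K(1)] by fastforce
    then show "A \<in> U" using gen A(1) by blast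
  qed
qed

section \<open>The correspondence\<close>

lemma subcat_of_ideal_eq: "subcat_of_ideal C n N T H = {A \<in> obj C. cl A \<in> H}"
  by (simp add: subcat_of_ideal_def)

lemma tensor_ideal_ImK0:
  assumes "n_ang_tensor_ideal C SO SM n N T U NX"
  shows "ImK0 C n N T U = cl ` U"
proof -
  have "n_ang_subcat C SO SM n N U NX" using assms by (simp add: n_ang_tensor_ideal_def)
  note closed = n_ang_subcatD[OF this]
  show ?thesis by (rule ImK0_eq) (fact closed)+
qed

text \<open>Sums and negatives are realised by direct sums and shifts. Absorption is tested on
  objects, since every ring element is the class of one, and there it is closure of U under
  tensoring.\<close>

lemma ideal_ImK0:
  assumes "n_ang_tensor_ideal C SO SM n N T U NX"
  shows "ideal (ImK0 C n N T U) K"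
proof -
  have U: "n_ang_subcat C SO SM n N U NX" and tensor: "\<And>A B. A \<in> U \<Longrightarrow> B \<in> obj C \<Longrightarrow> tob T B A \<in> U"
    using assms by (auto simp: n_ang_tensor_ideal_def)
  note closed = n_ang_subcatD[OF U]
  show ?thesis
    unfolding tensor_ideal_ImK0[OF assms]
  proof (rule idealI)
    show "subgroup (cl ` U) (add_monoid K)"
    proof (rule K0.add.subgroupI)
      show "cl ` U \<subseteq> carrier K" "cl ` U \<noteq> {}" using cl_carrier closed(1,3) by auto
      fix x assume "x \<in> cl ` U"
      then obtain A where A: "A \<in> U" "x = cl A" by blast
      then have "\<ominus>\<^bsub>K\<^esub> x = cl (SO A)" using cl_shift closed(1) by auto
      then show "\<ominus>\<^bsub>K\<^esub> x \<in> cl ` U" using closed(5) A by blast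
      fix y assume "y \<in> cl ` U"
      then obtain B where B: "B \<in> U" "y = cl B" by blast
      obtain S where S: "bsum A B S" using bsum_exists[of A B] A B closed(1) by blast
      then show "x \<oplus>\<^bsub>K\<^esub> y \<in> cl ` U"
        using cl_bsum[OF S] closed(4)[OF _ _ S] A B by auto
    qed
    fix a x assume "a \<in> cl ` U" and x: "x \<in> carrier K"
    then obtain A B where A: "A \<in> U" "a = cl A" and B: "B \<in> obj C" "x = cl B"
      by (auto simp: carrier_K)
    have "x \<otimes>\<^bsub>K\<^esub> a = cl (tob T B A)" using cl_tob A B closed(1) by auto
    then show "x \<otimes>\<^bsub>K\<^esub> a \<in> cl ` U" using tensor A B by blast
    then show "a \<otimes>\<^bsub>K\<^esub> x \<in> cl ` U"
      using K0.m_comm[of a x] x A cl_carrier closed(1) by auto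
  qed (rule K0.ring_axioms)
qed

lemma subcat_of_ImK0:
  assumes "n_ang_tensor_ideal C SO SM n N T U NX" "subcat_complete n N U" "subcat_dense C U"
  shows "subcat_of_ideal C n N T (ImK0 C n N T U) = U"
proof -
  have U: "n_ang_subcat C SO SM n N U NX" using assms(1) by (simp add: n_ang_tensor_ideal_def)
  show ?thesis
    unfolding subcat_of_ideal_eq tensor_ideal_ImK0[OF assms(1)]
    using dense_complete_detects[OF U assms(2,3)] n_ang_subcatD(1)[OF U] by blast
qed

section \<open>The subcategory attached to an ideal\<close>

context
  fixes H assumes H: "ideal H K"
begin

interpretation H: ideal H K by (rule H)

abbreviation AH where "AH \<equiv> subcat_of_ideal C n N T H"

lemma AH_iff: "A \<in> AH \<longleftrightarrow> A \<in> obj C \<and> cl A \<in> H"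
  by (simp add: subcat_of_ideal_eq)

lemma AH_bsum: "A \<in> AH \<Longrightarrow> B \<in> AH \<Longrightarrow> bsum A B S \<Longrightarrow> S \<in> AH"
  using bsum_obj cl_bsum H.a_closed by (auto simp: AH_iff)

lemma AH_shift: "A \<in> obj C \<Longrightarrow> SO A \<in> AH \<longleftrightarrow> A \<in> AH"
  using cl_shift H.a_inv_closed K0.minus_minus[OF cl_carrier] by (metis AH_iff SO_obj)

lemma AH_zob: "zob \<in> AH"
  by (simp add: AH_iff cl_zob H.zero_closed)

lemma AH_dense: "subcat_dense C AH"
  unfolding subcat_dense_def
proof
  fix A assume A: "A \<in> obj C"
  obtain S where S: "bsum A (SO A) S" using bsum_exists[OF A SO_obj[OF A]] by blast
  then have "cl S = \<zero>\<^bsub>K\<^esub>" using cl_bsum[OF S] cl_shift[OF A] K0.r_neg cl_carrier[OF A] by simp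
  then have "S \<in> AH" using bsum_obj[OF S] H.zero_closed by (simp add: AH_iff)
  then show "\<exists>S\<in>AH. \<exists>B i1 i2 p1 p2. biprod C A B S i1 i2 p1 p2" using S unfolding bsum_def by blast
qed

text \<open>The preimage of H in the free abelian group is a subgroup containing \<open>R\<close>,
  hence all Euler characteristics; so the class of one object of an n-angle is determined modulo
  this subgroup by the others.\<close>

lemma AH_complete: "subcat_complete n N AH"
  unfolding subcat_complete_def
proof (intro ballI impI)
  let ?K = "{f \<in> Fcarrier C. cos f \<in> H}"
  have K: "addsub ?K"
    unfolding addsub_def
  proof (intro conjI ballI)
    show "0 \<in> ?K"
      using addsub_zero[OF addsub_Fcarrier] cos_zero[OF addsub_zero[OF addsub_R]] H.zero_closed by simp
    fix f g assume "f \<in> ?K" "g \<in> ?K"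
    then have f: "f \<in> Fcarrier C" "cos f \<in> H" and g: "g \<in> Fcarrier C" "cos g \<in> H" by auto
    have d: "f - g \<in> Fcarrier C" using addsub_diff[OF addsub_Fcarrier f(1) g(1)] .
    have "cos f = cos (f - g) \<oplus>\<^bsub>K\<^esub> cos g" using cos_add[OF d g(1)] by simp
    then have "cos (f - g) = cos f \<oplus>\<^bsub>K\<^esub> (\<ominus>\<^bsub>K\<^esub> cos g)"
      using cos_carrier[OF d] cos_carrier[OF g(1)] by (simp add: K0.a_assoc K0.r_neg)
    then have "cos (f - g) \<in> H" using H.a_closed[OF f(2) H.a_inv_closed[OF g(2)]] by (simp only:)
    then show "f - g \<in> ?K" using d by blast
  qed
  fix Y j assume Y: "Y \<in> N" and j: "j \<in> {1..n}" and all: "\<forall>i\<in>{1..n} - {j}. fst Y i \<in> AH"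
  have "altsum C n (fst Y) \<in> ?K"
    using chi_in_R[OF Y] R_subset cos_zero H.zero_closed by (auto simp: chi_eq_altsum)
  then have "gen C (fst Y j) \<in> ?K"
  proof (rule altsum_remaining[OF K _ j])
    fix i assume "i \<in> {1..n} - {j}"
    then have "fst Y i \<in> AH" using all by blast
    then show "gen C (fst Y i) \<in> ?K" using gen_Fcarrier by (simp add: AH_iff cl_eq)
  qed
  then show "fst Y j \<in> AH" using angle_obj[OF Y j] by (simp add: AH_iff cl_eq)
qed

lemma AH_tensor_ideal: "n_ang_tensor_ideal C SO SM n N T AH (angles_in n N AH)"
  unfolding n_ang_tensor_ideal_def
proof (intro conjI ballI)
  show "n_ang_subcat C SO SM n N AH (angles_in n N AH)"
  proof (rule angulated_subcat)
    show "B \<in> AH" if "A \<in> AH" "isomorphic C A B" for A B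
      using that cl_isomorphic[OF that(2)] isomorphic_obj[OF that(2)] by (simp add: AH_iff)
    show "AH \<subseteq> obj C" by (auto simp: subcat_of_ideal_eq)
  qed (fact AH_zob AH_dense AH_complete | erule AH_bsum, assumption+ | erule AH_shift)+
  show "tob T B A \<in> AH" if "A \<in> AH" "B \<in> obj C" for A B
    using that H.I_l_closed cl_carrier by (auto simp: AH_iff tob_obj cl_tob)
qed

text \<open>An element of H is the class of some object, and that object lies in \<open>AH\<close>
  by definition.\<close>

lemma ImK0_AH: "ImK0 C n N T AH = H"
proof -
  have "H \<subseteq> cl ` obj C" using H.a_subset carrier_K by simp
  then show ?thesis
    unfolding tensor_ideal_ImK0[OF AH_tensor_ideal] by (auto simp: AH_iff)
qed

end

text \<open>By \<open>subcat_of_ImK0\<close>, the class of A lies in the image exactly when A lies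
  in U. So properness and primality pass from objects to ring elements, products being classes of
  tensor products.\<close>

lemma primeideal_ImK0:
  assumes "n_ang_tensor_prime_ideal C SO SM n N T U NX" "subcat_complete n N U" "subcat_dense C U"
  shows "primeideal (ImK0 C n N T U) K"
proof -
  have ideal: "n_ang_tensor_ideal C SO SM n N T U NX" and proper: "U \<noteq> obj C"
    and prime: "\<And>A B. A \<in> obj C \<Longrightarrow> B \<in> obj C \<Longrightarrow> tob T A B \<in> U \<Longrightarrow> A \<in> U \<or> B \<in> U"
    using assms(1) by (auto simp: n_ang_tensor_prime_ideal_def)
  have mem: "cl A \<in> ImK0 C n N T U \<longleftrightarrow> A \<in> U" if "A \<in> obj C" for A
    using subcat_of_ImK0[OF ideal assms(2,3)] that unfolding subcat_of_ideal_eq by blast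
  show ?thesis
  proof (rule primeidealI[OF ideal_ImK0[OF ideal] cring_K])
    have "U \<subseteq> obj C" using n_ang_subcatD(1) ideal unfolding n_ang_tensor_ideal_def by blast
    then show "carrier K \<noteq> ImK0 C n N T U" using proper mem cl_carrier by blast
    fix a b assume ab: "a \<in> carrier K" "b \<in> carrier K" "a \<otimes>\<^bsub>K\<^esub> b \<in> ImK0 C n N T U"
    then obtain A B where AB: "A \<in> obj C" "B \<in> obj C" "a = cl A" "b = cl B" by (auto simp: carrier_K)
    then have "tob T A B \<in> U" using ab(3) mem tob_obj by (simp add: cl_tob[symmetric])
    then show "a \<in> ImK0 C n N T U \<or> b \<in> ImK0 C n N T U" using prime mem AB by blast
  qed
qed

text \<open>If every object lay in the subcategory, H would contain all classes and be the whole
  ring; this gives properness. Primality is that of H, read on classes of objects.\<close>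

lemma AH_prime:
  assumes "primeideal H K"
  shows "n_ang_tensor_prime_ideal C SO SM n N T (subcat_of_ideal C n N T H)
    (angles_in n N (subcat_of_ideal C n N T H))"
proof -
  interpret H: primeideal H K by (rule assms)
  have "carrier K \<subseteq> H" if "subcat_of_ideal C n N T H = obj C"
    using that unfolding subcat_of_ideal_eq carrier_K by blast
  then have "subcat_of_ideal C n N T H \<noteq> obj C" using H.I_notcarr H.a_subset by blast
  moreover have "A \<in> subcat_of_ideal C n N T H \<or> B \<in> subcat_of_ideal C n N T H"
    if "A \<in> obj C" "B \<in> obj C" "tob T A B \<in> subcat_of_ideal C n N T H" for A B
    using that H.I_prime[of "cl A" "cl B"] cl_carrier by (auto simp: subcat_of_ideal_eq cl_tob)
  ultimately show ?thesis
    unfolding n_ang_tensor_prime_ideal_def using AH_tensor_ideal[OF H.is_ideal] by blast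
qed

end

theorem theorem5p2:
  fixes C :: "('o, 'm) cat" and SO :: "'o \<Rightarrow> 'o" and SM :: "'m \<Rightarrow> 'm"
    and n :: nat and N :: "('o, 'm) nseq set" and T :: "('o, 'm) tensor"
  assumes "n \<ge> 3" and "odd n"
    and "tensor_n_angulated C SO SM n N T"
  defines "SA \<equiv> {U. \<exists>NX. n_ang_tensor_ideal C SO SM n N T U NX \<and>
                          subcat_complete n N U \<and> subcat_dense C U}"
    and "SP \<equiv> {U. \<exists>NX. n_ang_tensor_prime_ideal C SO SM n N T U NX \<and>
                          subcat_complete n N U \<and> subcat_dense C U}"
    and "IA \<equiv> {H. ideal H (K0 C n N T)}"
    and "IP \<equiv> {H. primeideal H (K0 C n N T)}"
  shows
    "(\<forall>U \<in> SA. ImK0 C n N T U \<in> IA) \<and>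
     (\<forall>H \<in> IA. subcat_of_ideal C n N T H \<in> SA) \<and>
     (\<forall>U \<in> SA. subcat_of_ideal C n N T (ImK0 C n N T U) = U) \<and>
     (\<forall>H \<in> IA. ImK0 C n N T (subcat_of_ideal C n N T H) = H) \<and>
     (\<forall>H \<in> IA. n_ang_tensor_ideal C SO SM n N T (subcat_of_ideal C n N T H)
                  (angles_in n N (subcat_of_ideal C n N T H))) \<and>
     (\<forall>U \<in> SP. ImK0 C n N T U \<in> IP) \<and>
     (\<forall>H \<in> IP. subcat_of_ideal C n N T H \<in> SP) \<and>
     (\<forall>U \<in> SP. subcat_of_ideal C n N T (ImK0 C n N T U) = U) \<and>
     (\<forall>H \<in> IP. ImK0 C n N T (subcat_of_ideal C n N T H) = H) \<and>
     (\<forall>H \<in> IP. n_ang_tensor_prime_ideal C SO SM n N T (subcat_of_ideal C n N T H)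
                  (angles_in n N (subcat_of_ideal C n N T H)))"
proof -
  interpret odd_tensor_angulated C SO SM n N T
    using assms(1-3) by unfold_locales (simp_all add: tensor_n_angulated_def)
  \<comment> \<open>Prime tensor ideals are tensor ideals and prime ideals are ideals, so both
    inverse identities in the prime case are restrictions of the general ones.\<close>
  have SP_SA: "U \<in> SP \<Longrightarrow> U \<in> SA" for U
    unfolding SA_def SP_def n_ang_tensor_prime_ideal_def by blast
  have IP_IA: "H \<in> IP \<Longrightarrow> H \<in> IA" for H
    unfolding IA_def IP_def by (auto dest: primeideal.axioms(1))
  have 1: "\<forall>U \<in> SA. ImK0 C n N T U \<in> IA"
    unfolding SA_def IA_def using ideal_ImK0 by blast
  have 2: "\<forall>H \<in> IA. subcat_of_ideal C n N T H \<in> SA"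
    unfolding SA_def IA_def using AH_tensor_ideal AH_complete AH_dense by blast
  have 3: "\<forall>U \<in> SA. subcat_of_ideal C n N T (ImK0 C n N T U) = U"
    unfolding SA_def using subcat_of_ImK0 by blast
  have 4: "\<forall>H \<in> IA. ImK0 C n N T (subcat_of_ideal C n N T H) = H"
    unfolding IA_def using ImK0_AH by blast
  have 5: "\<forall>H \<in> IA. n_ang_tensor_ideal C SO SM n N T (subcat_of_ideal C n N T H)
                  (angles_in n N (subcat_of_ideal C n N T H))"
    unfolding IA_def using AH_tensor_ideal by blast
  have 6: "\<forall>U \<in> SP. ImK0 C n N T U \<in> IP"
    unfolding SP_def IP_def using primeideal_ImK0 by blast
  have 10: "\<forall>H \<in> IP. n_ang_tensor_prime_ideal C SO SM n N T (subcat_of_ideal C n N T H)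
                  (angles_in n N (subcat_of_ideal C n N T H))"
    unfolding IP_def using AH_prime by blast
  have 7: "\<forall>H \<in> IP. subcat_of_ideal C n N T H \<in> SP"
  proof
    fix H assume H: "H \<in> IP"
    then have "ideal H (K0 C n N T)" using IP_IA by (simp add: IA_def)
    then show "subcat_of_ideal C n N T H \<in> SP"
      unfolding SP_def using 10 H AH_complete AH_dense by blast
  qed
  have 8: "\<forall>U \<in> SP. subcat_of_ideal C n N T (ImK0 C n N T U) = U"
    using 3 SP_SA by blast
  have 9: "\<forall>H \<in> IP. ImK0 C n N T (subcat_of_ideal C n N T H) = H"
    using 4 IP_IA by blast
  show ?thesis by (intro conjI) (fact 1 2 3 4 5 6 7 8 9 10)+
qed

end
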